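(* Let $E$ be a metrizable Lusin space, $m$ a positive $\sigma$-finite measure with full support on the Borel $\sigma$-field $\mathcal{B}(E)$, and $(\mathcal{E},D(\mathcal{E}))$ a quasi-regular (not necessarily symmetric) Dirichlet form on $L^2(E;m)$. Assume that $(\mathcal{E},D(\mathcal{E}))$ is transient and let $\mu\in\mathcal{M}_b$. Then $\mu\in\mathcal{M}_{0,b}$ if and only if there exist $f\in L^1(E;m)$ and $\nu\in\mathcal{F}_e^*\cap\mathcal{M}_b$ such that $$\mu=f\cdot m+\nu,$$ i.e. for every bounded $u\in\mathcal{F}_e$, $$\langle\mu,\tilde u\rangle=(f,u)+\langle\nu,\tilde u\rangle.$$
   Context: Dirichlet form: $D(\mathcal{E})$ is a dense linear subspace of $L^2(E;m)$ and $\mathcal{E}$ is a bilinear form on it such that its symmetric part $\tilde{\mathcal{E}}(u,v)=\frac12(\mathcal{E}(u,v)+\mathcal{E}(v,u))$ is a nonnegative closed form; with $\mathcal{E}_\alpha(u,v)=\mathcal{E}(u,v)+\alpha\int_E uv\,dm$ (and similarly $\tilde{\mathcal{E}}_\alpha$), the weak sector condition $|\mathcal{E}_1(u,v)|\le K\mathcal{E}_1(u,u)^{1/2}\mathcal{E}_1(v,v)^{1/2}$ holds for some $K$; and for every $u\in D(\mathcal{E})$, $u^+\wedge 1\in D(\mathcal{E})$ and $\mathcal{E}(u+u^+\wedge1,u-u^+\wedge1)\ge0$, $\mathcal{E}(u-u^+\wedge1,u+u^+\wedge1)\ge0$. An $\mathcal{E}$-nest is an increasing sequence $\{F_k\}$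 of closed subsets of $E$ such that $\bigcup_k\{u\in D(\mathcal{E}):u=0\ m\text{-a.e. on }E\setminus F_k\}$ is dense in $D(\mathcal{E})$ for the norm $\mathcal{E}_1(u,u)^{1/2}$. A set $N\subset E$ is $\mathcal{E}$-exceptional if $N\subset\bigcap_k(E\setminus F_k)$ for some $\mathcal{E}$-nest $\{F_k\}$; "$\mathcal{E}$-q.e." means outside an $\mathcal{E}$-exceptional set. A function $f$ is $\mathcal{E}$-quasi-continuous if $f|_{F_k}$ is continuous for every $k$, for some $\mathcal{E}$-nest $\{F_k\}$. The form is quasi-regular if: (i) there is an $\mathcal{E}$-nest of compact sets; (ii) some $\tilde{\mathcal{E}}_1^{1/2}$-dense subset of $D(\mathcal{E})$ consists of elements having $\mathcal{E}$-quasi-continuous $m$-versions; (iii) there are $u_n\in D(\mathcal{E})$, $n\in\mathbb{N}$, with $\mathcal{E}$-quasi-continuous $m$-versions $\tilde u_n$, and an $\mathcal{E}$-exceptional set $N$, such that $\{\tilde u_n\}$ separates the points of $E\setminus N$. Extended Dirichlet space: $\mathcal{F}_e$ is the set of ($m$-classes of) $m$-a.e. finite measurable functions $u$ for which there is an $\tilde{\mathcal{E}}$-Cauchy sequence $\{u_n\}\subset D(\mathcal{E})$ with $u_n\to u$ $m$-a.e. (an approximating sequence); $\mathcal{E}(u,u)=\lim_n\mathcal{E}(u_n,u_n)$. The form is transient if there is a bounded $g\in L^1(E;m)$, $g>0$ $m$-a.e., with $\int_E|u|g\,dm\le\mathcal{E}(u,u)^{1/2}$ for all $u\in D(\mathcal{E})$;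 then $(\mathcal{F}_e,\tilde{\mathcal{E}})$ is a Hilbert space, and $\mathcal{F}_e^*$ denotes its dual space. Every $u\in\mathcal{F}_e$ then has an $\mathcal{E}$-quasi-continuous $m$-version, denoted $\tilde u$, which is $\mathcal{E}$-q.e. unique. Measures: $\mathcal{M}_b$ is the set of signed Borel measures $\mu$ on $E$ with $|\mu|(E)<\infty$ ($|\mu|$ the total variation measure). A positive measure $\mu$ on $\mathcal{B}(E)$ is $\mathcal{E}$-smooth ($\mu\in S$) if $\mu(B)=0$ for all $\mathcal{E}$-exceptional $B\in\mathcal{B}(E)$ and there is an $\mathcal{E}$-nest $\{F_k\}$ of compact sets with $\mu(F_k)<\infty$ for all $k$. $\mathcal{M}_{0,b}=\{\mu\in\mathcal{M}_b:|\mu|\in S\}$. $\mathcal{F}_e^*\cap\mathcal{M}_b$ is the set of measures in $\mathcal{M}_b$ that are bounded linear functionals on $(\mathcal{F}_e,\tilde{\mathcal{E}})$ (acting by integration). Notation: $\langle\mu,u\rangle=\int_E u\,d\mu$ whenever the integral is well defined, $(f,u)=\int_E fu\,dm$, and $f\cdot m$ is the measure with density $f$ with respect to $m$. *)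

theory Defs
  imports "HOL-Analysis.Analysis"
begin

section \<open>Lusin spaces\<close>

text \<open>
  A Lusin space is a Hausdorff space that is the image of a Polish space under a continuous
  bijection. As the map is bijective, the Polish space may be carried by the type of the target.
\<close>

definition lusin_space :: "'a topology \<Rightarrow> bool" where
  "lusin_space X \<longleftrightarrow> Hausdorff_space X \<and>
     (\<exists>(Y :: 'a topology) h. completely_metrizable_space Y \<and> second_countable Y \<and>
        continuous_map Y X h \<and> bij_betw h (topspace Y) (topspace X))"

definition full_support :: "'a::topological_space measure \<Rightarrow> bool" where
  "full_support m \<longleftrightarrow> (\<forall>U. open U \<and> U \<noteq> {} \<longrightarrow> 0 < emeasure m U)"


section \<open>Signed Borel measures\<close>

text \<open>
  A finite signed measure is a real-valued set function; only its values on Borel sets matter.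
\<close>

definition signed_measure :: "('a::topological_space set \<Rightarrow> real) \<Rightarrow> bool" where
  "signed_measure \<mu> \<longleftrightarrow>
     (\<forall>A :: nat \<Rightarrow> 'a set. range A \<subseteq> sets borel \<longrightarrow> disjoint_family A \<longrightarrow>
        (\<lambda>n. \<mu> (A n)) sums \<mu> (\<Union>n. A n))"

text \<open>
  Jordan decomposition: the positive part is the upper variation
  \<open>\<mu>\<^sup>+(A) = sup {\<mu>(B) | B \<subseteq> A}\<close>, the negative part is the upper variation of \<open>-\<mu>\<close>, and
  \<open>|\<mu>| = \<mu>\<^sup>+ + \<mu>\<^sup>-\<close>. The lemmas below show that \<^const>\<open>measure_of\<close> is applied to genuine measures.
\<close>

definition upper_var :: "('a::topological_space set \<Rightarrow> real) \<Rightarrow> 'a set \<Rightarrow> ennreal" where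
  "upper_var \<mu> A = (SUP B\<in>{B \<in> sets borel. B \<subseteq> A}. ennreal (\<mu> B))"

definition pos_part :: "('a::topological_space set \<Rightarrow> real) \<Rightarrow> 'a measure" where
  "pos_part \<mu> = measure_of UNIV (sets borel) (upper_var \<mu>)"

definition neg_part :: "('a::topological_space set \<Rightarrow> real) \<Rightarrow> 'a measure" where
  "neg_part \<mu> = pos_part (\<lambda>A. - \<mu> A)"

definition total_var :: "('a::topological_space set \<Rightarrow> real) \<Rightarrow> 'a measure" where
  "total_var \<mu> =
     measure_of UNIV (sets borel) (\<lambda>A. emeasure (pos_part \<mu>) A + emeasure (neg_part \<mu>) A)"

definition bounded_measures :: "('a::topological_space set \<Rightarrow> real) set" where
  "bounded_measures = {\<mu>. signed_measure \<mu> \<and> emeasure (total_var \<mu>) UNIV < \<infinity>}"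

definition signed_integrable :: "('a::topological_space set \<Rightarrow> real) \<Rightarrow> ('a \<Rightarrow> real) \<Rightarrow> bool" where
  "signed_integrable \<mu> u \<longleftrightarrow> integrable (total_var \<mu>) u"

definition signed_integral :: "('a::topological_space set \<Rightarrow> real) \<Rightarrow> ('a \<Rightarrow> real) \<Rightarrow> real" where
  "signed_integral \<mu> u = integral\<^sup>L (pos_part \<mu>) u - integral\<^sup>L (neg_part \<mu>) u"

lemma signed_measure_sums:
  assumes "signed_measure \<mu>" "\<And>n::nat. A n \<in> sets borel" "disjoint_family A"
  shows "(\<lambda>n. \<mu> (A n)) sums \<mu> (\<Union>n. A n)"
  using assms unfolding signed_measure_def by blast

lemma signed_measure_empty:
  assumes "signed_measure \<mu>"
  shows "\<mu> {} = 0"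
proof -
  have "(\<lambda>n::nat. \<mu> {}) sums \<mu> (\<Union>n::nat. {})"
    using assms by (rule signed_measure_sums) (simp_all add: disjoint_family_on_def)
  then have "(\<lambda>n::nat. \<mu> {}) \<longlonglongrightarrow> 0"
    using summable_LIMSEQ_zero sums_summable by blast
  then show ?thesis
    by (simp add: LIMSEQ_const_iff)
qed

lemma signed_measure_add:
  assumes "signed_measure \<mu>" "A \<in> sets borel" "B \<in> sets borel" "A \<inter> B = {}"
  shows "\<mu> (A \<union> B) = \<mu> A + \<mu> B"
proof -
  define S where "S = binaryset A B"
  have "(\<lambda>n. \<mu> (S n)) sums \<mu> (\<Union>n. S n)"
    using assms(1)
  proof (rule signed_measure_sums)
    show "S n \<in> sets borel" for n
      using assms(2,3) by (simp add: S_def binaryset_def)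
    show "disjoint_family S"
      using assms(4) by (auto simp: S_def binaryset_def disjoint_family_on_def split: if_splits)
  qed
  moreover have "(\<lambda>n. \<mu> (S n)) sums (\<mu> A + \<mu> B)"
    unfolding S_def using signed_measure_empty[OF assms(1)] by (rule binaryset_sums)
  ultimately show ?thesis
    by (metis S_def UN_binaryset_eq sums_unique2)
qed

lemma signed_measure_uminus:
  "signed_measure \<mu> \<Longrightarrow> signed_measure (\<lambda>A. - \<mu> A)"
  unfolding signed_measure_def by (auto intro: sums_minus)

lemma upper_var_finite_sum:
  fixes A :: "nat \<Rightarrow> 'a::topological_space set"
  assumes "signed_measure \<mu>" "disjoint_family A" "range A \<subseteq> sets borel"
  shows "(\<Sum>i<n. upper_var \<mu> (A i)) \<le> upper_var \<mu> (\<Union>i<n. A i)"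
proof (induction n)
  case 0
  show ?case by simp
next
  case (Suc n)
  let ?C = "\<Union>i<n. A i"
  have disj: "?C \<inter> A n = {}"
  proof -
    have "A i \<inter> A n = {}" if "i < n" for i
      using assms(2) that by (intro disjoint_family_onD) auto
    then show ?thesis by blast
  qed
  let ?S = "\<lambda>A. {B \<in> sets borel. B \<subseteq> A} :: 'a set set"
  have "upper_var \<mu> ?C + upper_var \<mu> (A n)
      = (SUP B\<in>?S ?C. SUP B'\<in>?S (A n). ennreal (\<mu> B) + ennreal (\<mu> B'))"
  proof -
    have ne: "?S A \<noteq> {}" for A
      using sets.empty_sets by blast
    show ?thesis
      unfolding upper_var_def ennreal_SUP_add_left[OF ne, symmetric] ennreal_SUP_add_right[OF ne]
      by (rule SUP_commute)
  qed
  also have "\<dots> \<le> upper_var \<mu> (?C \<union> A n)"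
  proof (intro SUP_least)
    fix B B' assume B: "B \<in> ?S ?C" "B' \<in> ?S (A n)"
    define P where "P = (if \<mu> B \<ge> 0 then B else {})"
    define P' where "P' = (if \<mu> B' \<ge> 0 then B' else {})"
    have P: "P \<in> ?S ?C" "P' \<in> ?S (A n)"
      using B by (auto simp: P_def P'_def)
    have 0: "\<mu> {} = 0"
      by (rule signed_measure_empty[OF assms(1)])
    have "\<mu> P \<ge> 0" "\<mu> P' \<ge> 0" and eq: "ennreal (\<mu> B) = ennreal (\<mu> P)" "ennreal (\<mu> B') = ennreal (\<mu> P')"
      by (auto simp: P_def P'_def 0 ennreal_neg)
    then have "ennreal (\<mu> B) + ennreal (\<mu> B') = ennreal (\<mu> P + \<mu> P')"
      by simp
    also have "\<mu> P + \<mu> P' = \<mu> (P \<union> P')"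
      using P disj by (intro signed_measure_add[symmetric] assms) auto
    also have "ennreal (\<mu> (P \<union> P')) \<le> upper_var \<mu> (?C \<union> A n)"
      unfolding upper_var_def using P by (intro SUP_upper) auto
    finally show "ennreal (\<mu> B) + ennreal (\<mu> B') \<le> upper_var \<mu> (?C \<union> A n)" .
  qed
  also have "?C \<union> A n = (\<Union>i<Suc n. A i)"
    by (auto simp: lessThan_Suc)
  finally have "upper_var \<mu> ?C + upper_var \<mu> (A n) \<le> upper_var \<mu> (\<Union>i<Suc n. A i)" .
  then show ?case
    unfolding sum.lessThan_Suc by (rule order_trans[OF add_right_mono[OF Suc.IH]])
qed

lemma upper_var_measure:
  assumes "signed_measure \<mu>"
  shows "measure_space UNIV (sets borel) (upper_var \<mu>)"
  unfolding measure_space_def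
proof (intro conjI)
  show "sigma_algebra UNIV (sets (borel :: 'a measure))"
    using sets.sigma_algebra_axioms[of "borel :: 'a measure"] by simp
  show "positive (sets borel) (upper_var \<mu>)"
    using signed_measure_empty[OF assms] by (simp add: positive_def upper_var_def)
  show "countably_additive (sets borel) (upper_var \<mu>)"
  proof (intro countably_additiveI antisym)
    fix A :: "nat \<Rightarrow> 'a set"
    assume A: "range A \<subseteq> sets borel" "disjoint_family A" "(\<Union>i. A i) \<in> sets borel"
    show "(\<Sum>i. upper_var \<mu> (A i)) \<le> upper_var \<mu> (\<Union>i. A i)"
    proof (rule suminf_le_const)
      fix n
      have "upper_var \<mu> (\<Union>i<n. A i) \<le> upper_var \<mu> (\<Union>i. A i)"
        unfolding upper_var_def by (rule SUP_subset_mono) auto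
      then show "(\<Sum>i<n. upper_var \<mu> (A i)) \<le> upper_var \<mu> (\<Union>i. A i)"
        using upper_var_finite_sum[OF assms A(2,1)] order_trans by blast
    qed simp
    show "upper_var \<mu> (\<Union>i. A i) \<le> (\<Sum>i. upper_var \<mu> (A i))"
      unfolding upper_var_def[of \<mu> "\<Union>i. A i"]
    proof (intro SUP_least)
      fix B assume B: "B \<in> {B \<in> sets borel. B \<subseteq> (\<Union>i. A i)}"
      have *: "(\<lambda>n. \<mu> (B \<inter> A n)) sums \<mu> (\<Union>n. B \<inter> A n)"
        using assms
      proof (rule signed_measure_sums)
        show "B \<inter> A n \<in> sets borel" for n
          using A(1) B by auto
        show "disjoint_family (\<lambda>n. B \<inter> A n)"
          using A(2) unfolding disjoint_family_on_def by blast
      qed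
      have "(\<Union>n. B \<inter> A n) = B" using B by auto
      with * have sums: "(\<lambda>n. \<mu> (B \<inter> A n)) sums \<mu> B" by simp
      have le: "ennreal (\<mu> (B \<inter> A n)) \<le> upper_var \<mu> (A n)" for n
        unfolding upper_var_def using A B by (intro SUP_upper) auto
      have "ennreal (\<Sum>i<n. \<mu> (B \<inter> A i)) \<le> (\<Sum>i. upper_var \<mu> (A i))" for n
      proof -
        have "ennreal (\<Sum>i<n. \<mu> (B \<inter> A i)) \<le> ennreal (\<Sum>i<n. max 0 (\<mu> (B \<inter> A i)))"
          by (intro ennreal_leI sum_mono) simp
        also have "\<dots> = (\<Sum>i<n. ennreal (max 0 (\<mu> (B \<inter> A i))))"
          by (rule sum_ennreal[symmetric]) simp
        also have "\<dots> \<le> (\<Sum>i<n. upper_var \<mu> (A i))"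
          using le by (intro sum_mono) (simp add: max_def ennreal_neg)
        also have "\<dots> \<le> (\<Sum>i. upper_var \<mu> (A i))"
          by (rule sum_le_suminf) auto
        finally show ?thesis .
      qed
      moreover have "(\<lambda>n. ennreal (\<Sum>i<n. \<mu> (B \<inter> A i))) \<longlonglongrightarrow> ennreal (\<mu> B)"
        using sums unfolding sums_def by (rule tendsto_ennrealI)
      ultimately show "ennreal (\<mu> B) \<le> (\<Sum>i. upper_var \<mu> (A i))"
        by (intro LIMSEQ_le_const2[where X = "\<lambda>n. ennreal (\<Sum>i<n. \<mu> (B \<inter> A i))"]) auto
    qed
  qed
qed

lemma
  fixes \<mu> :: "'a::topological_space set \<Rightarrow> real"
  shows sets_pos_part [simp]: "sets (pos_part \<mu>) = sets borel"
  and sets_neg_part [simp]: "sets (neg_part \<mu>) = sets borel"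
  and sets_total_var [simp]: "sets (total_var \<mu>) = sets borel"
  using sets.sigma_sets_eq[of "borel :: 'a measure"]
  by (simp_all add: pos_part_def neg_part_def total_var_def)

lemma emeasure_pos_part:
  assumes "signed_measure \<mu>" "A \<in> sets borel"
  shows "emeasure (pos_part \<mu>) A = upper_var \<mu> A"
  using upper_var_measure[OF assms(1)] assms(2) unfolding pos_part_def measure_space_def
  by (intro emeasure_measure_of_sigma) auto

lemma emeasure_neg_part:
  assumes "signed_measure \<mu>" "A \<in> sets borel"
  shows "emeasure (neg_part \<mu>) A = upper_var (\<lambda>A. - \<mu> A) A"
  unfolding neg_part_def by (rule emeasure_pos_part[OF signed_measure_uminus assms(2)]) fact

lemma emeasure_total_var:
  assumes "A \<in> sets borel"
  shows "emeasure (total_var \<mu>) A = emeasure (pos_part \<mu>) A + emeasure (neg_part \<mu>) A"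
  unfolding total_var_def
proof (rule emeasure_measure_of_sigma)
  show "sigma_algebra UNIV (sets (borel :: 'a measure))"
    using sets.sigma_algebra_axioms[of "borel :: 'a measure"] by simp
  show "positive (sets borel) (\<lambda>A. emeasure (pos_part \<mu>) A + emeasure (neg_part \<mu>) A)"
    by (simp add: positive_def)
  show "countably_additive (sets borel) (\<lambda>A. emeasure (pos_part \<mu>) A + emeasure (neg_part \<mu>) A)"
  proof (rule countably_additiveI)
    fix A :: "nat \<Rightarrow> 'a set"
    assume "range A \<subseteq> sets borel" "disjoint_family A"
    then show "(\<Sum>i. emeasure (pos_part \<mu>) (A i) + emeasure (neg_part \<mu>) (A i)) =
        emeasure (pos_part \<mu>) (\<Union>i. A i) + emeasure (neg_part \<mu>) (\<Union>i. A i)"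
      by (subst suminf_add[symmetric]) (auto simp: suminf_emeasure)
  qed
qed fact


section \<open>Dirichlet forms\<close>

text \<open>
  Elements of \<open>L\<^sup>2(E;m)\<close> and of the extended Dirichlet space are represented by functions; the
  domain \<open>D\<close> is a set of functions closed under passing to an \<open>m\<close>-version, and the form \<open>\<E>\<close> does
  not distinguish between \<open>m\<close>-versions.
\<close>

definition L2 :: "'a measure \<Rightarrow> ('a \<Rightarrow> real) set" where
  "L2 m = {u \<in> borel_measurable m. integrable m (\<lambda>x. (u x)\<^sup>2)}"

type_synonym 'a form = "('a \<Rightarrow> real) \<Rightarrow> ('a \<Rightarrow> real) \<Rightarrow> real"

definition sym_part :: "'a form \<Rightarrow> 'a form" where
  "sym_part \<E> u v = (\<E> u v + \<E> v u) / 2"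

definition form_alpha :: "'a measure \<Rightarrow> 'a form \<Rightarrow> real \<Rightarrow> 'a form" where
  "form_alpha m \<E> \<alpha> u v = \<E> u v + \<alpha> * (\<integral>x. u x * v x \<partial>m)"

definition form_Cauchy :: "'a form \<Rightarrow> (nat \<Rightarrow> 'a \<Rightarrow> real) \<Rightarrow> bool" where
  "form_Cauchy \<E> u \<longleftrightarrow>
     (\<forall>e>0. \<exists>N. \<forall>i\<ge>N. \<forall>j\<ge>N.
        sqrt (\<E> (\<lambda>x. u i x - u j x) (\<lambda>x. u i x - u j x)) < e)"

definition bilinear_form_on :: "'a measure \<Rightarrow> 'a form \<Rightarrow> ('a \<Rightarrow> real) set \<Rightarrow> bool" where
  "bilinear_form_on m \<E> D \<longleftrightarrow>
     D \<subseteq> L2 m \<and>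
     (\<forall>u\<in>D. \<forall>v\<in>borel_measurable m. (AE x in m. u x = v x) \<longrightarrow> v \<in> D) \<and>
     (\<lambda>x. 0) \<in> D \<and>
     (\<forall>u\<in>D. \<forall>v\<in>D. (\<lambda>x. u x + v x) \<in> D) \<and>
     (\<forall>c. \<forall>u\<in>D. (\<lambda>x. c * u x) \<in> D) \<and>
     (\<forall>u\<in>D. \<forall>u'\<in>D. \<forall>v\<in>D. (AE x in m. u x = u' x) \<longrightarrow> \<E> u v = \<E> u' v \<and> \<E> v u = \<E> v u') \<and>
     (\<forall>u\<in>D. \<forall>u'\<in>D. \<forall>v\<in>D. \<E> (\<lambda>x. u x + u' x) v = \<E> u v + \<E> u' v \<and>
                              \<E> v (\<lambda>x. u x + u' x) = \<E> v u + \<E> v u') \<and>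
     (\<forall>c. \<forall>u\<in>D. \<forall>v\<in>D. \<E> (\<lambda>x. c * u x) v = c * \<E> u v \<and> \<E> v (\<lambda>x. c * u x) = c * \<E> v u)"

definition dense_in_L2 :: "'a measure \<Rightarrow> ('a \<Rightarrow> real) set \<Rightarrow> bool" where
  "dense_in_L2 m D \<longleftrightarrow> (\<forall>f\<in>L2 m. \<forall>e>0. \<exists>u\<in>D. sqrt (\<integral>x. (f x - u x)\<^sup>2 \<partial>m) < e)"

definition closed_form :: "'a measure \<Rightarrow> 'a form \<Rightarrow> ('a \<Rightarrow> real) set \<Rightarrow> bool" where
  "closed_form m \<E> D \<longleftrightarrow>
     (\<forall>u. (\<forall>n. u n \<in> D) \<and> form_Cauchy (form_alpha m \<E> 1) u \<longrightarrow>
        (\<exists>w\<in>D. (\<lambda>n. sqrt (form_alpha m \<E> 1 (\<lambda>x. u n x - w x) (\<lambda>x. u n x - w x))) \<longlonglongrightarrow> 0))"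

definition unit_contraction :: "('a \<Rightarrow> real) \<Rightarrow> 'a \<Rightarrow> real" where
  "unit_contraction u x = min (max (u x) 0) 1"

definition dirichlet_form :: "'a measure \<Rightarrow> 'a form \<Rightarrow> ('a \<Rightarrow> real) set \<Rightarrow> bool" where
  "dirichlet_form m \<E> D \<longleftrightarrow>
     bilinear_form_on m \<E> D \<and>
     dense_in_L2 m D \<and>
     (\<forall>u\<in>D. 0 \<le> sym_part \<E> u u) \<and>
     closed_form m (sym_part \<E>) D \<and>
     (\<exists>K. \<forall>u\<in>D. \<forall>v\<in>D. \<bar>form_alpha m \<E> 1 u v\<bar>
        \<le> K * sqrt (form_alpha m \<E> 1 u u) * sqrt (form_alpha m \<E> 1 v v)) \<and>
     (\<forall>u\<in>D. unit_contraction u \<in> D \<and>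
        0 \<le> \<E> (\<lambda>x. u x + unit_contraction u x) (\<lambda>x. u x - unit_contraction u x) \<and>
        0 \<le> \<E> (\<lambda>x. u x - unit_contraction u x) (\<lambda>x. u x + unit_contraction u x))"


section \<open>Nests, exceptional sets and quasi-continuity\<close>

definition form_dense ::
    "'a measure \<Rightarrow> 'a form \<Rightarrow> ('a \<Rightarrow> real) set \<Rightarrow> ('a \<Rightarrow> real) set \<Rightarrow> bool" where
  "form_dense m \<E> D A \<longleftrightarrow>
     A \<subseteq> D \<and>
     (\<forall>u\<in>D. \<forall>e>0. \<exists>v\<in>A. sqrt (form_alpha m \<E> 1 (\<lambda>x. u x - v x) (\<lambda>x. u x - v x)) < e)"

definition nest ::
    "'a::topological_space measure \<Rightarrow> 'a form \<Rightarrow> ('a \<Rightarrow> real) set \<Rightarrow> (nat \<Rightarrow> 'a set) \<Rightarrow> bool" where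
  "nest m \<E> D F \<longleftrightarrow>
     incseq F \<and> (\<forall>k. closed (F k)) \<and>
     form_dense m \<E> D (\<Union>k. {u \<in> D. AE x in m. x \<notin> F k \<longrightarrow> u x = 0})"

definition exceptional ::
    "'a::topological_space measure \<Rightarrow> 'a form \<Rightarrow> ('a \<Rightarrow> real) set \<Rightarrow> 'a set \<Rightarrow> bool" where
  "exceptional m \<E> D N \<longleftrightarrow> (\<exists>F. nest m \<E> D F \<and> N \<subseteq> (\<Inter>k. - F k))"

definition quasi_continuous ::
    "'a::topological_space measure \<Rightarrow> 'a form \<Rightarrow> ('a \<Rightarrow> real) set \<Rightarrow> ('a \<Rightarrow> real) \<Rightarrow> bool" where
  "quasi_continuous m \<E> D f \<longleftrightarrow> (\<exists>F. nest m \<E> D F \<and> (\<forall>k. continuous_on (F k) f))"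

definition qc_version ::
    "'a::topological_space measure \<Rightarrow> 'a form \<Rightarrow> ('a \<Rightarrow> real) set \<Rightarrow> ('a \<Rightarrow> real) \<Rightarrow> ('a \<Rightarrow> real) \<Rightarrow> bool"
    where
  "qc_version m \<E> D u u' \<longleftrightarrow> quasi_continuous m \<E> D u' \<and> (AE x in m. u' x = u x)"

definition quasi_regular ::
    "'a::topological_space measure \<Rightarrow> 'a form \<Rightarrow> ('a \<Rightarrow> real) set \<Rightarrow> bool" where
  "quasi_regular m \<E> D \<longleftrightarrow>
     (\<exists>F. nest m \<E> D F \<and> (\<forall>k. compact (F k))) \<and>
     (\<exists>A. form_dense m (sym_part \<E>) D A \<and> (\<forall>u\<in>A. \<exists>u'. qc_version m \<E> D u u')) \<and>
     (\<exists>(u :: nat \<Rightarrow> 'a \<Rightarrow> real) u' N.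
        (\<forall>n. u n \<in> D \<and> qc_version m \<E> D (u n) (u' n)) \<and> exceptional m \<E> D N \<and>
        (\<forall>x\<in>-N. \<forall>y\<in>-N. x \<noteq> y \<longrightarrow> (\<exists>n. u' n x \<noteq> u' n y)))"


section \<open>Transience and the extended Dirichlet space\<close>

definition transient :: "'a measure \<Rightarrow> 'a form \<Rightarrow> ('a \<Rightarrow> real) set \<Rightarrow> bool" where
  "transient m \<E> D \<longleftrightarrow>
     (\<exists>g. integrable m g \<and> bounded (range g) \<and> (AE x in m. 0 < g x) \<and>
        (\<forall>u\<in>D. (\<integral>x. \<bar>u x\<bar> * g x \<partial>m) \<le> sqrt (\<E> u u)))"

definition approximating ::
    "'a measure \<Rightarrow> 'a form \<Rightarrow> ('a \<Rightarrow> real) set \<Rightarrow> ('a \<Rightarrow> real) \<Rightarrow> (nat \<Rightarrow> 'a \<Rightarrow> real) \<Rightarrow> bool" where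
  "approximating m \<E> D u un \<longleftrightarrow>
     (\<forall>n. un n \<in> D) \<and> form_Cauchy (sym_part \<E>) un \<and> (AE x in m. (\<lambda>n. un n x) \<longlonglongrightarrow> u x)"

definition extended_domain :: "'a measure \<Rightarrow> 'a form \<Rightarrow> ('a \<Rightarrow> real) set \<Rightarrow> ('a \<Rightarrow> real) set" where
  "extended_domain m \<E> D = {u \<in> borel_measurable m. \<exists>un. approximating m \<E> D u un}"

text \<open>The value \<open>\<E>(u,u)\<close> for \<open>u\<close> in the extended space; the limit does not depend on the
  approximating sequence.\<close>

definition extended_energy ::
    "'a measure \<Rightarrow> 'a form \<Rightarrow> ('a \<Rightarrow> real) set \<Rightarrow> ('a \<Rightarrow> real) \<Rightarrow> real" where
  "extended_energy m \<E> D u =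
     (THE l. \<exists>un. approximating m \<E> D u un \<and> (\<lambda>n. \<E> (un n) (un n)) \<longlonglongrightarrow> l)"

definition extended_dual ::
    "'a measure \<Rightarrow> 'a form \<Rightarrow> ('a \<Rightarrow> real) set \<Rightarrow> (('a \<Rightarrow> real) \<Rightarrow> real) set" where
  "extended_dual m \<E> D = {L.
     (\<forall>u\<in>extended_domain m \<E> D. \<forall>v\<in>extended_domain m \<E> D. L (\<lambda>x. u x + v x) = L u + L v) \<and>
     (\<forall>c. \<forall>u\<in>extended_domain m \<E> D. L (\<lambda>x. c * u x) = c * L u) \<and>
     (\<exists>C. \<forall>u\<in>extended_domain m \<E> D. \<bar>L u\<bar> \<le> C * sqrt (extended_energy m \<E> D u))}"


section \<open>Classes of measures\<close>

definition smooth ::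
    "'a::topological_space measure \<Rightarrow> 'a form \<Rightarrow> ('a \<Rightarrow> real) set \<Rightarrow> 'a measure \<Rightarrow> bool" where
  "smooth m \<E> D \<kappa> \<longleftrightarrow>
     sets \<kappa> = sets borel \<and>
     (\<forall>B\<in>sets borel. exceptional m \<E> D B \<longrightarrow> emeasure \<kappa> B = 0) \<and>
     (\<exists>F. nest m \<E> D F \<and> (\<forall>k. compact (F k) \<and> emeasure \<kappa> (F k) < \<infinity>))"

definition bounded_smooth_measures ::
    "'a::topological_space measure \<Rightarrow> 'a form \<Rightarrow> ('a \<Rightarrow> real) set \<Rightarrow> ('a set \<Rightarrow> real) set" where
  "bounded_smooth_measures m \<E> D = {\<mu> \<in> bounded_measures. smooth m \<E> D (total_var \<mu>)}"

text \<open>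
  A quasi-continuous function is arbitrary on an exceptional set, so only its Borel versions are
  integrated. That \<open>\<nu>\<close> is a functional on the classes \<open>u\<close> means that the integral of a
  quasi-continuous version, whenever it is defined, has the same value for all versions of \<open>u\<close>.
  It is always defined for some version if \<open>u\<close> is \<open>m\<close>-essentially bounded, but need not be
  otherwise; such \<open>u\<close> are dense in the extended space, hence determine the functional.
\<close>

definition dual_bounded_measures ::
    "'a::topological_space measure \<Rightarrow> 'a form \<Rightarrow> ('a \<Rightarrow> real) set \<Rightarrow> ('a set \<Rightarrow> real) set" where
  "dual_bounded_measures m \<E> D = {\<nu> \<in> bounded_measures.
     \<exists>L\<in>extended_dual m \<E> D. \<forall>u\<in>extended_domain m \<E> D. \<forall>u'\<in>borel_measurable borel.
       qc_version m \<E> D u u' \<longrightarrow> signed_integrable \<nu> u' \<longrightarrow> L u = signed_integral \<nu> u'}"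

text \<open>\<open>\<mu> = f \<sqdot> m + \<nu>\<close>, tested against the bounded elements of the extended space.\<close>

definition decomposition ::
    "'a::topological_space measure \<Rightarrow> 'a form \<Rightarrow> ('a \<Rightarrow> real) set \<Rightarrow>
     ('a set \<Rightarrow> real) \<Rightarrow> ('a \<Rightarrow> real) \<Rightarrow> ('a set \<Rightarrow> real) \<Rightarrow> bool" where
  "decomposition m \<E> D \<mu> f \<nu> \<longleftrightarrow>
     (\<forall>u\<in>extended_domain m \<E> D. (\<exists>c. AE x in m. \<bar>u x\<bar> \<le> c) \<longrightarrow>
        (\<forall>u'\<in>borel_measurable borel. qc_version m \<E> D u u' \<longrightarrow>
           signed_integrable \<mu> u' \<and> signed_integrable \<nu> u' \<and>
           signed_integral \<mu> u' = (\<integral>x. f x * u x \<partial>m) + signed_integral \<nu> u'))"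

end

theory Submission
  imports Defs
begin

text \<open>
  Everything depends on the form only through its symmetric part, so let \<open>\<E>\<close> be symmetric. A set
  is exceptional only if its indicator is a quasi-continuous version of \<open>0\<close>; testing the
  decomposition with such indicators shows that \<open>\<mu>\<close> charges no exceptional set, which gives
  smoothness.

  Conversely, let \<open>\<kappa>\<close> be a finite measure that charges no exceptional set. For \<open>\<alpha> > 0\<close> let \<open>w\<close> be
  the Riesz representative of \<open>v \<mapsto> \<integral>v d\<kappa>\<close> with respect to \<open>\<E>\<^sub>\<alpha>(u,v) + \<integral>u v d\<kappa>\<close>. Then
  \<open>0 \<le> w \<le> 1\<close> and \<open>(1 - w) \<cdot> \<kappa> = \<alpha> w \<cdot> m + \<E>(w,\<cdot>)\<close>, where \<open>\<alpha> \<integral>w dm \<le> \<kappa>(E)\<close> and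
  \<open>\<E>(w,w) \<le> \<integral>w d\<kappa>\<close>, and the last quantity tends to \<open>0\<close> as \<open>\<alpha> \<rightarrow> \<infinity>\<close>. Repeating this with the
  remainder \<open>w \<cdot> \<kappa>\<close> and summing up decomposes \<open>\<kappa>\<close>; no potential theory of smooth measures is
  needed. Transience enters through the bound of a weighted \<open>L\<^sup>1\<close>-norm by the energy: it makes the
  form closable with respect to almost everywhere convergence, and it lets \<open>\<E>\<close>-Cauchy sequences of
  quasi-continuous functions converge quasi-everywhere, which carries the identity from the domain
  over to the extended space.
\<close>

text \<open>Two series must converge at once: the densities \<open>f k\<close> in L1 and the
  functions \<open>w k\<close> in energy. Both follow from making the remainders small: the mass of
  \<open>f k\<close> is at most that of the k-th remainder, and the energy of \<open>w k\<close> is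
  at most the mass of the next one. The sum of the \<open>w k\<close> is controlled in energy but
  not in L2, so its limit may leave \<open>D\<close>; the functional is therefore carried by the
  Cauchy sequence of partial sums. Quasi-continuity is handled without capacities. The substitute is
  a single function \<open>p\<close>, the 1-resolvent of the transience weight \<open>g\<close>.
  Resolvents of functions dominated by \<open>g\<close> are dominated by \<open>p\<close> and are
  dense, so increasing closed sets form a nest as soon as \<open>p\<close> is dominated off them by
  elements of \<open>D\<close> of geometrically small energy. Truncation bounds the energy, but no
  continuity of truncation in energy is available. Sequences that are merely bounded in energy are
  therefore replaced by near-minimisers of the energy in convex sets, which are Cauchy.\<close>

text \<open>Divide by \<open>t\<close> and let \<open>t\<close> tend to 0; the witness makes
  \<open>t * B\<close> at most \<open>- A / 2\<close>. This turns minimality and contraction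
  inequalities into first-order ones.\<close>

lemma quadratic_nonneg_imp:
  fixes A B :: real
  assumes "\<And>t. 0 < t \<Longrightarrow> 0 \<le> t * A + t\<^sup>2 * B"
  shows "0 \<le> A"
proof (rule ccontr)
  assume "\<not> 0 \<le> A"
  define t where "t = - A / (2 * (\<bar>B\<bar> + 1))"
  have t: "t > 0" using \<open>\<not> 0 \<le> A\<close> by (simp add: t_def divide_neg_pos)
  have "0 \<le> t * (A + t * B)" using assms[OF t] by (simp add: power2_eq_square algebra_simps)
  then have "0 \<le> A + t * B" using t by (simp add: zero_le_mult_iff)
  moreover have "t * B \<le> t * (\<bar>B\<bar> + 1)" using t by (intro mult_left_mono) auto
  moreover have "t * (\<bar>B\<bar> + 1) = - A / 2" by (simp add: t_def field_simps)
  ultimately show False using \<open>\<not> 0 \<le> A\<close> by simp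
qed

section \<open>Nonnegative symmetric forms\<close>

text \<open>Vectors are functions, so that one calculus serves the energy, its shifts by the L2
  product, the L2 spaces and the penalized form. The form is only semidefinite: \<open>nb\<close> is
  a seminorm, and limits are determined up to functions of seminorm zero.\<close>

locale psd_form =
  fixes V :: "('a \<Rightarrow> real) set" and b :: "'a form"
  assumes zero_in: "(\<lambda>x. 0) \<in> V"
    and add_in: "\<And>u v. u \<in> V \<Longrightarrow> v \<in> V \<Longrightarrow> (\<lambda>x. u x + v x) \<in> V"
    and scale_in: "\<And>c u. u \<in> V \<Longrightarrow> (\<lambda>x. c * u x) \<in> V"
    and b_sym: "\<And>u v. u \<in> V \<Longrightarrow> v \<in> V \<Longrightarrow> b u v = b v u"
    and b_add: "\<And>u u' v. u \<in> V \<Longrightarrow> u' \<in> V \<Longrightarrow> v \<in> V \<Longrightarrow> b (\<lambda>x. u x + u' x) v = b u v + b u' v"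
    and b_scale: "\<And>c u v. u \<in> V \<Longrightarrow> v \<in> V \<Longrightarrow> b (\<lambda>x. c * u x) v = c * b u v"
    and b_nonneg: "\<And>u. u \<in> V \<Longrightarrow> 0 \<le> b u u"
begin

definition nb :: "('a \<Rightarrow> real) \<Rightarrow> real" where
  "nb u = sqrt (b u u)"

lemma lincomb_in: "u \<in> V \<Longrightarrow> v \<in> V \<Longrightarrow> (\<lambda>x. s * u x + t * v x) \<in> V"
  using add_in[OF scale_in scale_in] .

lemma diff_in: "u \<in> V \<Longrightarrow> v \<in> V \<Longrightarrow> (\<lambda>x. u x - v x) \<in> V"
  using lincomb_in[of u v 1 "-1"] by simp

lemma minus_in: "u \<in> V \<Longrightarrow> (\<lambda>x. - u x) \<in> V"
  using scale_in[of u "-1"] by simp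

lemma mid_in: "u \<in> V \<Longrightarrow> v \<in> V \<Longrightarrow> (\<lambda>x. (u x + v x) / 2) \<in> V"
  using lincomb_in[of u v "1/2" "1/2"] by (simp add: field_simps)

lemma b_lincomb:
  assumes "u \<in> V" "u' \<in> V" "v \<in> V"
  shows "b (\<lambda>x. s * u x + t * u' x) v = s * b u v + t * b u' v"
  using assms by (simp add: b_add b_scale scale_in)

lemma b_lincomb_right:
  assumes "u \<in> V" "u' \<in> V" "v \<in> V"
  shows "b v (\<lambda>x. s * u x + t * u' x) = s * b v u + t * b v u'"
  using b_lincomb[OF assms] b_sym[OF assms(3)] assms lincomb_in by auto

lemma b_add_right: "u \<in> V \<Longrightarrow> u' \<in> V \<Longrightarrow> v \<in> V \<Longrightarrow> b v (\<lambda>x. u x + u' x) = b v u + b v u'"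
  using b_lincomb_right[of u u' v 1 1] by simp

lemma b_scale_right: "u \<in> V \<Longrightarrow> v \<in> V \<Longrightarrow> b v (\<lambda>x. c * u x) = c * b v u"
  using b_lincomb_right[of u u v c 0] by simp

lemma b_diff: "u \<in> V \<Longrightarrow> u' \<in> V \<Longrightarrow> v \<in> V \<Longrightarrow> b (\<lambda>x. u x - u' x) v = b u v - b u' v"
  using b_lincomb[of u u' v 1 "-1"] by simp

lemma b_diff_right: "u \<in> V \<Longrightarrow> u' \<in> V \<Longrightarrow> v \<in> V \<Longrightarrow> b v (\<lambda>x. u x - u' x) = b v u - b v u'"
  using b_lincomb_right[of u u' v 1 "-1"] by simp

lemma b_quad:
  assumes "u \<in> V" "v \<in> V"
  shows "b (\<lambda>x. s * u x + t * v x) (\<lambda>x. s * u x + t * v x) = s\<^sup>2 * b u u + 2 * s * t * b u v + t\<^sup>2 * b v v"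
  using assms b_sym[OF assms]
  by (simp add: b_lincomb b_lincomb_right lincomb_in power2_eq_square algebra_simps)

lemma b_quad_add:
  "u \<in> V \<Longrightarrow> v \<in> V \<Longrightarrow> b (\<lambda>x. u x + v x) (\<lambda>x. u x + v x) = b u u + 2 * b u v + b v v"
  using b_quad[of u v 1 1] by simp

lemma b_quad_diff:
  "u \<in> V \<Longrightarrow> v \<in> V \<Longrightarrow> b (\<lambda>x. u x - v x) (\<lambda>x. u x - v x) = b u u - 2 * b u v + b v v"
  using b_quad[of u v 1 "-1"] by simp

lemma b_quad_mid:
  "u \<in> V \<Longrightarrow> v \<in> V \<Longrightarrow> 4 * b (\<lambda>x. (u x + v x) / 2) (\<lambda>x. (u x + v x) / 2) = b u u + 2 * b u v + b v v"
  using b_quad[of u v "1/2" "1/2"] by (simp add: field_simps)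

lemma nb_nonneg: "u \<in> V \<Longrightarrow> 0 \<le> nb u"
  by (simp add: nb_def b_nonneg)

lemma nb_sq: "u \<in> V \<Longrightarrow> (nb u)\<^sup>2 = b u u"
  by (simp add: nb_def b_nonneg)

lemma cauchy_schwarz:
  assumes "u \<in> V" "v \<in> V"
  shows "\<bar>b u v\<bar> \<le> nb u * nb v"
proof -
  have "(b u v)\<^sup>2 \<le> b u u * b v v"
  proof (cases "b v v = 0")
    case True
    \<comment> \<open>For \<open>b v v = 0\<close> the quadratic in \<open>t\<close> degenerates to
      an affine function that stays nonnegative, so its slope vanishes.\<close>
    have pos: "0 \<le> b u u + t * (2 * b u v)" for t
      using b_nonneg[OF lincomb_in[OF assms, of 1 t]] b_quad[OF assms, of 1 t] True
      by (simp add: algebra_simps)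
    have "b u v = 0"
    proof (rule ccontr)
      assume "b u v \<noteq> 0"
      then have "(- (b u u + 1) / (2 * b u v)) * (2 * b u v) = - (b u u + 1)" by simp
      then show False using pos[of "- (b u u + 1) / (2 * b u v)"] by linarith
    qed
    then show ?thesis using True by simp
  next
    case False
    then have pos: "0 < b v v" using b_nonneg[OF assms(2)] by simp
    have "0 \<le> b u u + 2 * (- b u v / b v v) * b u v + (- b u v / b v v)\<^sup>2 * b v v"
      using b_nonneg[OF lincomb_in[OF assms, of 1 "- b u v / b v v"]]
        b_quad[OF assms, of 1 "- b u v / b v v"] by simp
    also have "\<dots> = b u u - (b u v)\<^sup>2 / b v v"
      using pos by (simp add: power2_eq_square field_simps)
    finally show ?thesis using pos by (simp add: field_simps)
  qed
  then have "sqrt ((b u v)\<^sup>2) \<le> sqrt (b u u * b v v)" by (rule real_sqrt_le_mono)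
  then show ?thesis by (simp add: nb_def real_sqrt_mult)
qed

lemma nb_scale: "u \<in> V \<Longrightarrow> nb (\<lambda>x. c * u x) = \<bar>c\<bar> * nb u"
  by (simp add: nb_def b_scale b_scale_right scale_in real_sqrt_mult flip: mult.assoc)

lemma nb_minus: "u \<in> V \<Longrightarrow> nb (\<lambda>x. - u x) = nb u"
  using nb_scale[of u "-1"] by simp

lemma nb_add:
  assumes "u \<in> V" "v \<in> V"
  shows "nb (\<lambda>x. u x + v x) \<le> nb u + nb v"
proof (rule power2_le_imp_le)
  have "(nb (\<lambda>x. u x + v x))\<^sup>2 = (nb u)\<^sup>2 + 2 * b u v + (nb v)\<^sup>2"
    using assms by (simp add: nb_sq add_in b_quad_add)
  also have "\<dots> \<le> (nb u)\<^sup>2 + 2 * (nb u * nb v) + (nb v)\<^sup>2"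
    using cauchy_schwarz[OF assms] by simp
  also have "\<dots> = (nb u + nb v)\<^sup>2" by (simp add: power2_eq_square algebra_simps)
  finally show "(nb (\<lambda>x. u x + v x))\<^sup>2 \<le> (nb u + nb v)\<^sup>2" .
qed (use assms nb_nonneg in auto)

lemma nb_diff: "u \<in> V \<Longrightarrow> v \<in> V \<Longrightarrow> nb (\<lambda>x. u x - v x) \<le> nb u + nb v"
  using nb_add[of u "\<lambda>x. - v x"] by (simp add: minus_in nb_minus)

lemma nb_diff_commute: "u \<in> V \<Longrightarrow> v \<in> V \<Longrightarrow> nb (\<lambda>x. u x - v x) = nb (\<lambda>x. v x - u x)"
  using nb_minus[OF diff_in, of u v] by simp

lemma nb_triangle: "u \<in> V \<Longrightarrow> v \<in> V \<Longrightarrow> nb u \<le> nb v + nb (\<lambda>x. u x - v x)"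
  using nb_add[of v "\<lambda>x. u x - v x"] by (simp add: diff_in)

lemma nb_triangle3:
  "u \<in> V \<Longrightarrow> v \<in> V \<Longrightarrow> w \<in> V \<Longrightarrow> nb (\<lambda>x. u x - w x) \<le> nb (\<lambda>x. u x - v x) + nb (\<lambda>x. v x - w x)"
  using nb_add[of "\<lambda>x. u x - v x" "\<lambda>x. v x - w x"] by (simp add: diff_in)

lemma nb_zero: "nb (\<lambda>x. 0) = 0"
  using nb_scale[OF zero_in, of 0] by simp

lemma sum_in: "(\<And>i. i \<in> I \<Longrightarrow> u i \<in> V) \<Longrightarrow> (\<lambda>x. \<Sum>i\<in>I. u i x) \<in> V"
proof (induction I rule: infinite_finite_induct)
  case (insert i I)
  then show ?case using add_in[of "u i" "\<lambda>x. \<Sum>i\<in>I. u i x"] by simp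
qed (auto simp: zero_in)

lemma nb_sum: "(\<And>i. i \<in> I \<Longrightarrow> u i \<in> V) \<Longrightarrow> nb (\<lambda>x. \<Sum>i\<in>I. u i x) \<le> (\<Sum>i\<in>I. nb (u i))"
proof (induction I rule: infinite_finite_induct)
  case (insert i I)
  have "nb (\<lambda>x. \<Sum>i\<in>insert i I. u i x) \<le> nb (u i) + nb (\<lambda>x. \<Sum>i\<in>I. u i x)"
    using insert nb_add[of "u i" "\<lambda>x. \<Sum>i\<in>I. u i x"] sum_in[of I u] by simp
  then show ?case using insert by simp
qed (auto simp: nb_zero)

lemma b_sum:
  "(\<And>i. i \<in> I \<Longrightarrow> u i \<in> V) \<Longrightarrow> v \<in> V \<Longrightarrow> b (\<lambda>x. \<Sum>i\<in>I. u i x) v = (\<Sum>i\<in>I. b (u i) v)"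
proof (induction I rule: infinite_finite_induct)
  case (insert i I)
  then show ?case using b_add[of "u i" "\<lambda>x. \<Sum>i\<in>I. u i x" v] sum_in[of I u] by simp
qed (use b_scale[OF zero_in, of v 0] in auto)

lemma form_Cauchy_iff:
  "form_Cauchy b u \<longleftrightarrow> (\<forall>e>0. \<exists>N. \<forall>i\<ge>N. \<forall>j\<ge>N. nb (\<lambda>x. u i x - u j x) < e)"
  by (simp add: form_Cauchy_def nb_def)

lemma form_CauchyI_sq:
  assumes "\<And>n. u n \<in> V" "\<And>i j. b (\<lambda>x. u i x - u j x) (\<lambda>x. u i x - u j x) \<le> r i + r j" "r \<longlonglongrightarrow> 0"
  shows "form_Cauchy b u"
  unfolding form_Cauchy_def
proof (intro allI impI)
  fix e :: real assume "e > 0"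
  then have "\<forall>\<^sub>F n in sequentially. r n < e\<^sup>2 / 2"
    using assms(3) by (intro order_tendstoD(2)) auto
  then obtain N where N: "\<And>n. n \<ge> N \<Longrightarrow> r n < e\<^sup>2 / 2" by (auto simp: eventually_sequentially)
  have "sqrt (b (\<lambda>x. u i x - u j x) (\<lambda>x. u i x - u j x)) < e" if "i \<ge> N" "j \<ge> N" for i j
  proof -
    have "b (\<lambda>x. u i x - u j x) (\<lambda>x. u i x - u j x) < e\<^sup>2"
      using assms(2)[of i j] N[OF that(1)] N[OF that(2)] by simp
    then show ?thesis using \<open>e > 0\<close> real_less_lsqrt by simp
  qed
  then show "\<exists>N. \<forall>i\<ge>N. \<forall>j\<ge>N. sqrt (b (\<lambda>x. u i x - u j x) (\<lambda>x. u i x - u j x)) < e" by blast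
qed

text \<open>Near-minimisers of a quadratic functional over shrinking convex sets form a Cauchy sequence
  by the parallelogram identity; this replaces weak compactness throughout.\<close>

lemma minimizing_Cauchy:
  fixes l :: "('a \<Rightarrow> real) \<Rightarrow> real"
  defines "J \<equiv> \<lambda>v. b v v - 2 * l v"
  assumes C: "\<And>k. C k \<subseteq> V" "\<And>k. C (Suc k) \<subseteq> C k"
    and mid: "\<And>k u v. u \<in> C k \<Longrightarrow> v \<in> C k \<Longrightarrow> (\<lambda>x. (u x + v x) / 2) \<in> C k"
    and l_mid: "\<And>u v. u \<in> V \<Longrightarrow> v \<in> V \<Longrightarrow> 2 * l (\<lambda>x. (u x + v x) / 2) = l u + l v"
    and bounded: "\<And>k. \<exists>v\<in>C k. J v \<le> M" "\<And>v. v \<in> V \<Longrightarrow> B \<le> J v"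
  shows "\<exists>v. (\<forall>k. v k \<in> C k \<and> J (v k) \<le> Inf (J ` C k) + 1 / Suc k) \<and> form_Cauchy b v"
proof -
  define d where "d k = Inf (J ` C k)" for k
  have bdd: "bdd_below (J ` C k)" for k
    using bounded(2) C(1) by (intro bdd_belowI[of _ B]) auto
  have ne: "C k \<noteq> {}" for k using bounded(1)[of k] by auto
  have "\<exists>v\<in>C k. J v < d k + 1 / Suc k" for k
    using cInf_lessD[of "J ` C k" "d k + 1 / Suc k"] ne by (auto simp: d_def)
  then obtain v where v: "\<And>k. v k \<in> C k" "\<And>k. J (v k) < d k + 1 / Suc k" by metis
  have dec: "C j \<subseteq> C k" if "k \<le> j" for j k
    using that C(2) by (induction rule: dec_induct) auto
  have d_low: "d k \<le> J w" if "w \<in> C k" for w k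
    unfolding d_def using bdd that by (intro cInf_lower) auto
  have d_M: "d k \<le> M" for k using bounded(1)[of k] d_low order_trans by blast
  have d_mono: "incseq d"
    unfolding d_def
  proof (rule incseq_SucI)
    show "Inf (J ` C k) \<le> Inf (J ` C (Suc k))" for k
      using ne[of "Suc k"] bdd[of k] C(2)[of k] by (intro cInf_superset_mono) blast+
  qed
  have vV: "v k \<in> V" for k using v(1) C(1) by auto
  obtain L where L: "d \<longlonglongrightarrow> L" using incseq_convergent[OF d_mono] d_M by metis
  have dL: "d k \<le> L" for k using incseq_le[OF d_mono L] .
  have key: "b (\<lambda>x. v i x - v j x) (\<lambda>x. v i x - v j x) \<le> 2 * (L - d i) + 2 / Suc i + (2 / Suc j + 2 * (L - d j))"
    if "i \<le> j" for i j
  proof -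
    \<comment> \<open>For \<open>i \<le> j\<close> both points lie in the larger set
      \<open>C i\<close>, hence so does the midpoint, and its value is at least \<open>d i\<close>.
      The linear terms cancel in the parallelogram identity.\<close>
    have m: "(\<lambda>x. (v i x + v j x) / 2) \<in> C i" using mid[OF v(1)[of i]] dec[OF that] v(1)[of j] by auto
    have "b (\<lambda>x. v i x - v j x) (\<lambda>x. v i x - v j x) = 2 * J (v i) + 2 * J (v j) - 4 * J (\<lambda>x. (v i x + v j x) / 2)"
      using b_quad_mid[OF vV vV, of i j] b_quad_diff[OF vV vV, of i j] l_mid[OF vV vV, of i j]
      by (simp add: J_def)
    also have "\<dots> \<le> 2 * (d i + 1 / Suc i) + 2 * (d j + 1 / Suc j) - 4 * d i"
      using v(2)[of i] v(2)[of j] d_low[OF m] by simp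
    also have "\<dots> \<le> 2 * (L - d i) + 2 / Suc i + (2 / Suc j + 2 * (L - d j))"
      using dL[of i] dL[of j] by simp
    finally show ?thesis .
  qed
  define r where "r n = 2 * (L - d n) + 2 / Suc n" for n
  have "form_Cauchy b v"
  proof (rule form_CauchyI_sq[where r = r])
    show "b (\<lambda>x. v i x - v j x) (\<lambda>x. v i x - v j x) \<le> r i + r j" for i j
    proof (cases "i \<le> j")
      case True then show ?thesis using key[of i j] by (simp add: r_def)
    next
      case False
      moreover have "b (\<lambda>x. v i x - v j x) (\<lambda>x. v i x - v j x) = b (\<lambda>x. v j x - v i x) (\<lambda>x. v j x - v i x)"
        using nb_diff_commute[OF vV vV, of i j] nb_sq[OF diff_in[OF vV vV]] by metis
      ultimately show ?thesis using key[of j i] by (simp add: r_def)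
    qed
    have "r \<longlonglongrightarrow> 2 * (L - L) + 2 * 0"
      unfolding r_def divide_inverse[of 2]
      by (intro tendsto_intros L LIMSEQ_inverse_real_of_nat)
    then show "r \<longlonglongrightarrow> 0" by simp
  qed (rule vV)
  then show ?thesis using v less_imp_le unfolding d_def by blast
qed

text \<open>The case of a vanishing linear term: elements of nearly minimal energy in decreasing
  midpoint-convex sets.\<close>

corollary convex_Cauchy:
  assumes "\<And>k. C k \<subseteq> V" "\<And>k. C (Suc k) \<subseteq> C k"
    and "\<And>k u v. u \<in> C k \<Longrightarrow> v \<in> C k \<Longrightarrow> (\<lambda>x. (u x + v x) / 2) \<in> C k"
    and "\<And>k. \<exists>v\<in>C k. b v v \<le> M"
  shows "\<exists>v. (\<forall>k. v k \<in> C k) \<and> form_Cauchy b v"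
  using minimizing_Cauchy[of C "\<lambda>_. 0" M 0] assms b_nonneg by auto

lemma b_mid_le:
  assumes "u \<in> V" "v \<in> V" "b u u \<le> M" "b v v \<le> M"
  shows "b (\<lambda>x. (u x + v x) / 2) (\<lambda>x. (u x + v x) / 2) \<le> M"
  using b_quad_mid[OF assms(1,2)] b_quad_diff[OF assms(1,2)] b_nonneg[OF diff_in[OF assms(1,2)]] assms(3,4)
  by linarith

lemma nb_tendsto:
  assumes "\<And>n. u n \<in> V" "w \<in> V" "(\<lambda>n. nb (\<lambda>x. u n x - w x)) \<longlonglongrightarrow> 0"
  shows "(\<lambda>n. nb (u n)) \<longlonglongrightarrow> nb w"
proof -
  have "(\<lambda>n. nb (u n) - nb w) \<longlonglongrightarrow> 0"
  proof (rule Lim_null_comparison[OF _ assms(3)])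
    have "\<bar>nb (u n) - nb w\<bar> \<le> nb (\<lambda>x. u n x - w x)" for n
      using nb_triangle[OF assms(1)[of n] assms(2)] nb_triangle[OF assms(2) assms(1)[of n]]
        nb_diff_commute[OF assms(1)[of n] assms(2)] by linarith
    then show "\<forall>\<^sub>F n in sequentially. norm (nb (u n) - nb w) \<le> nb (\<lambda>x. u n x - w x)" by simp
  qed
  then show ?thesis by (simp add: LIM_zero_iff)
qed

lemma Cauchy_if_tendsto:
  assumes "\<And>n. u n \<in> V" "w \<in> V" "(\<lambda>n. nb (\<lambda>x. u n x - w x)) \<longlonglongrightarrow> 0"
  shows "form_Cauchy b u"
  unfolding form_Cauchy_iff
proof (intro allI impI)
  fix e :: real assume "0 < e"
  then have "\<forall>\<^sub>F n in sequentially. nb (\<lambda>x. u n x - w x) < e / 2"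
    by (intro order_tendstoD(2)[OF assms(3)]) simp
  then obtain N where N: "\<And>n. n \<ge> N \<Longrightarrow> nb (\<lambda>x. u n x - w x) < e / 2"
    by (auto simp: eventually_sequentially)
  have "nb (\<lambda>x. u i x - u j x) < e" if "i \<ge> N" "j \<ge> N" for i j
    using nb_triangle3[OF assms(1,2,1), of i j] nb_diff_commute[OF assms(2,1), of j]
      N[OF that(1)] N[OF that(2)] by simp
  then show "\<exists>N. \<forall>i\<ge>N. \<forall>j\<ge>N. nb (\<lambda>x. u i x - u j x) < e" by blast
qed

lemma Cauchy_bounded:
  assumes "\<And>n. u n \<in> V" "form_Cauchy b u"
  shows "\<exists>C\<ge>0. \<forall>n. nb (u n) \<le> C"
proof -
  obtain N where N: "\<And>i j. i \<ge> N \<Longrightarrow> j \<ge> N \<Longrightarrow> nb (\<lambda>x. u i x - u j x) < 1"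
    using assms(2) unfolding form_Cauchy_iff by (meson zero_less_one)
  define C where "C = Max ((\<lambda>n. nb (u n)) ` {..N}) + 1"
  have le: "nb (u n) \<le> C - 1" if "n \<le> N" for n
    unfolding C_def using that by (simp add: Max_ge)
  have "nb (u n) \<le> C" for n
  proof (cases "n \<le> N")
    case False
    then show ?thesis using nb_triangle[OF assms(1,1), of n N] N[of n N] le[of N] by simp
  qed (use le[of n] in simp)
  moreover have "0 \<le> C" using nb_nonneg[OF assms(1), of N] le[of N] by simp
  ultimately show ?thesis by blast
qed

lemma Cauchy_lincomb:
  assumes "\<And>n. u n \<in> V" "form_Cauchy b u" "\<And>n. v n \<in> V" "form_Cauchy b v"
  shows "form_Cauchy b (\<lambda>n x. s * u n x + t * v n x)"
  unfolding form_Cauchy_iff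
proof (intro allI impI)
  fix e :: real assume "0 < e"
  define d where "d = e / (\<bar>s\<bar> + \<bar>t\<bar> + 1)"
  have "0 < d" using \<open>0 < e\<close> by (simp add: d_def add_nonneg_pos)
  obtain N where N: "\<And>i j. i \<ge> N \<Longrightarrow> j \<ge> N \<Longrightarrow> nb (\<lambda>x. u i x - u j x) < d"
    using assms(2) \<open>0 < d\<close> unfolding form_Cauchy_iff by meson
  obtain N' where N': "\<And>i j. i \<ge> N' \<Longrightarrow> j \<ge> N' \<Longrightarrow> nb (\<lambda>x. v i x - v j x) < d"
    using assms(4) \<open>0 < d\<close> unfolding form_Cauchy_iff by meson
  have "nb (\<lambda>x. (s * u i x + t * v i x) - (s * u j x + t * v j x)) < e"
    if ij: "i \<ge> max N N'" "j \<ge> max N N'" for i j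
  proof -
    note du = diff_in[OF assms(1,1), of i j] and dv = diff_in[OF assms(3,3), of i j]
    have "(\<lambda>x. (s * u i x + t * v i x) - (s * u j x + t * v j x)) =
        (\<lambda>x. s * (u i x - u j x) + t * (v i x - v j x))"
      by (simp add: algebra_simps)
    then have "nb (\<lambda>x. (s * u i x + t * v i x) - (s * u j x + t * v j x)) \<le>
        \<bar>s\<bar> * nb (\<lambda>x. u i x - u j x) + \<bar>t\<bar> * nb (\<lambda>x. v i x - v j x)"
      using nb_add[OF scale_in[OF du] scale_in[OF dv], of s t] nb_scale[OF du, of s] nb_scale[OF dv, of t]
      by simp
    also have "\<dots> \<le> \<bar>s\<bar> * d + \<bar>t\<bar> * d"
      using N[of i j] N'[of i j] ij by (intro add_mono mult_left_mono) auto
    also have "\<dots> < (\<bar>s\<bar> + \<bar>t\<bar> + 1) * d" using \<open>0 < d\<close> by (simp add: distrib_right)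
    also have "\<dots> = e" by (simp add: d_def add_nonneg_pos less_imp_neq[THEN not_sym])
    finally show ?thesis .
  qed
  then show "\<exists>N. \<forall>i\<ge>N. \<forall>j\<ge>N. nb (\<lambda>x. (s * u i x + t * v i x) - (s * u j x + t * v j x)) < e"
    by blast
qed

definition complete :: bool where
  "complete \<longleftrightarrow> (\<forall>u. (\<forall>n. u n \<in> V) \<longrightarrow> form_Cauchy b u \<longrightarrow>
     (\<exists>w\<in>V. (\<lambda>n. nb (\<lambda>x. u n x - w x)) \<longlonglongrightarrow> 0))"

text \<open>The quadratic functional \<open>J\<close> is minimised over \<open>S\<close>; the first
  variation at the limit \<open>w\<close> in directions of \<open>S\<close> gives the equation. As
  \<open>S\<close> need not be closed, \<open>w\<close> is only a limit of elements of
  \<open>S\<close>. With \<open>S = V\<close> this is the Riesz theorem, in general the projection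
  onto the closure of \<open>S\<close>.\<close>

lemma riesz_subspace:
  assumes complete and S: "S \<subseteq> V" "(\<lambda>x. 0) \<in> S"
    and S_add: "\<And>u v. u \<in> S \<Longrightarrow> v \<in> S \<Longrightarrow> (\<lambda>x. u x + v x) \<in> S"
    and S_scale: "\<And>c u. u \<in> S \<Longrightarrow> (\<lambda>x. c * u x) \<in> S"
    and l_add: "\<And>u v. u \<in> V \<Longrightarrow> v \<in> V \<Longrightarrow> l (\<lambda>x. u x + v x) = l u + l v"
    and l_scale: "\<And>c u. u \<in> V \<Longrightarrow> l (\<lambda>x. c * u x) = c * l u"
    and l_bound: "\<And>v. v \<in> V \<Longrightarrow> \<bar>l v\<bar> \<le> K * nb v"
  shows "\<exists>w\<in>V. (\<exists>v. (\<forall>n. v n \<in> S) \<and> (\<lambda>n. nb (\<lambda>x. v n x - w x)) \<longlonglongrightarrow> 0) \<and> (\<forall>u\<in>S. b w u = l u)"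
proof -
  define J where "J v = b v v - 2 * l v" for v
  have J_low: "- K\<^sup>2 \<le> J v" if "v \<in> V" for v
  proof -
    have "0 \<le> (nb v - K)\<^sup>2" by simp
    also have "\<dots> = b v v - 2 * (K * nb v) + K\<^sup>2" using nb_sq[OF that] by (simp add: power2_eq_square algebra_simps)
    finally show ?thesis using l_bound[OF that] by (simp add: J_def)
  qed
  have l_mid: "2 * l (\<lambda>x. (u x + v x) / 2) = l u + l v" if "u \<in> V" "v \<in> V" for u v
    using l_scale[OF add_in[OF that], of "1/2"] l_add[OF that] by simp
  have S_mid: "(\<lambda>x. (u x + v x) / 2) \<in> S" if "u \<in> S" "v \<in> S" for u v
    using S_scale[OF S_add[OF that], of "1/2"] by simp
  have "\<exists>v. (\<forall>k. v k \<in> S \<and> b (v k) (v k) - 2 * l (v k) \<le> Inf ((\<lambda>v. b v v - 2 * l v) ` S) + 1 / Suc k) \<and> form_Cauchy b v"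
    using S J_low l_mid S_mid
    by (intro minimizing_Cauchy[of "\<lambda>_. S" l "J (\<lambda>x. 0)" "- K\<^sup>2"]) (auto simp: J_def)
  then obtain v where v: "\<And>k. v k \<in> S" "\<And>k. J (v k) \<le> Inf (J ` S) + 1 / Suc k" "form_Cauchy b v"
    unfolding J_def by auto
  have vV: "v k \<in> V" for k using v(1) S(1) by auto
  obtain w where w: "w \<in> V" "(\<lambda>n. nb (\<lambda>x. v n x - w x)) \<longlonglongrightarrow> 0"
    using \<open>complete\<close> v(3) vV unfolding complete_def by blast
  have J_tendsto: "(\<lambda>n. J (z n)) \<longlonglongrightarrow> J y"
    if z: "\<And>n. z n \<in> V" and y: "y \<in> V" "(\<lambda>n. nb (\<lambda>x. z n x - y x)) \<longlonglongrightarrow> 0" for z y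
  proof -
    have "(\<lambda>n. l (z n) - l y) \<longlonglongrightarrow> 0"
    proof (rule Lim_null_comparison[OF _ tendsto_mult_right_zero[OF y(2), of K]])
      have "\<bar>l (z n) - l y\<bar> \<le> K * nb (\<lambda>x. z n x - y x)" for n
        using l_bound[OF diff_in[OF z[of n] y(1)]] l_add[OF z[of n] minus_in[OF y(1)]] l_scale[OF y(1), of "-1"]
        by simp
      then show "\<forall>\<^sub>F n in sequentially. norm (l (z n) - l y) \<le> K * nb (\<lambda>x. z n x - y x)" by simp
    qed
    then have "(\<lambda>n. l (z n)) \<longlonglongrightarrow> l y" by (simp add: LIM_zero_iff)
    moreover have "(\<lambda>n. (nb (z n))\<^sup>2) \<longlonglongrightarrow> (nb y)\<^sup>2" using nb_tendsto[OF z y] by (rule tendsto_power)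
    ultimately show ?thesis
      unfolding J_def using z y(1) by (auto simp: nb_sq intro!: tendsto_intros)
  qed
  have "(\<lambda>k. Inf (J ` S) + 1 / Suc k) \<longlonglongrightarrow> Inf (J ` S) + 0"
    by (intro tendsto_intros LIMSEQ_Suc lim_1_over_n)
  then have Jw: "J w \<le> Inf (J ` S)"
    using LIMSEQ_le[OF J_tendsto[OF vV w]] v(2) by auto
  have le: "l u \<le> b w u" if u: "u \<in> S" for u
  proof -
    have uV: "u \<in> V" using u S(1) by auto
    have "0 \<le> 2 * (b w u - l u)"
    proof (rule quadratic_nonneg_imp)
      fix t :: real
      \<comment> \<open>The competitor \<open>w + t u\<close> need not lie in \<open>S\<close>; it
        is compared with the infimum through the elements \<open>z n\<close> of \<open>S\<close>
        that converge to it.\<close>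
      define z where "z n x = v n x + t * u x" for n x
      have zS: "z n \<in> S" for n unfolding z_def by (intro S_add S_scale v u)
      have wt: "(\<lambda>x. w x + t * u x) \<in> V" by (intro add_in scale_in w(1) uV)
      have "(\<lambda>n. J (z n)) \<longlonglongrightarrow> J (\<lambda>x. w x + t * u x)"
        using zS S(1) w(2) by (intro J_tendsto wt) (auto simp: z_def)
      moreover have "bdd_below (J ` S)" using J_low S(1) by (intro bdd_belowI[of _ "- K\<^sup>2"]) auto
      then have "Inf (J ` S) \<le> J (z n)" for n using zS by (intro cInf_lower) auto
      ultimately have "J w \<le> J (\<lambda>x. w x + t * u x)"
        using Jw by (intro LIMSEQ_le_const[where X = "\<lambda>n. J (z n)"]) (auto intro: order_trans)
      also have "\<dots> = J w + t * (2 * (b w u - l u)) + t\<^sup>2 * b u u"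
        using b_quad[OF w(1) uV, of 1 t] l_add[OF w(1) scale_in[OF uV, of t]] l_scale[OF uV]
        by (simp add: J_def algebra_simps)
      finally show "0 \<le> t * (2 * (b w u - l u)) + t\<^sup>2 * b u u" by simp
    qed
    then show ?thesis by simp
  qed
  have "b w u = l u" if "u \<in> S" for u
  proof -
    have uV: "u \<in> V" using that S(1) by auto
    show ?thesis
      using le[OF that] le[OF S_scale[OF that, of "-1"]] b_scale_right[OF uV w(1), of "-1"] l_scale[OF uV, of "-1"]
      by simp
  qed
  then show ?thesis using w v(1) by blast
qed

lemma riesz:
  assumes complete
    and "\<And>u v. u \<in> V \<Longrightarrow> v \<in> V \<Longrightarrow> l (\<lambda>x. u x + v x) = l u + l v"
    and "\<And>c u. u \<in> V \<Longrightarrow> l (\<lambda>x. c * u x) = c * l u"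
    and "\<And>v. v \<in> V \<Longrightarrow> \<bar>l v\<bar> \<le> K * nb v"
  shows "\<exists>w\<in>V. \<forall>v\<in>V. b w v = l v"
proof -
  have "\<exists>w\<in>V. (\<exists>v. (\<forall>n. v n \<in> V) \<and> (\<lambda>n. nb (\<lambda>x. v n x - w x)) \<longlonglongrightarrow> 0) \<and> (\<forall>u\<in>V. b w u = l u)"
    by (rule riesz_subspace[where l = l and K = K]) (use assms zero_in add_in scale_in in auto)
  then show ?thesis by (elim bexE conjE) (rule bexI)
qed

text \<open>The projection \<open>w\<close> of \<open>x\<close> onto the closure of \<open>S\<close>
  leaves \<open>x - w\<close> orthogonal to \<open>S\<close>, hence of seminorm zero; elements of
  \<open>S\<close> close to \<open>w\<close> are then equally close to \<open>x\<close>.\<close>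

lemma dense_if_orthogonal_trivial:
  assumes complete and S: "S \<subseteq> V" "(\<lambda>x. 0) \<in> S"
    and S_add: "\<And>u v. u \<in> S \<Longrightarrow> v \<in> S \<Longrightarrow> (\<lambda>x. u x + v x) \<in> S"
    and S_scale: "\<And>c u. u \<in> S \<Longrightarrow> (\<lambda>x. c * u x) \<in> S"
    and orth: "\<And>y. y \<in> V \<Longrightarrow> (\<And>v. v \<in> S \<Longrightarrow> b y v = 0) \<Longrightarrow> b y y = 0"
    and x: "x \<in> V" and "0 < (e::real)"
  shows "\<exists>v\<in>S. nb (\<lambda>z. x z - v z) < e"
proof -
  have "\<exists>w\<in>V. (\<exists>v. (\<forall>n. v n \<in> S) \<and> (\<lambda>n. nb (\<lambda>x. v n x - w x)) \<longlonglongrightarrow> 0) \<and> (\<forall>u\<in>S. b w u = b x u)"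
  proof (rule riesz_subspace[OF \<open>complete\<close> S S_add S_scale])
    show "\<bar>b x v\<bar> \<le> nb x * nb v" if "v \<in> V" for v by (rule cauchy_schwarz[OF x that])
  qed (use x in \<open>simp_all add: b_add_right b_scale_right\<close>)
  then obtain w v where w: "w \<in> V" "\<forall>u\<in>S. b w u = b x u"
    and v: "\<forall>n. v n \<in> S" "(\<lambda>n. nb (\<lambda>z. v n z - w z)) \<longlonglongrightarrow> 0"
    by (elim bexE conjE exE)
  have "b (\<lambda>z. x z - w z) (\<lambda>z. x z - w z) = 0"
    using x w S(1) by (intro orth diff_in) (auto simp: b_diff subset_iff)
  then have xw: "nb (\<lambda>z. x z - w z) = 0" by (simp add: nb_def)
  obtain n where n: "nb (\<lambda>z. v n z - w z) < e"
    using LIMSEQ_D[OF v(2) \<open>0 < e\<close>] by (force simp: abs_less_iff)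
  have vV: "v n \<in> V" using v(1) S(1) by auto
  have "nb (\<lambda>z. x z - v n z) < e"
    using nb_triangle3[OF x w(1) vV] xw n nb_diff_commute[OF vV w(1)] by simp
  then show ?thesis using v(1) by blast
qed

end

section \<open>Square-integrable functions\<close>

lemma L2_measurable: "u \<in> L2 m \<Longrightarrow> u \<in> borel_measurable m"
  by (simp add: L2_def)

lemma L2_mult_integrable:
  assumes "u \<in> L2 m" "v \<in> L2 m"
  shows "integrable m (\<lambda>x. u x * v x)"
proof (rule Bochner_Integration.integrable_bound)
  show "integrable m (\<lambda>x. (u x)\<^sup>2 + (v x)\<^sup>2)" using assms by (auto simp: L2_def)
  show "(\<lambda>x. u x * v x) \<in> borel_measurable m" using assms by (auto simp: L2_def)
  have "\<bar>u x * v x\<bar> \<le> (u x)\<^sup>2 + (v x)\<^sup>2" for x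
  proof -
    have "2 * \<bar>u x * v x\<bar> \<le> (u x)\<^sup>2 + (v x)\<^sup>2"
      using sum_squares_bound[of "\<bar>u x\<bar>" "\<bar>v x\<bar>"] by (simp add: abs_mult mult.assoc)
    then show ?thesis by linarith
  qed
  then show "AE x in m. norm (u x * v x) \<le> norm ((u x)\<^sup>2 + (v x)\<^sup>2)" by simp
qed

lemma L2_bound:
  assumes "v \<in> L2 m" "u \<in> borel_measurable m" "AE x in m. \<bar>u x\<bar> \<le> \<bar>v x\<bar>"
  shows "u \<in> L2 m"
proof -
  have "AE x in m. norm ((u x)\<^sup>2) \<le> norm ((v x)\<^sup>2)"
    using assms(3) by eventually_elim (simp flip: abs_le_square_iff)
  then have "integrable m (\<lambda>x. (u x)\<^sup>2)"
    using assms(1,2) by (elim Bochner_Integration.integrable_bound[rotated 2]) (auto simp: L2_def)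
  then show ?thesis using assms(2) by (simp add: L2_def)
qed

lemma L2_add:
  assumes "u \<in> L2 m" "v \<in> L2 m"
  shows "(\<lambda>x. u x + v x) \<in> L2 m"
proof -
  have "integrable m (\<lambda>x. (u x)\<^sup>2 + 2 * (u x * v x) + (v x)\<^sup>2)"
    using assms L2_mult_integrable[OF assms]
    by (intro Bochner_Integration.integrable_add integrable_mult_right) (auto simp: L2_def)
  moreover have "(\<lambda>x. (u x)\<^sup>2 + 2 * (u x * v x) + (v x)\<^sup>2) = (\<lambda>x. (u x + v x)\<^sup>2)"
    by (simp add: fun_eq_iff power2_sum algebra_simps)
  ultimately show ?thesis using assms[THEN L2_measurable] by (simp add: L2_def)
qed

lemma psd_form_L2: "psd_form (L2 m) (\<lambda>u v. \<integral>x. u x * v x \<partial>m)"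
proof
  show "(\<lambda>x. c * u x) \<in> L2 m" if "u \<in> L2 m" for c u
    using that by (auto simp: L2_def power_mult_distrib)
  show "(\<integral>x. (u x + u' x) * v x \<partial>m) = (\<integral>x. u x * v x \<partial>m) + (\<integral>x. u' x * v x \<partial>m)"
    if "u \<in> L2 m" "u' \<in> L2 m" "v \<in> L2 m" for u u' v
    using that by (simp add: L2_mult_integrable distrib_right)
  show "(\<integral>x. (c * u x) * v x \<partial>m) = c * (\<integral>x. u x * v x \<partial>m)" for c :: real and u v
    by (simp add: mult.assoc)
qed (simp_all add: L2_add mult.commute, simp add: L2_def)

lemma L2_eq_zero:
  assumes "u \<in> L2 m" "(\<integral>x. u x * u x \<partial>m) = 0"
  shows "AE x in m. u x = 0"
proof -
  have "AE x in m. u x * u x = 0"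
    using assms L2_mult_integrable[OF assms(1,1)] by (subst (asm) integral_nonneg_eq_0_iff_AE) auto
  then show ?thesis by simp
qed

text \<open>Fatou's lemma including integrability of the limit. The bound is asked only from some
  index on, since it usually comes from a Cauchy property.\<close>

lemma integral_Fatou:
  fixes f :: "nat \<Rightarrow> 'a \<Rightarrow> real"
  assumes f: "\<And>j. integrable M (f j)" "\<And>j. AE x in M. 0 \<le> f j x"
    and F: "F \<in> borel_measurable M" "AE x in M. (\<lambda>j. f j x) \<longlonglongrightarrow> F x"
    and le: "\<And>j. N \<le> j \<Longrightarrow> integral\<^sup>L M (f j) \<le> c"
  shows "integrable M F \<and> integral\<^sup>L M F \<le> c"
proof -
  have [measurable]: "f j \<in> borel_measurable M" for j using f(1) by auto
  have c: "0 \<le> c" using integral_nonneg_AE[OF f(2), of N] le[of N] by simp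
  have "AE x in M. \<forall>j. 0 \<le> f j x" using f(2) by (simp add: AE_all_countable)
  then have F0: "AE x in M. 0 \<le> F x"
    using F(2) by eventually_elim (rule LIMSEQ_le_const, auto)
  have "(\<integral>\<^sup>+x. ennreal (F x) \<partial>M) \<le> (\<integral>\<^sup>+x. liminf (\<lambda>j. ennreal (f j x)) \<partial>M)"
  proof (rule nn_integral_mono_AE)
    show "AE x in M. ennreal (F x) \<le> liminf (\<lambda>j. ennreal (f j x))"
      using F(2)
    proof eventually_elim
      case (elim x)
      have "liminf (\<lambda>j. ennreal (f j x)) = ennreal (F x)"
        by (rule lim_imp_Liminf[OF sequentially_bot tendsto_ennrealI[OF elim]])
      then show ?case by simp
    qed
  qed
  also have "\<dots> \<le> liminf (\<lambda>j. \<integral>\<^sup>+x. ennreal (f j x) \<partial>M)"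
    by (rule nn_integral_liminf) measurable
  also have "\<dots> \<le> limsup (\<lambda>j. \<integral>\<^sup>+x. ennreal (f j x) \<partial>M)"
    by (rule Liminf_le_Limsup) simp
  also have "\<dots> \<le> ennreal c"
    using nn_integral_eq_integral[OF f] le
    by (intro Limsup_bounded, unfold eventually_sequentially) (auto intro: ennreal_leI)
  finally have le_c: "(\<integral>\<^sup>+x. ennreal (F x) \<partial>M) \<le> ennreal c" .
  have int: "integrable M F"
    by (rule integrableI_nonneg[OF F(1) F0]) (use le_c in \<open>auto intro: le_less_trans\<close>)
  then show ?thesis
    using le_c nn_integral_eq_integral[OF int F0] c by (simp add: ennreal_le_iff)
qed

lemma L2_dominated_convergence:
  assumes "h \<in> L2 m" "\<And>n. u n \<in> borel_measurable m" "z \<in> borel_measurable m"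
    and "AE x in m. (\<lambda>n. u n x) \<longlonglongrightarrow> z x" "\<And>n. AE x in m. \<bar>u n x - z x\<bar> \<le> h x"
  shows "(\<lambda>n. \<integral>x. (u n x - z x) * (u n x - z x) \<partial>m) \<longlonglongrightarrow> 0"
proof -
  have "(\<lambda>n. \<integral>x. (u n x - z x) * (u n x - z x) \<partial>m) \<longlonglongrightarrow> (\<integral>x. 0 \<partial>m)"
  proof (rule integral_dominated_convergence[where w = "\<lambda>x. h x * h x"])
    show "integrable m (\<lambda>x. h x * h x)" using assms(1) L2_mult_integrable by blast
    show "AE x in m. (\<lambda>n. (u n x - z x) * (u n x - z x)) \<longlonglongrightarrow> 0"
      using assms(4)
    proof eventually_elim
      case (elim x)
      then have "(\<lambda>n. u n x - z x) \<longlonglongrightarrow> 0" by (simp add: LIM_zero_iff)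
      then show ?case using tendsto_mult[of _ 0 _ _ 0] by fastforce
    qed
    show "AE x in m. norm ((u n x - z x) * (u n x - z x)) \<le> h x * h x" for n
      using assms(5)[of n]
    proof eventually_elim
      case (elim x)
      then show ?case using mult_mono[OF elim elim] by (simp add: abs_mult)
    qed
  qed (use assms in auto)
  then show ?thesis by simp
qed

section \<open>Symmetric Dirichlet forms\<close>

text \<open>\<open>unit_le\<close> is the Markov property in symmetric form; the two one-sided
  contraction inequalities of a nonsymmetric form yield it for the symmetric part.\<close>

locale dform =
  fixes m :: "'a::metric_space measure" and a :: "'a form" and D :: "('a \<Rightarrow> real) set"
  assumes sets_m [measurable_cong]: "sets m = sets borel"
    and bilinear: "bilinear_form_on m a D"
    and symmetric: "\<And>u v. u \<in> D \<Longrightarrow> v \<in> D \<Longrightarrow> a u v = a v u"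
    and nonneg: "\<And>u. u \<in> D \<Longrightarrow> 0 \<le> a u u"
    and dense: "dense_in_L2 m D"
    and closed: "closed_form m a D"
    and unit_in: "\<And>u. u \<in> D \<Longrightarrow> unit_contraction u \<in> D"
    and unit_le: "\<And>u. u \<in> D \<Longrightarrow> a (unit_contraction u) (unit_contraction u) \<le> a u u"
begin

lemma D_L2: "u \<in> D \<Longrightarrow> u \<in> L2 m"
  using bilinear by (auto simp: bilinear_form_on_def)

lemma D_measurable [measurable_dest]: "u \<in> D \<Longrightarrow> u \<in> borel_measurable borel"
  using D_L2 L2_measurable measurable_cong_sets[OF sets_m refl] by blast

lemma D_version: "u \<in> D \<Longrightarrow> v \<in> borel_measurable m \<Longrightarrow> (AE x in m. u x = v x) \<Longrightarrow> v \<in> D"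
  using bilinear unfolding bilinear_form_on_def by blast

sublocale a: psd_form D a
proof
  show "(\<lambda>x. 0) \<in> D" using bilinear unfolding bilinear_form_on_def by blast
  show "(\<lambda>x. u x + v x) \<in> D" if "u \<in> D" "v \<in> D" for u v
    using bilinear that unfolding bilinear_form_on_def by blast
  show "(\<lambda>x. c * u x) \<in> D" if "u \<in> D" for c u
    using bilinear that unfolding bilinear_form_on_def by blast
  show "a (\<lambda>x. u x + u' x) v = a u v + a u' v" if "u \<in> D" "u' \<in> D" "v \<in> D" for u u' v
    using bilinear that unfolding bilinear_form_on_def by blast
  show "a (\<lambda>x. c * u x) v = c * a u v" if "u \<in> D" "v \<in> D" for c u v
    using bilinear that unfolding bilinear_form_on_def by blast
qed (rule symmetric nonneg, assumption+)+

sublocale L: psd_form "L2 m" "\<lambda>u v. \<integral>x. u x * v x \<partial>m"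
  by (rule psd_form_L2)

lemma psd_form_alpha:
  assumes "0 \<le> \<alpha>"
  shows "psd_form D (form_alpha m a \<alpha>)"
proof
  fix u u' v :: "'a \<Rightarrow> real" and c :: real
  assume u: "u \<in> D" and v: "v \<in> D"
  show "form_alpha m a \<alpha> u v = form_alpha m a \<alpha> v u"
    using a.b_sym[OF u v] L.b_sym[OF D_L2[OF u] D_L2[OF v]] by (simp add: form_alpha_def)
  show "form_alpha m a \<alpha> (\<lambda>x. c * u x) v = c * form_alpha m a \<alpha> u v"
    using a.b_scale[OF u v, of c] L.b_scale[OF D_L2[OF u] D_L2[OF v], of c]
    unfolding form_alpha_def by (simp add: algebra_simps)
  assume u': "u' \<in> D"
  show "form_alpha m a \<alpha> (\<lambda>x. u x + u' x) v = form_alpha m a \<alpha> u v + form_alpha m a \<alpha> u' v"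
    using a.b_add[OF u u' v] L.b_add[OF D_L2[OF u] D_L2[OF u'] D_L2[OF v]]
    by (simp only: form_alpha_def distrib_left add_ac)
next
  show "0 \<le> form_alpha m a \<alpha> u u" if "u \<in> D" for u
    using nonneg[OF that] L.b_nonneg[OF D_L2[OF that]] assms by (simp add: form_alpha_def)
qed (rule a.zero_in a.add_in a.scale_in, assumption?, assumption?)+

sublocale e: psd_form D "form_alpha m a 1"
  by (rule psd_form_alpha) simp

lemma e_eq: "form_alpha m a 1 u v = a u v + (\<integral>x. u x * v x \<partial>m)"
  by (simp add: form_alpha_def)

lemma a_le_e: "u \<in> D \<Longrightarrow> a.nb u \<le> e.nb u"
  by (simp add: a.nb_def e.nb_def e_eq L.b_nonneg D_L2)

lemma L_le_e: "u \<in> D \<Longrightarrow> L.nb u \<le> e.nb u"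
  by (simp add: L.nb_def e.nb_def e_eq nonneg)

lemma e_le: "u \<in> D \<Longrightarrow> e.nb u \<le> a.nb u + L.nb u"
  unfolding a.nb_def e.nb_def e_eq L.nb_def
  by (intro sqrt_add_le_add_sqrt L.b_nonneg nonneg) (auto simp: D_L2)

lemma e_complete: "e.complete"
  using closed unfolding e.complete_def closed_form_def e.nb_def by blast

lemma a_cong:
  assumes "u \<in> D" "u' \<in> D" "v \<in> D" "v' \<in> D" "AE x in m. u x = u' x" "AE x in m. v x = v' x"
  shows "a u v = a u' v'"
  using bilinear assms unfolding bilinear_form_on_def by metis

lemma L_cong:
  assumes "AE x in m. u x = u' x" "AE x in m. v x = v' x" "u \<in> D" "u' \<in> D" "v \<in> D" "v' \<in> D"
  shows "(\<integral>x. u x * v x \<partial>m) = (\<integral>x. u' x * v' x \<partial>m)"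
  by (rule integral_cong_AE) (use assms in auto)

lemma a_nb_cong:
  assumes "u \<in> D" "u' \<in> D" "AE x in m. u x = u' x"
  shows "a.nb u = a.nb u'"
  using a_cong[OF assms(1,2,1,2,3,3)] by (simp add: a.nb_def)

lemma e_nb_cong:
  assumes "u \<in> D" "u' \<in> D" "AE x in m. u x = u' x"
  shows "e.nb u = e.nb u'"
  using a_cong[OF assms(1,2,1,2,3,3)] L_cong[OF assms(3,3,1,2,1,2)] by (simp add: e.nb_def e_eq)

lemma L_nb_zero: "u \<in> L2 m \<Longrightarrow> L.nb u = 0 \<Longrightarrow> AE x in m. u x = 0"
  by (rule L2_eq_zero) (simp_all add: L.nb_def)

lemma e_Cauchy:
  assumes "form_Cauchy a u" "\<And>n. u n \<in> D" "z \<in> L2 m" "(\<lambda>n. L.nb (\<lambda>x. u n x - z x)) \<longlonglongrightarrow> 0"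
  shows "form_Cauchy (form_alpha m a 1) u"
  unfolding e.form_Cauchy_iff
proof (intro allI impI)
  fix \<epsilon> :: real assume "\<epsilon> > 0"
  then obtain N where N: "\<And>i j. i \<ge> N \<Longrightarrow> j \<ge> N \<Longrightarrow> a.nb (\<lambda>x. u i x - u j x) < \<epsilon> / 3"
    using assms(1) unfolding a.form_Cauchy_iff by (meson zero_less_divide_iff zero_less_numeral)
  have "\<forall>\<^sub>F n in sequentially. L.nb (\<lambda>x. u n x - z x) < \<epsilon> / 3"
    using assms(4) \<open>\<epsilon> > 0\<close> by (intro order_tendstoD(2)) auto
  then obtain N' where N': "\<And>i. i \<ge> N' \<Longrightarrow> L.nb (\<lambda>x. u i x - z x) < \<epsilon> / 3"
    by (auto simp: eventually_sequentially)
  have "e.nb (\<lambda>x. u i x - u j x) < \<epsilon>" if "i \<ge> max N N'" "j \<ge> max N N'" for i j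
  proof -
    have "L.nb (\<lambda>x. u i x - u j x) \<le> L.nb (\<lambda>x. u i x - z x) + L.nb (\<lambda>x. z x - u j x)"
      using assms(2,3) by (intro L.nb_triangle3) (auto simp: D_L2)
    then show ?thesis
      using e_le[OF a.diff_in[OF assms(2,2)], of i j] N[of i j] N'[of i] N'[of j] that
        L.nb_diff_commute[OF assms(3) D_L2[OF assms(2)], of j] by simp
  qed
  then show "\<exists>N. \<forall>i\<ge>N. \<forall>j\<ge>N. e.nb (\<lambda>x. u i x - u j x) < \<epsilon>" by blast
qed

text \<open>A substitute for the Banach-Saks theorem.\<close>

lemma weak_closure:
  assumes S: "S \<subseteq> D" "\<And>u v. u \<in> S \<Longrightarrow> v \<in> S \<Longrightarrow> (\<lambda>x. (u x + v x) / 2) \<in> S"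
    and z: "z \<in> L2 m"
    and approx: "\<And>\<epsilon>. 0 < \<epsilon> \<Longrightarrow> \<exists>v\<in>S. a v v \<le> M \<and> L.nb (\<lambda>x. v x - z x) \<le> \<epsilon>"
  shows "z \<in> D \<and> a z z \<le> M \<and> (\<forall>\<epsilon>>0. \<exists>v\<in>S. e.nb (\<lambda>x. z x - v x) < \<epsilon>)"
proof -
  \<comment> \<open>Only closeness in L2 is prescribed. Choosing elements of nearly minimal energy
    in each \<open>C k\<close> adds the Cauchy property in energy.\<close>
  define C where "C k = {v \<in> S. a v v \<le> M \<and> L.nb (\<lambda>x. v x - z x) \<le> 1 / Suc k}" for k
  have "\<exists>v. (\<forall>k. v k \<in> C k) \<and> form_Cauchy a v"
  proof (rule a.convex_Cauchy)
    show "C k \<subseteq> D" for k using S(1) by (auto simp: C_def)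
    have "1 / real (Suc (Suc k)) \<le> 1 / real (Suc k)" for k by (simp add: frac_le)
    then show "C (Suc k) \<subseteq> C k" for k unfolding C_def using order_trans by blast
    show "\<exists>v\<in>C k. a v v \<le> M" for k using approx[of "1 / Suc k"] by (auto simp: C_def)
    show "(\<lambda>x. (u x + v x) / 2) \<in> C k" if uv: "u \<in> C k" "v \<in> C k" for k u v
    proof -
      have D: "u \<in> D" "v \<in> D" using uv S(1) by (auto simp: C_def)
      have "L.nb (\<lambda>x. (1/2) * ((u x - z x) + (v x - z x))) = 1/2 * L.nb (\<lambda>x. (u x - z x) + (v x - z x))"
        using L.nb_scale[OF L.add_in[OF L.diff_in[OF D_L2[OF D(1)] z] L.diff_in[OF D_L2[OF D(2)] z]], of "1/2"]
        by simp
      also have "\<dots> \<le> 1/2 * (L.nb (\<lambda>x. u x - z x) + L.nb (\<lambda>x. v x - z x))"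
        using L.nb_add[OF L.diff_in[OF D_L2[OF D(1)] z] L.diff_in[OF D_L2[OF D(2)] z]] by simp
      also have "\<dots> \<le> 1 / Suc k" using uv by (simp add: C_def)
      also have "(\<lambda>x. (1/2) * ((u x - z x) + (v x - z x))) = (\<lambda>x. (u x + v x) / 2 - z x)"
        by (auto simp: field_simps)
      finally show ?thesis using uv S(2) a.b_mid_le[OF D] by (simp add: C_def)
    qed
  qed
  then obtain v where v: "\<And>k. v k \<in> C k" "form_Cauchy a v" by blast
  have vD: "v k \<in> D" for k using v(1) S(1) by (auto simp: C_def)
  have vz: "(\<lambda>n. L.nb (\<lambda>x. v n x - z x)) \<longlonglongrightarrow> 0"
  proof (rule tendsto_sandwich[OF _ _ tendsto_const])
    show "(\<lambda>n. 1 / real (Suc n)) \<longlonglongrightarrow> 0" using LIMSEQ_Suc[OF lim_1_over_n] .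
    show "\<forall>\<^sub>F n in sequentially. 0 \<le> L.nb (\<lambda>x. v n x - z x)"
      using L.nb_nonneg[OF L.diff_in[OF D_L2[OF vD] z]] by simp
    show "\<forall>\<^sub>F n in sequentially. L.nb (\<lambda>x. v n x - z x) \<le> 1 / real (Suc n)"
      using v(1) by (simp add: C_def)
  qed
  obtain w where w: "w \<in> D" "(\<lambda>n. e.nb (\<lambda>x. v n x - w x)) \<longlonglongrightarrow> 0"
    using e_complete e_Cauchy[OF v(2) vD z vz] vD unfolding e.complete_def by blast
  \<comment> \<open>Closedness provides some limit \<open>w\<close>; the L2 limit being unique,
    \<open>w\<close> is a version of \<open>z\<close>.\<close>
  have "L.nb (\<lambda>x. w x - z x) \<le> 0"
  proof (rule LIMSEQ_le_const)
    show "(\<lambda>n. e.nb (\<lambda>x. v n x - w x) + L.nb (\<lambda>x. v n x - z x)) \<longlonglongrightarrow> 0"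
      using tendsto_add[OF w(2) vz] by simp
    have "L.nb (\<lambda>x. w x - z x) \<le> e.nb (\<lambda>x. v n x - w x) + L.nb (\<lambda>x. v n x - z x)" for n
      using L.nb_triangle3[OF D_L2[OF w(1)] D_L2[OF vD] z, of n] L_le_e[OF a.diff_in[OF vD w(1)], of n]
        L.nb_diff_commute[OF D_L2[OF w(1)] D_L2[OF vD], of n] by simp
    then show "\<exists>N. \<forall>n\<ge>N. L.nb (\<lambda>x. w x - z x) \<le> e.nb (\<lambda>x. v n x - w x) + L.nb (\<lambda>x. v n x - z x)"
      by blast
  qed
  then have "AE x in m. w x - z x = 0"
    using L.nb_nonneg[OF L.diff_in[OF D_L2[OF w(1)] z]] by (intro L_nb_zero L.diff_in D_L2 w(1) z) auto
  then have wz: "AE x in m. w x = z x" by simp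
  have zD: "z \<in> D" using D_version[OF w(1) L2_measurable[OF z] wz] .
  have ev: "e.nb (\<lambda>x. v n x - w x) = e.nb (\<lambda>x. v n x - z x)" for n
    using wz by (intro e_nb_cong a.diff_in vD w(1) zD) auto
  have e: "(\<lambda>n. e.nb (\<lambda>x. v n x - z x)) \<longlonglongrightarrow> 0" using w(2) by (simp add: ev)
  then have "(\<lambda>n. a.nb (\<lambda>x. v n x - z x)) \<longlonglongrightarrow> 0"
    using a_le_e[OF a.diff_in[OF vD zD]] a.nb_nonneg[OF a.diff_in[OF vD zD]]
    by (intro tendsto_sandwich[OF _ _ tendsto_const e]) auto
  then have "(\<lambda>n. (a.nb (v n))\<^sup>2) \<longlonglongrightarrow> (a.nb z)\<^sup>2"
    by (intro tendsto_power a.nb_tendsto vD zD)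
  then have "(a.nb z)\<^sup>2 \<le> M"
    using v(1) by (intro LIMSEQ_le_const2[where X = "\<lambda>n. (a.nb (v n))\<^sup>2"]) (auto simp: a.nb_sq[OF vD] C_def)
  moreover have "\<exists>u\<in>S. e.nb (\<lambda>x. z x - u x) < \<epsilon>" if "\<epsilon> > 0" for \<epsilon>
  proof -
    have "\<forall>\<^sub>F n in sequentially. e.nb (\<lambda>x. v n x - z x) < \<epsilon>" using e that by (rule order_tendstoD(2))
    then obtain n where "e.nb (\<lambda>x. v n x - z x) < \<epsilon>" by (auto simp: eventually_sequentially)
    then show ?thesis using v(1)[of n] e.nb_diff_commute[OF vD zD, of n] by (auto simp: C_def)
  qed
  ultimately show ?thesis using zD by (simp add: a.nb_sq)
qed

text \<open>A common L2 dominator turns pointwise into L2 convergence, so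
  \<open>weak_closure\<close> applies. The sequence \<open>v\<close> itself need not converge in
  energy; only other elements of \<open>S\<close> are claimed to approach \<open>z\<close>.\<close>

lemma weak_closure_seq:
  assumes "S \<subseteq> D" "\<And>u v. u \<in> S \<Longrightarrow> v \<in> S \<Longrightarrow> (\<lambda>x. (u x + v x) / 2) \<in> S"
    and v: "\<And>n. v n \<in> S" "\<And>n. a.nb (v n) \<le> M"
    and z: "z \<in> borel_measurable borel" "AE x in m. (\<lambda>n. v n x) \<longlonglongrightarrow> z x"
    and h: "h \<in> L2 m" "\<And>n. AE x in m. \<bar>v n x\<bar> \<le> h x"
  shows "z \<in> D \<and> a.nb z \<le> M \<and> (\<forall>\<epsilon>>0. \<exists>v\<in>S. e.nb (\<lambda>x. z x - v x) < \<epsilon>)"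
proof -
  have M: "0 \<le> M" using v a.nb_nonneg[of "v 0"] assms(1) by (meson order_trans subsetD)
  have zm: "z \<in> borel_measurable m" using z(1) measurable_cong_sets[OF sets_m refl] by blast
  have "AE x in m. \<forall>n. \<bar>v n x\<bar> \<le> h x" using h(2) by (simp add: AE_all_countable)
  then have zh: "AE x in m. \<bar>z x\<bar> \<le> h x"
    using z(2)
  proof eventually_elim
    case (elim x)
    then show ?case by (intro LIMSEQ_le_const2[where X = "\<lambda>n. \<bar>v n x\<bar>"] tendsto_rabs) auto
  qed
  have zL: "z \<in> L2 m"
    by (rule L2_bound[OF h(1) zm]) (use zh in eventually_elim, auto)
  have vm: "v n \<in> borel_measurable m" for n using v(1) assms(1) D_L2 L2_measurable by blast
  have "(\<lambda>n. \<integral>x. (v n x - z x) * (v n x - z x) \<partial>m) \<longlonglongrightarrow> 0"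
  proof (rule L2_dominated_convergence[where h = "\<lambda>x. 2 * h x"])
    show "AE x in m. \<bar>v n x - z x\<bar> \<le> 2 * h x" for n using zh h(2)[of n] by eventually_elim auto
  qed (use h z vm zm L.scale_in in auto)
  then have lim: "(\<lambda>n. L.nb (\<lambda>x. v n x - z x)) \<longlonglongrightarrow> 0"
    unfolding L.nb_def using tendsto_real_sqrt by force
  have approx: "\<exists>u\<in>S. a u u \<le> M\<^sup>2 \<and> L.nb (\<lambda>x. u x - z x) \<le> \<epsilon>" if "0 < \<epsilon>" for \<epsilon>
  proof -
    have "\<forall>\<^sub>F n in sequentially. L.nb (\<lambda>x. v n x - z x) < \<epsilon>" using lim that by (rule order_tendstoD(2))
    then obtain n where "L.nb (\<lambda>x. v n x - z x) < \<epsilon>" by (auto simp: eventually_sequentially)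
    moreover have "a (v n) (v n) \<le> M\<^sup>2"
      using v assms(1) a.nb_nonneg a.nb_sq by (metis power_mono subsetD)
    ultimately show ?thesis using v(1) by (intro bexI[of _ "v n"]) auto
  qed
  have "z \<in> D \<and> a z z \<le> M\<^sup>2 \<and> (\<forall>\<epsilon>>0. \<exists>v\<in>S. e.nb (\<lambda>x. z x - v x) < \<epsilon>)"
    by (rule weak_closure[OF assms(1,2) zL approx])
  then show ?thesis using M real_sqrt_le_mono[of "a z z" "M\<^sup>2"] by (simp add: a.nb_def)
qed

lemmas D_limit = weak_closure_seq[of D, OF subset_refl a.mid_in]

subsection \<open>Contractions\<close>

lemma trunc_eq: "0 < c \<Longrightarrow> (\<lambda>x. min (max (u x) 0) c) = (\<lambda>x. c * unit_contraction (\<lambda>x. (1/c) * u x) x)"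
  for c :: real
  by (auto simp: unit_contraction_def fun_eq_iff min_def max_def field_simps)

lemma trunc_in: "u \<in> D \<Longrightarrow> 0 < c \<Longrightarrow> (\<lambda>x. min (max (u x) 0) c) \<in> D"
  unfolding trunc_eq by (intro a.scale_in unit_in)

lemma trunc_le:
  assumes "u \<in> D" "0 < c"
  shows "a.nb (\<lambda>x. min (max (u x) 0) c) \<le> a.nb u"
proof -
  have s: "(\<lambda>x. (1/c) * u x) \<in> D" by (rule a.scale_in[OF assms(1)])
  have "a.nb (\<lambda>x. min (max (u x) 0) c) = c * a.nb (unit_contraction (\<lambda>x. (1/c) * u x))"
    unfolding trunc_eq[OF assms(2)] using a.nb_scale[OF unit_in[OF s], of c] assms(2) by simp
  also have "a.nb (unit_contraction (\<lambda>x. (1/c) * u x)) \<le> a.nb (\<lambda>x. (1/c) * u x)"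
    unfolding a.nb_def using unit_le[OF s] by simp
  also have "c * a.nb (\<lambda>x. (1/c) * u x) = a.nb u"
    using assms(2) by (subst a.nb_scale[OF assms(1)]) simp
  finally show ?thesis using assms(2) by simp
qed

text \<open>The positive part is the pointwise limit of the truncations at the heights
  \<open>Suc n\<close>, none of which has more energy than \<open>u\<close>.\<close>

lemma pos_in_le:
  assumes "u \<in> D"
  shows "(\<lambda>x. max (u x) 0) \<in> D \<and> a.nb (\<lambda>x. max (u x) 0) \<le> a.nb u"
proof -
  have "(\<lambda>x. max (u x) 0) \<in> D \<and> a.nb (\<lambda>x. max (u x) 0) \<le> a.nb u \<and>
     (\<forall>\<epsilon>>0. \<exists>v\<in>D. e.nb (\<lambda>x. max (u x) 0 - v x) < \<epsilon>)"
  proof (rule D_limit[where v = "\<lambda>n x. min (max (u x) 0) (real (Suc n))" and h = "\<lambda>x. \<bar>u x\<bar>"])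
    show "(\<lambda>x. min (max (u x) 0) (real (Suc n))) \<in> D" for n by (rule trunc_in[OF assms]) simp
    show "a.nb (\<lambda>x. min (max (u x) 0) (real (Suc n))) \<le> a.nb u" for n by (rule trunc_le[OF assms]) simp
    have "(\<lambda>n. min (max (u x) 0) (real (Suc n))) \<longlonglongrightarrow> max (u x) 0" for x
    proof (rule tendsto_eventually)
      obtain N where "max (u x) 0 \<le> real N" using real_arch_simple by blast
      then show "\<forall>\<^sub>F n in sequentially. min (max (u x) 0) (real (Suc n)) = max (u x) 0"
        unfolding eventually_sequentially by (intro exI[of _ N]) auto
    qed
    then show "AE x in m. (\<lambda>n. min (max (u x) 0) (real (Suc n))) \<longlonglongrightarrow> max (u x) 0" by simp
    show "(\<lambda>x. \<bar>u x\<bar>) \<in> L2 m"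
      using D_L2[OF assms] L2_measurable[OF D_L2[OF assms]] by (intro L2_bound[OF D_L2[OF assms]]) auto
  qed (use assms in auto)
  then show ?thesis by blast
qed

lemmas pos_in = pos_in_le[THEN conjunct1] and pos_le = pos_in_le[THEN conjunct2]

text \<open>The factor 2 adds the bounds for the positive and the negative part.\<close>

lemma abs_in_le:
  assumes "u \<in> D"
  shows "(\<lambda>x. \<bar>u x\<bar>) \<in> D \<and> a.nb (\<lambda>x. \<bar>u x\<bar>) \<le> 2 * a.nb u"
proof -
  have eq: "(\<lambda>x. \<bar>u x\<bar>) = (\<lambda>x. max (u x) 0 + max (- u x) 0)" by auto
  note p = pos_in[OF assms] pos_in[OF a.minus_in[OF assms]]
  show ?thesis unfolding eq
    using a.add_in[OF p] a.nb_add[OF p] pos_le[OF assms] pos_le[OF a.minus_in[OF assms]] a.nb_minus[OF assms]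
    by simp
qed

lemmas abs_in = abs_in_le[THEN conjunct1] and abs_le = abs_in_le[THEN conjunct2]

lemma clip_in_le:
  assumes "u \<in> D" "0 < c"
  shows "(\<lambda>x. max (- c) (min (u x) c)) \<in> D \<and> a.nb (\<lambda>x. max (- c) (min (u x) c)) \<le> 2 * a.nb u"
proof -
  have eq: "(\<lambda>x. max (- c) (min (u x) c)) = (\<lambda>x. min (max (u x) 0) c - min (max (- u x) 0) c)"
    using assms(2) by (auto simp: min_def max_def fun_eq_iff)
  note p = trunc_in[OF assms] trunc_in[OF a.minus_in[OF assms(1)] assms(2)]
  show ?thesis unfolding eq
    using a.diff_in[OF p] a.nb_diff[OF p] trunc_le[OF assms] trunc_le[OF a.minus_in[OF assms(1)] assms(2)]
      a.nb_minus[OF assms(1)]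
    by simp
qed

lemmas clip_in = clip_in_le[THEN conjunct1] and clip_le = clip_in_le[THEN conjunct2]

text \<open>With \<open>X = min u t\<close> and \<open>Y = u - X\<close>, truncating
  \<open>X + s Y\<close> at \<open>t\<close> returns \<open>X\<close> for every
  \<open>s > 0\<close>. Hence the energy does not drop in direction \<open>Y\<close>, that is
  \<open>a X Y \<ge> 0\<close>. This is the sign needed to bound the mass of a penalized
  solution.\<close>

lemma a_min_nonneg:
  assumes "u \<in> D" "\<And>x. 0 \<le> u x" "0 < t"
  shows "0 \<le> a (\<lambda>x. min (u x) t) u"
proof -
  define X where "X x = min (u x) t" for x
  define Y where "Y x = u x - X x" for x
  have X_eq: "X = (\<lambda>x. min (max (u x) 0) t)" using assms(2) by (simp add: X_def fun_eq_iff max_absorb1)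
  have X: "X \<in> D" unfolding X_eq by (rule trunc_in[OF assms(1,3)])
  have Y: "Y \<in> D" unfolding Y_def using assms(1) X by (rule a.diff_in)
  have "0 \<le> 2 * a X Y"
  proof (rule quadratic_nonneg_imp)
    fix s :: real assume "0 < s"
    have "(\<lambda>x. min (max (X x + s * Y x) 0) t) = X"
    proof
      fix x show "min (max (X x + s * Y x) 0) t = X x"
        using assms(2)[of x] \<open>0 < s\<close> assms(3) by (cases "u x \<le> t") (auto simp: X_def Y_def)
    qed
    then have "a.nb X \<le> a.nb (\<lambda>x. X x + s * Y x)"
      using trunc_le[OF a.add_in[OF X a.scale_in[OF Y, of s]] assms(3)] by simp
    then have "a X X \<le> a (\<lambda>x. X x + s * Y x) (\<lambda>x. X x + s * Y x)" by (simp add: a.nb_def)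
    also have "\<dots> = a X X + s * (2 * a X Y) + s\<^sup>2 * a Y Y"
      using a.b_quad[OF X Y, of 1 s] by simp
    finally show "0 \<le> s * (2 * a X Y) + s\<^sup>2 * a Y Y" by simp
  qed
  moreover have "a X u = a X X + a X Y"
    using a.b_add_right[OF X Y X] by (simp add: Y_def)
  ultimately have "0 \<le> a X u" using nonneg[OF X] by simp
  then show ?thesis by (simp add: X_def[abs_def])
qed

subsection \<open>The resolvent\<close>

lemma resolvent_exists:
  assumes "\<phi> \<in> L2 m"
  shows "\<exists>w\<in>D. \<forall>v\<in>D. form_alpha m a 1 w v = (\<integral>x. \<phi> x * v x \<partial>m)"
proof (rule e.riesz[OF e_complete])
  show "\<bar>\<integral>x. \<phi> x * v x \<partial>m\<bar> \<le> L.nb \<phi> * e.nb v" if "v \<in> D" for v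
    using L.cauchy_schwarz[OF assms D_L2[OF that]] mult_left_mono[OF L_le_e[OF that] L.nb_nonneg[OF assms]]
    by linarith
qed (use assms L.b_add_right L.b_scale_right D_L2 in auto)

text \<open>The 1-resolvent. A representing function is picked, so its properties hold only almost
  everywhere.\<close>

definition G :: "('a \<Rightarrow> real) \<Rightarrow> 'a \<Rightarrow> real" where
  "G \<phi> = (SOME w. w \<in> D \<and> (\<forall>v\<in>D. form_alpha m a 1 w v = (\<integral>x. \<phi> x * v x \<partial>m)))"

lemma G: "\<phi> \<in> L2 m \<Longrightarrow> G \<phi> \<in> D \<and> (\<forall>v\<in>D. form_alpha m a 1 (G \<phi>) v = (\<integral>x. \<phi> x * v x \<partial>m))"
  unfolding G_def using resolvent_exists by (rule someI2_bex) blast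

lemmas G_in = G[THEN conjunct1] and G_eq = G[THEN conjunct2, rule_format]

text \<open>\<open>w\<close> minimises \<open>e(v,v) - 2 (\<phi>,v)\<close> and its positive part
  does at least as well, so both differ by seminorm zero. Stated for any solution \<open>w\<close>
  of the equation, it also covers sums and differences of resolvents.\<close>

lemma resolvent_nonneg:
  assumes w: "w \<in> D" and \<phi>: "\<phi> \<in> L2 m" "AE x in m. 0 \<le> \<phi> x"
    and eq: "\<And>v. v \<in> D \<Longrightarrow> form_alpha m a 1 w v = (\<integral>x. \<phi> x * v x \<partial>m)"
  shows "AE x in m. 0 \<le> w x"
proof -
  define p where "p x = max (w x) 0" for x
  have p: "p \<in> D" unfolding p_def by (rule pos_in[OF w])
  have "(\<integral>x. p x * p x \<partial>m) \<le> (\<integral>x. w x * w x \<partial>m)"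
    using L2_mult_integrable[OF D_L2[OF p] D_L2[OF p]] L2_mult_integrable[OF D_L2[OF w] D_L2[OF w]]
    by (intro integral_mono) (auto simp: p_def max_def)
  moreover have "a p p \<le> a w w"
    using pos_le[OF w] by (simp add: p_def[abs_def] a.nb_def)
  ultimately have 1: "form_alpha m a 1 p p \<le> form_alpha m a 1 w w" by (simp add: e_eq)
  have 2: "(\<integral>x. \<phi> x * w x \<partial>m) \<le> (\<integral>x. \<phi> x * p x \<partial>m)"
  proof (rule integral_mono_AE)
    show "AE x in m. \<phi> x * w x \<le> \<phi> x * p x"
      using \<phi>(2) by eventually_elim (auto simp: p_def intro!: mult_left_mono)
  qed (use L2_mult_integrable \<phi> D_L2 w p in auto)
  have "form_alpha m a 1 (\<lambda>x. w x - p x) (\<lambda>x. w x - p x) \<le> 0"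
    using e.b_quad_diff[OF w p] eq[OF p] eq[OF w] 1 2 by simp
  then have "(\<integral>x. (w x - p x) * (w x - p x) \<partial>m) \<le> 0"
    using nonneg[OF a.diff_in[OF w p]] by (simp add: e_eq)
  then have "(\<integral>x. (w x - p x) * (w x - p x) \<partial>m) = 0"
    using L.b_nonneg[OF L.diff_in[OF D_L2[OF w] D_L2[OF p]]] by simp
  then have "AE x in m. w x - p x = 0"
    by (intro L2_eq_zero L.diff_in D_L2 w p)
  then show ?thesis by eventually_elim (auto simp: p_def)
qed

lemma G_nonneg: "\<phi> \<in> L2 m \<Longrightarrow> AE x in m. 0 \<le> \<phi> x \<Longrightarrow> AE x in m. 0 \<le> G \<phi> x"
  using resolvent_nonneg[of "G \<phi>" \<phi>] G by blast

text \<open>Up to a constant, \<open>w\<close> minimises the energy of \<open>v\<close> plus the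
  squared L2 distance of \<open>v\<close> from \<open>\<phi>\<close>. Truncation to the interval
  from 0 to \<open>B\<close>, in which \<open>\<phi>\<close> takes its values, decreases both
  terms.\<close>

lemma resolvent_le:
  assumes w: "w \<in> D" and \<phi>: "\<phi> \<in> L2 m" "AE x in m. 0 \<le> \<phi> x" "AE x in m. \<phi> x \<le> B" and "0 < B"
    and eq: "\<And>v. v \<in> D \<Longrightarrow> form_alpha m a 1 w v = (\<integral>x. \<phi> x * v x \<partial>m)"
  shows "AE x in m. w x \<le> B"
proof -
  define t where "t x = min (max (w x) 0) B" for x
  have t: "t \<in> D" unfolding t_def by (rule trunc_in[OF w \<open>0 < B\<close>])
  have a: "a t t \<le> a w w"
    using trunc_le[OF w \<open>0 < B\<close>] by (simp add: t_def[abs_def] a.nb_def)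
  have "(\<integral>x. (t x - \<phi> x) * (t x - \<phi> x) \<partial>m) \<le> (\<integral>x. (w x - \<phi> x) * (w x - \<phi> x) \<partial>m)"
  proof (rule integral_mono_AE)
    show "AE x in m. (t x - \<phi> x) * (t x - \<phi> x) \<le> (w x - \<phi> x) * (w x - \<phi> x)"
      using \<phi>(2,3)
    proof eventually_elim
      case (elim x)
      then have "\<bar>t x - \<phi> x\<bar> \<le> \<bar>w x - \<phi> x\<bar>" using \<open>0 < B\<close> by (auto simp: t_def min_def max_def)
      then show ?case unfolding abs_le_square_iff power2_eq_square .
    qed
  qed (intro L2_mult_integrable L.diff_in D_L2 w t \<phi>(1))+
  then have "(\<integral>x. t x * t x \<partial>m) - 2 * (\<integral>x. \<phi> x * t x \<partial>m) \<le> (\<integral>x. w x * w x \<partial>m) - 2 * (\<integral>x. \<phi> x * w x \<partial>m)"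
    using L.b_quad_diff[OF D_L2[OF t] \<phi>(1)] L.b_quad_diff[OF D_L2[OF w] \<phi>(1)]
      L.b_sym[OF D_L2[OF t] \<phi>(1)] L.b_sym[OF D_L2[OF w] \<phi>(1)] by simp
  then have "form_alpha m a 1 (\<lambda>x. w x - t x) (\<lambda>x. w x - t x) \<le> 0"
    using e.b_quad_diff[OF w t] eq[OF t] eq[OF w] a e_eq[of t t] e_eq[of w w] by simp
  then have "(\<integral>x. (w x - t x) * (w x - t x) \<partial>m) \<le> 0"
    using nonneg[OF a.diff_in[OF w t]] by (simp add: e_eq)
  then have "(\<integral>x. (w x - t x) * (w x - t x) \<partial>m) = 0"
    using L.b_nonneg[OF L.diff_in[OF D_L2[OF w] D_L2[OF t]]] by simp
  then have "AE x in m. w x - t x = 0"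
    by (intro L2_eq_zero L.diff_in D_L2 w t)
  then show ?thesis by eventually_elim (auto simp: t_def)
qed

lemma G_mono:
  assumes "\<phi> \<in> L2 m" "\<psi> \<in> L2 m" "AE x in m. \<phi> x \<le> \<psi> x"
  shows "AE x in m. G \<phi> x \<le> G \<psi> x"
proof -
  have "AE x in m. 0 \<le> G \<psi> x - G \<phi> x"
  proof (rule resolvent_nonneg)
    show "form_alpha m a 1 (\<lambda>x. G \<psi> x - G \<phi> x) v = (\<integral>x. (\<psi> x - \<phi> x) * v x \<partial>m)" if "v \<in> D" for v
      using that assms G_in G_eq L.b_diff[OF assms(2,1) D_L2[OF that]] by (subst e.b_diff) auto
  qed (use assms G_in L.diff_in a.diff_in in auto)
  then show ?thesis by simp
qed

text \<open>Testing the resolvent equation with \<open>u\<close> and with \<open>G u\<close> shows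
  that \<open>a (G u) u - a (G u) (G u)\<close> is the squared L2 norm of \<open>u - G u\<close>,
  hence nonnegative.\<close>

lemma G_contraction:
  assumes "u \<in> D"
  shows "a.nb (G u) \<le> a.nb u"
proof -
  note u = D_L2[OF assms] and w = G_in[OF D_L2[OF assms]]
  have "form_alpha m a 1 (G u) (G u) = (\<integral>x. u x * G u x \<partial>m)" using G_eq[OF u w] .
  then have "a (G u) (G u) = (\<integral>x. u x * G u x \<partial>m) - (\<integral>x. G u x * G u x \<partial>m)" by (simp add: e_eq)
  moreover have "a (G u) u = (\<integral>x. u x * u x \<partial>m) - (\<integral>x. u x * G u x \<partial>m)"
    using G_eq[OF u assms] by (simp add: e_eq mult.commute)
  moreover have "0 \<le> (\<integral>x. u x * u x \<partial>m) - 2 * (\<integral>x. u x * G u x \<partial>m) + (\<integral>x. G u x * G u x \<partial>m)"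
    using L.b_quad_diff[OF u D_L2[OF w]] L.b_nonneg[OF L.diff_in[OF u D_L2[OF w]]] by simp
  ultimately have "a (G u) (G u) \<le> a (G u) u" by simp
  moreover have "0 \<le> a (G u) (G u) - 2 * a (G u) u + a u u"
    using a.b_quad_diff[OF w assms] nonneg[OF a.diff_in[OF w assms]] by simp
  ultimately show ?thesis by (simp add: a.nb_def)
qed

end

section \<open>Transience\<close>

locale transient_form = dform m a D
  for m :: "'a::metric_space measure" and a :: "'a form" and D :: "('a \<Rightarrow> real) set" +
  fixes g :: "'a \<Rightarrow> real"
  assumes g_integrable: "integrable m g"
    and g_bounded: "bounded (range g)"
    and g_pos: "AE x in m. 0 < g x"
    and g_le: "\<And>u. u \<in> D \<Longrightarrow> (\<integral>x. \<bar>u x\<bar> * g x \<partial>m) \<le> a.nb u"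
begin

section \<open>Weighted L1 norms controlled by the energy, and a dense core\<close>

lemma g_measurable [measurable]: "g \<in> borel_measurable borel"
  using borel_measurable_integrable[OF g_integrable] measurable_cong_sets[OF sets_m refl] by blast

lemma g_nonneg: "AE x in m. 0 \<le> g x"
  using g_pos by eventually_elim simp

lemma g_L2: "g \<in> L2 m"
proof -
  obtain B where B: "\<And>x. \<bar>g x\<bar> \<le> B" using g_bounded unfolding bounded_iff by auto
  have "integrable m (\<lambda>x. (g x)\<^sup>2)"
  proof (rule Bochner_Integration.integrable_bound)
    show "integrable m (\<lambda>x. B * g x)" using g_integrable by simp
    have "(g x)\<^sup>2 \<le> \<bar>B * g x\<bar>" for x
      using mult_right_mono[OF B[of x], of "\<bar>g x\<bar>"] B[of x] by (simp add: power2_eq_square abs_mult flip: abs_mult)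
    then show "AE x in m. norm ((g x)\<^sup>2) \<le> norm (B * g x)" by simp
  qed simp
  then show ?thesis by (simp add: L2_def)
qed

text \<open>Functions bounded by a multiple of \<open>p\<close> are dense (see \<open>core_dense\<close>), so nests can be detected
  by the single function \<open>p\<close> instead of capacities.\<close>

definition p :: "'a \<Rightarrow> real" where "p x = max (G g x) 0"

lemma p_in: "p \<in> D"
  unfolding p_def[abs_def] by (rule pos_in[OF G_in[OF g_L2]])

lemma p_nonneg: "0 \<le> p x"
  by (simp add: p_def)

lemma p_AE: "AE x in m. p x = G g x"
  using G_nonneg[OF g_L2 g_nonneg] by eventually_elim (simp add: p_def)

lemma p_bounded: "\<exists>B\<ge>0. AE x in m. p x \<le> B"
proof -
  obtain B where B: "\<And>x. \<bar>g x\<bar> \<le> B" using g_bounded unfolding bounded_iff by auto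
  have "AE x in m. G g x \<le> max B 1"
  proof (rule resolvent_le[OF G_in[OF g_L2] g_L2 g_nonneg])
    have "g x \<le> max B 1" for x using B[of x] by linarith
    then show "AE x in m. g x \<le> max B 1" by simp
  qed (auto simp: G_eq[OF g_L2])
  then show ?thesis using p_AE by (intro exI[of _ "max B 1"]) auto
qed

text \<open>By symmetry of the resolvent, integrating \<open>\<bar>u\<bar>\<close> against
  \<open>G g\<close> is integrating \<open>G \<bar>u\<bar>\<close> against \<open>g\<close>.
  Transience applies to the latter, and \<open>G\<close> does not increase the energy.\<close>

lemma p_le:
  assumes "u \<in> D"
  shows "(\<integral>x. \<bar>u x\<bar> * p x \<partial>m) \<le> 2 * a.nb u"
proof -
  define v where "v x = \<bar>u x\<bar>" for x
  have v: "v \<in> D" unfolding v_def by (rule abs_in[OF assms])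
  note Gv = G_in[OF D_L2[OF v]] and Gg = G_in[OF g_L2]
  have "(\<integral>x. \<bar>u x\<bar> * p x \<partial>m) = (\<integral>x. v x * G g x \<partial>m)"
  proof (rule integral_cong_AE)
    have [measurable]: "u \<in> borel_measurable borel" "p \<in> borel_measurable borel"
      "v \<in> borel_measurable borel" "G g \<in> borel_measurable borel"
      using assms p_in v Gg by measurable
    show "(\<lambda>x. \<bar>u x\<bar> * p x) \<in> borel_measurable m" "(\<lambda>x. v x * G g x) \<in> borel_measurable m"
      by measurable
    show "AE x in m. \<bar>u x\<bar> * p x = v x * G g x"
      using p_AE by eventually_elim (simp add: v_def)
  qed
  also have "\<dots> = (\<integral>x. g x * G v x \<partial>m)"
    using G_eq[OF D_L2[OF v] Gg] G_eq[OF g_L2 Gv] e.b_sym[OF Gv Gg] by simp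
  also have "\<dots> \<le> (\<integral>x. \<bar>G v x\<bar> * g x \<partial>m)"
  proof (rule integral_mono_AE)
    show "AE x in m. g x * G v x \<le> \<bar>G v x\<bar> * g x" using g_pos by eventually_elim (simp add: mult.commute)
  qed (intro L2_mult_integrable g_L2 D_L2 Gv abs_in)+
  also have "\<dots> \<le> a.nb (G v)" by (rule g_le[OF Gv])
  also have "\<dots> \<le> a.nb v" by (rule G_contraction[OF v])
  also have "\<dots> \<le> 2 * a.nb u" unfolding v_def by (rule abs_le[OF assms])
  finally show ?thesis .
qed

text \<open>Both summands occur in \<open>a (G \<phi>) u\<close>, which is the integral of
  \<open>(\<phi> - G \<phi>) u\<close>: if \<open>\<bar>\<phi>\<bar> \<le> g\<close>, then
  \<open>\<bar>G \<phi>\<bar> \<le> p\<close>.\<close>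

definition \<rho> :: "'a \<Rightarrow> real" where "\<rho> x = g x + p x"

lemma rho_measurable [measurable]: "\<rho> \<in> borel_measurable borel"
  unfolding \<rho>_def using p_in by measurable

lemma rho_pos: "AE x in m. 0 < \<rho> x"
  using g_pos by eventually_elim (simp add: \<rho>_def p_nonneg add_pos_nonneg)

lemma rho_integrable: "u \<in> L2 m \<Longrightarrow> integrable m (\<lambda>x. \<bar>u x\<bar> * \<rho> x)"
  using L.add_in[OF g_L2 D_L2[OF p_in]] 
  by (intro L2_mult_integrable) (auto simp: \<rho>_def[abs_def] L2_def)

lemma rho_le:
  assumes "u \<in> D"
  shows "(\<integral>x. \<bar>u x\<bar> * \<rho> x \<partial>m) \<le> 3 * a.nb u"
proof -
  have "(\<integral>x. \<bar>u x\<bar> * \<rho> x \<partial>m) = (\<integral>x. \<bar>u x\<bar> * g x \<partial>m) + (\<integral>x. \<bar>u x\<bar> * p x \<partial>m)"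
    using L.b_add_right[OF g_L2 D_L2[OF p_in] D_L2[OF abs_in[OF assms]]] by (simp add: \<rho>_def[abs_def])
  then show ?thesis using g_le[OF assms] p_le[OF assms] by simp
qed

lemma rho_int_nonneg: "0 \<le> (\<integral>x. \<bar>u x\<bar> * \<rho> x \<partial>m)"
  by (rule integral_nonneg_AE) (use rho_pos in eventually_elim, simp)

text \<open>Integrability is part of the notion, since the Bochner integral of a nonintegrable
  function is 0 and elements of the extended space need not lie in L2.\<close>

definition close :: "('a \<Rightarrow> real) \<Rightarrow> ('a \<Rightarrow> real) \<Rightarrow> real \<Rightarrow> bool" where
  "close u v \<epsilon> \<longleftrightarrow> integrable m (\<lambda>x. \<bar>u x - v x\<bar> * \<rho> x) \<and> (\<integral>x. \<bar>u x - v x\<bar> * \<rho> x \<partial>m) \<le> \<epsilon>"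

lemma close_commute: "close u v \<epsilon> \<longleftrightarrow> close v u \<epsilon>"
  by (simp add: close_def abs_minus_commute)

lemma close_mono: "close u v \<epsilon> \<Longrightarrow> \<epsilon> \<le> \<delta> \<Longrightarrow> close u v \<delta>"
  by (auto simp: close_def)

lemma close_dominated:
  assumes [measurable]: "u \<in> borel_measurable borel" "v \<in> borel_measurable borel"
    and le: "AE x in m. \<bar>u x - v x\<bar> * \<rho> x \<le> h x" and h: "integrable m h" "integral\<^sup>L m h \<le> \<epsilon>"
  shows "close u v \<epsilon>"
proof -
  have int: "integrable m (\<lambda>x. \<bar>u x - v x\<bar> * \<rho> x)"
  proof (rule Bochner_Integration.integrable_bound[OF h(1)])
    show "AE x in m. norm (\<bar>u x - v x\<bar> * \<rho> x) \<le> norm (h x)"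
      using le rho_pos by eventually_elim (auto simp: abs_mult)
  qed measurable
  then show ?thesis using integral_mono_AE[OF int h(1) le] h(2) by (simp add: close_def)
qed

lemma close_contraction:
  assumes "u' \<in> borel_measurable borel" "v' \<in> borel_measurable borel" "close u v \<epsilon>"
    and le: "AE x in m. \<bar>u' x - v' x\<bar> \<le> \<bar>u x - v x\<bar>"
  shows "close u' v' \<epsilon>"
proof (rule close_dominated[OF assms(1,2)])
  show "AE x in m. \<bar>u' x - v' x\<bar> * \<rho> x \<le> \<bar>u x - v x\<bar> * \<rho> x"
    using le rho_pos by eventually_elim (simp add: mult_right_mono)
qed (use assms(3) in \<open>auto simp: close_def\<close>)

lemma close_lincomb:
  assumes "u \<in> borel_measurable borel" "v \<in> borel_measurable borel" "0 \<le> s" "0 \<le> t"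
    and c: "close u1 v1 \<epsilon>" "close u2 v2 \<delta>"
    and le: "\<And>x. \<bar>u x - v x\<bar> \<le> s * \<bar>u1 x - v1 x\<bar> + t * \<bar>u2 x - v2 x\<bar>"
  shows "close u v (s * \<epsilon> + t * \<delta>)"
proof (rule close_dominated[OF assms(1,2)])
  show "AE x in m. \<bar>u x - v x\<bar> * \<rho> x \<le> s * (\<bar>u1 x - v1 x\<bar> * \<rho> x) + t * (\<bar>u2 x - v2 x\<bar> * \<rho> x)"
    using rho_pos
  proof eventually_elim
    case (elim x)
    show ?case using mult_right_mono[OF le[of x], of "\<rho> x"] elim by (simp add: algebra_simps)
  qed
  show "integrable m (\<lambda>x. s * (\<bar>u1 x - v1 x\<bar> * \<rho> x) + t * (\<bar>u2 x - v2 x\<bar> * \<rho> x))"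
    "(\<integral>x. s * (\<bar>u1 x - v1 x\<bar> * \<rho> x) + t * (\<bar>u2 x - v2 x\<bar> * \<rho> x) \<partial>m) \<le> s * \<epsilon> + t * \<delta>"
    using c assms(3,4) by (auto simp: close_def intro!: add_mono mult_left_mono)
qed

lemma close_triangle:
  assumes "u \<in> borel_measurable borel" "w \<in> borel_measurable borel" "close u v \<epsilon>" "close v w \<delta>"
  shows "close u w (\<epsilon> + \<delta>)"
  using close_lincomb[OF assms(1,2) _ _ assms(3,4), of 1 1] by simp

lemma close_mid:
  assumes "u \<in> borel_measurable borel" "v \<in> borel_measurable borel" "z \<in> borel_measurable borel"
    "close u z \<epsilon>" "close v z \<epsilon>"
  shows "close (\<lambda>x. (u x + v x) / 2) z \<epsilon>"
proof -
  have "\<bar>(u x + v x) / 2 - z x\<bar> \<le> 1/2 * \<bar>u x - z x\<bar> + 1/2 * \<bar>v x - z x\<bar>" for x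
    by (simp add: abs_if field_simps)
  then have "close (\<lambda>x. (u x + v x) / 2) z (1/2 * \<epsilon> + 1/2 * \<epsilon>)"
    using assms by (intro close_lincomb[OF _ _ _ _ assms(4,5)]) auto
  then show ?thesis by simp
qed

lemma close_D: "u \<in> D \<Longrightarrow> v \<in> D \<Longrightarrow> close u v (3 * a.nb (\<lambda>x. u x - v x))"
  using rho_integrable[OF D_L2[OF a.diff_in]] rho_le[OF a.diff_in] by (simp add: close_def)

lemma close_eq_AE:
  assumes "\<And>\<epsilon>. 0 < \<epsilon> \<Longrightarrow> close u v \<epsilon>"
  shows "AE x in m. u x = v x"
proof -
  have "(\<integral>x. \<bar>u x - v x\<bar> * \<rho> x \<partial>m) \<le> 0"
    by (rule field_le_epsilon) (use assms in \<open>simp add: close_def\<close>)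
  then have "(\<integral>x. \<bar>u x - v x\<bar> * \<rho> x \<partial>m) = 0" using rho_int_nonneg[of "\<lambda>x. u x - v x"] by simp
  moreover have "AE x in m. 0 \<le> \<bar>u x - v x\<bar> * \<rho> x" using rho_pos by eventually_elim simp
  ultimately have "AE x in m. \<bar>u x - v x\<bar> * \<rho> x = 0"
    using integral_nonneg_eq_0_iff_AE[of m "\<lambda>x. \<bar>u x - v x\<bar> * \<rho> x"] assms[of 1] by (simp add: close_def)
  then show ?thesis using rho_pos by eventually_elim simp
qed

text \<open>Fatou's lemma in \<open>j\<close> with \<open>i\<close> fixed. No membership of
  \<open>z\<close> in \<open>D\<close> or L2 enters, so this applies to elements of the extended
  space.\<close>

lemma Cauchy_close_limit:
  assumes u: "\<And>n. u n \<in> D" "form_Cauchy a u"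
    and z [measurable]: "z \<in> borel_measurable borel" and lim: "AE x in m. (\<lambda>n. u n x) \<longlonglongrightarrow> z x" and "0 < \<epsilon>"
  shows "\<exists>N. \<forall>i\<ge>N. close (u i) z \<epsilon>"
proof -
  obtain N where N: "\<And>i j. i \<ge> N \<Longrightarrow> j \<ge> N \<Longrightarrow> a.nb (\<lambda>x. u i x - u j x) < \<epsilon> / 3"
    using u(2) \<open>0 < \<epsilon>\<close> unfolding a.form_Cauchy_iff by (meson zero_less_divide_iff zero_less_numeral)
  have [measurable]: "u n \<in> borel_measurable borel" for n using u(1) by measurable
  have "close (u i) z \<epsilon>" if "i \<ge> N" for i
    unfolding close_def
  proof (rule integral_Fatou[where f = "\<lambda>j x. \<bar>u i x - u j x\<bar> * \<rho> x"])
    show "AE x in m. (\<lambda>j. \<bar>u i x - u j x\<bar> * \<rho> x) \<longlonglongrightarrow> \<bar>u i x - z x\<bar> * \<rho> x"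
      using lim by eventually_elim (intro tendsto_intros)
    show "integrable m (\<lambda>x. \<bar>u i x - u j x\<bar> * \<rho> x)" for j
      using close_D[OF u(1) u(1)] by (simp add: close_def)
    show "(\<integral>x. \<bar>u i x - u j x\<bar> * \<rho> x \<partial>m) \<le> \<epsilon>" if "N \<le> j" for j
      using close_D[OF u(1) u(1), of i j] N[OF \<open>i \<ge> N\<close> that] by (simp add: close_def)
    show "AE x in m. 0 \<le> \<bar>u i x - u j x\<bar> * \<rho> x" for j using rho_pos by eventually_elim simp
  qed measurable
  then show ?thesis by blast
qed

text \<open>The first bound lets functions be cut off by means of \<open>p\<close> alone; the second
  makes \<open>a v\<close> continuous for the weighted L1 norm. Resolvents of functions dominated by
  \<open>g\<close> satisfy both.\<close>

definition core :: "('a \<Rightarrow> real) set" where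
  "core = {v \<in> D. \<exists>C\<ge>0. (AE x in m. \<bar>v x\<bar> \<le> C * p x) \<and> (\<forall>u\<in>D. \<bar>a v u\<bar> \<le> C * (\<integral>x. \<bar>u x\<bar> * \<rho> x \<partial>m))}"

lemma core_D: "core \<subseteq> D"
  by (auto simp: core_def)

lemma core_add:
  assumes "u \<in> core" "v \<in> core"
  shows "(\<lambda>x. u x + v x) \<in> core"
proof -
  obtain C C' where C: "C \<ge> 0" "AE x in m. \<bar>u x\<bar> \<le> C * p x" "\<And>w. w \<in> D \<Longrightarrow> \<bar>a u w\<bar> \<le> C * (\<integral>x. \<bar>w x\<bar> * \<rho> x \<partial>m)"
    and C': "C' \<ge> 0" "AE x in m. \<bar>v x\<bar> \<le> C' * p x" "\<And>w. w \<in> D \<Longrightarrow> \<bar>a v w\<bar> \<le> C' * (\<integral>x. \<bar>w x\<bar> * \<rho> x \<partial>m)"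
    using assms by (auto simp: core_def)
  have D: "u \<in> D" "v \<in> D" using assms core_D by auto
  show ?thesis unfolding core_def
  proof (intro CollectI conjI exI[of _ "C + C'"] ballI a.add_in D)
    show "AE x in m. \<bar>u x + v x\<bar> \<le> (C + C') * p x"
      using C(2) C'(2) by eventually_elim (simp add: distrib_right)
    show "\<bar>a (\<lambda>x. u x + v x) w\<bar> \<le> (C + C') * (\<integral>x. \<bar>w x\<bar> * \<rho> x \<partial>m)" if "w \<in> D" for w
      using C(3)[OF that] C'(3)[OF that] a.b_add[OF D that] by (simp add: distrib_right)
  qed (use C C' in auto)
qed

lemma core_scale:
  assumes "u \<in> core"
  shows "(\<lambda>x. c * u x) \<in> core"
proof -
  obtain C where C: "C \<ge> 0" "AE x in m. \<bar>u x\<bar> \<le> C * p x" "\<And>w. w \<in> D \<Longrightarrow> \<bar>a u w\<bar> \<le> C * (\<integral>x. \<bar>w x\<bar> * \<rho> x \<partial>m)"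
    using assms by (auto simp: core_def)
  have D: "u \<in> D" using assms core_D by auto
  show ?thesis unfolding core_def
  proof (intro CollectI conjI exI[of _ "\<bar>c\<bar> * C"] ballI a.scale_in D)
    show "AE x in m. \<bar>c * u x\<bar> \<le> \<bar>c\<bar> * C * p x"
      using C(2) by eventually_elim (simp add: abs_mult mult_left_mono mult.assoc)
    show "\<bar>a (\<lambda>x. c * u x) w\<bar> \<le> \<bar>c\<bar> * C * (\<integral>x. \<bar>w x\<bar> * \<rho> x \<partial>m)" if "w \<in> D" for w
      using C(3)[OF that] a.b_scale[OF D that] by (simp add: abs_mult mult_left_mono mult.assoc)
  qed (use C in auto)
qed

text \<open>Comparing \<open>\<phi>\<close> and \<open>- \<phi>\<close> with \<open>g\<close> bounds
  \<open>G \<phi>\<close> by \<open>p\<close>; the second core bound is then read off the resolvent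
  equation.\<close>

lemma G_core:
  assumes "\<phi> \<in> borel_measurable borel" "AE x in m. \<bar>\<phi> x\<bar> \<le> g x"
  shows "\<phi> \<in> L2 m" "G \<phi> \<in> core"
proof -
  have "\<phi> \<in> borel_measurable m" using assms(1) measurable_cong_sets[OF sets_m refl] by blast
  then show \<phi>: "\<phi> \<in> L2 m"
    using assms(2) by (intro L2_bound[OF g_L2]) (auto elim!: eventually_mono)
  note G\<phi> = G_in[OF \<phi>]
  have neg: "AE x in m. - G \<phi> x \<le> G g x"
  proof -
    have "AE x in m. 0 \<le> G g x + G \<phi> x"
    proof (rule resolvent_nonneg[of _ "\<lambda>x. g x + \<phi> x"])
      show "AE x in m. 0 \<le> g x + \<phi> x" using assms(2) by eventually_elim auto
      show "form_alpha m a 1 (\<lambda>x. G g x + G \<phi> x) v = (\<integral>x. (g x + \<phi> x) * v x \<partial>m)" if "v \<in> D" for v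
        using that G_eq[OF \<phi> that] G_eq[OF g_L2 that] e.b_add[OF G_in[OF g_L2] G\<phi> that]
          L.b_add[OF g_L2 \<phi> D_L2[OF that]] by simp
    qed (use a.add_in L.add_in \<phi> G\<phi> g_L2 G_in in auto)
    then show ?thesis by eventually_elim auto
  qed
  have pos: "AE x in m. G \<phi> x \<le> G g x"
    by (rule G_mono[OF \<phi> g_L2]) (use assms(2) in eventually_elim, auto)
  have bd: "AE x in m. \<bar>G \<phi> x\<bar> \<le> 1 * p x"
    using neg pos p_AE by eventually_elim auto
  show "G \<phi> \<in> core" unfolding core_def
  proof (intro CollectI conjI exI[of _ 1] ballI bd G\<phi>)
    fix u assume u: "u \<in> D"
    have au: "a (G \<phi>) u = (\<integral>x. \<phi> x * u x - G \<phi> x * u x \<partial>m)"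
      using G_eq[OF \<phi> u] L2_mult_integrable[OF \<phi> D_L2[OF u]] L2_mult_integrable[OF D_L2[OF G\<phi>] D_L2[OF u]]
      by (simp add: e_eq)
    have "\<bar>a (G \<phi>) u\<bar> \<le> (\<integral>x. \<bar>u x\<bar> * \<rho> x \<partial>m)"
      unfolding au
    proof (rule integral_abs_bound[THEN order_trans], rule integral_mono_AE)
      show "AE x in m. \<bar>\<phi> x * u x - G \<phi> x * u x\<bar> \<le> \<bar>u x\<bar> * \<rho> x"
        using assms(2) bd
      proof eventually_elim
        case (elim x)
        have "\<bar>\<phi> x * u x - G \<phi> x * u x\<bar> = \<bar>u x\<bar> * \<bar>\<phi> x - G \<phi> x\<bar>" by (simp add: abs_mult[symmetric] algebra_simps)
        also have "\<dots> \<le> \<bar>u x\<bar> * \<rho> x" using elim by (intro mult_left_mono) (auto simp: \<rho>_def)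
        finally show ?case .
      qed
    qed (intro integrable_abs Bochner_Integration.integrable_diff L2_mult_integrable \<phi>(1) D_L2 u G\<phi> rho_integrable)+
    then show "\<bar>a (G \<phi>) u\<bar> \<le> 1 * (\<integral>x. \<bar>u x\<bar> * \<rho> x \<partial>m)" by simp
  qed simp
qed

text \<open>For \<open>y\<close> orthogonal to the core, take \<open>\<phi>\<close> to be
  \<open>y\<close> clipped to the range between \<open>- g\<close> and \<open>g\<close>. Then
  \<open>\<phi> y\<close> is nonnegative and has integral 0, so \<open>y\<close> vanishes because
  \<open>g\<close> is positive.\<close>

lemma core_dense:
  assumes "u \<in> D" "0 < \<epsilon>"
  shows "\<exists>v\<in>core. e.nb (\<lambda>x. u x - v x) < \<epsilon>"
proof (rule e.dense_if_orthogonal_trivial[OF e_complete core_D])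
  show "(\<lambda>x. 0) \<in> core" using core_scale[OF G_core(2)[of "\<lambda>x. 0"], of 0] g_nonneg by simp
  fix y assume y: "y \<in> D" and orth: "\<And>v. v \<in> core \<Longrightarrow> form_alpha m a 1 y v = 0"
  have [measurable]: "y \<in> borel_measurable borel" using y by measurable
  define \<phi> where "\<phi> x = max (- g x) (min (y x) (g x))" for x
  have \<phi>m: "\<phi> \<in> borel_measurable borel" unfolding \<phi>_def by measurable
  have \<phi>g: "AE x in m. \<bar>\<phi> x\<bar> \<le> g x" using g_pos by eventually_elim (auto simp: \<phi>_def)
  note \<phi> = G_core[OF \<phi>m \<phi>g]
  have "(\<integral>x. \<phi> x * y x \<partial>m) = 0"
    using orth[OF \<phi>(2)] G_eq[OF \<phi>(1) y] e.b_sym[OF y G_in[OF \<phi>(1)]] by simp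
  moreover have "AE x in m. 0 \<le> \<phi> x * y x"
    using g_pos
  proof eventually_elim
    case (elim x)
    then show ?case by (cases "0 \<le> y x") (auto simp: \<phi>_def min_def max_def intro!: mult_nonneg_nonneg mult_nonpos_nonpos mult_nonneg_nonpos)
  qed
  ultimately have "AE x in m. \<phi> x * y x = 0"
    using integral_nonneg_eq_0_iff_AE[OF L2_mult_integrable[OF \<phi>(1) D_L2[OF y]]] by simp
  then have "AE x in m. y x = 0"
    using g_pos by eventually_elim (auto simp: \<phi>_def min_def max_def split: if_splits)
  then have "e.nb y = e.nb (\<lambda>x. 0)" by (intro e_nb_cong y a.zero_in)
  then show "form_alpha m a 1 y y = 0" using e.nb_sq[OF y] e.nb_zero by simp
qed (use assms core_add core_scale in auto)

text \<open>This makes \<^const>\<open>extended_energy\<close> well defined.\<close>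

lemma closable:
  assumes u: "\<And>n. u n \<in> D" "form_Cauchy a u" "AE x in m. (\<lambda>n. u n x) \<longlonglongrightarrow> 0"
  shows "(\<lambda>n. a.nb (u n)) \<longlonglongrightarrow> 0"
proof -
  \<comment> \<open>Almost everywhere convergence of an energy-Cauchy sequence is also convergence
    in the weighted L1 norm, for which \<open>a v\<close> is continuous.\<close>
  have core0: "(\<lambda>n. a v (u n)) \<longlonglongrightarrow> 0" if "v \<in> core" for v
  proof -
    obtain C where C: "C \<ge> 0" "\<And>w. w \<in> D \<Longrightarrow> \<bar>a v w\<bar> \<le> C * (\<integral>x. \<bar>w x\<bar> * \<rho> x \<partial>m)"
      using \<open>v \<in> core\<close> by (auto simp: core_def)
    have "(\<lambda>n. \<integral>x. \<bar>u n x\<bar> * \<rho> x \<partial>m) \<longlonglongrightarrow> 0"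
    proof (rule LIMSEQ_I)
      fix r :: real assume "0 < r"
      then obtain N where "\<forall>i\<ge>N. (\<integral>x. \<bar>u i x - 0\<bar> * \<rho> x \<partial>m) \<le> r / 2"
        using Cauchy_close_limit[OF u(1,2) _ u(3), of "r/2"] by (auto simp: close_def)
      then show "\<exists>N. \<forall>n\<ge>N. norm ((\<integral>x. \<bar>u n x\<bar> * \<rho> x \<partial>m) - 0) < r"
        using \<open>0 < r\<close> rho_int_nonneg by (intro exI[of _ N]) (auto intro: le_less_trans)
    qed
    then have "(\<lambda>n. C * (\<integral>x. \<bar>u n x\<bar> * \<rho> x \<partial>m)) \<longlonglongrightarrow> 0" by (rule tendsto_mult_right_zero)
    then show ?thesis by (rule Lim_null_comparison[rotated]) (use C(2) u(1) in auto)
  qed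
  show ?thesis
  proof (rule LIMSEQ_I)
    fix r :: real assume "0 < r"
    obtain N where N: "\<And>i j. i \<ge> N \<Longrightarrow> j \<ge> N \<Longrightarrow> a.nb (\<lambda>x. u i x - u j x) < r / 4"
      using u(2) \<open>0 < r\<close> unfolding a.form_Cauchy_iff by (meson zero_less_divide_iff zero_less_numeral)
    obtain v where v: "v \<in> core" "e.nb (\<lambda>x. u N x - v x) < r / 4"
      using core_dense[OF u(1), of "r/4" N] \<open>0 < r\<close> by auto
    have vD: "v \<in> D" using v core_D by auto
    have "\<forall>\<^sub>F n in sequentially. \<bar>a v (u n)\<bar> < r\<^sup>2 / 4"
      using tendsto_rabs[OF core0[OF v(1)]] \<open>0 < r\<close> by (intro order_tendstoD(2)) auto
    then obtain N' where N': "\<And>n. n \<ge> N' \<Longrightarrow> \<bar>a v (u n)\<bar> < r\<^sup>2 / 4" by (auto simp: eventually_sequentially)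
    have "a.nb (u n) < r" if "n \<ge> max N N'" for n
    proof (rule ccontr)
      assume "\<not> a.nb (u n) < r"
      then have ge: "r \<le> a.nb (u n)" by simp
      have "a.nb (\<lambda>x. u n x - v x) \<le> a.nb (\<lambda>x. u n x - u N x) + a.nb (\<lambda>x. u N x - v x)"
        by (rule a.nb_triangle3[OF u(1) u(1) vD])
      also have "\<dots> \<le> r / 4 + r / 4"
        using N[of n N] that v(2) a_le_e[OF a.diff_in[OF u(1) vD], of N] by simp
      finally have nv: "a.nb (\<lambda>x. u n x - v x) \<le> r / 2" by simp
      \<comment> \<open>Since \<open>r\<close> is assumed to be at most \<open>a.nb (u n)\<close>,
        splitting off \<open>v\<close> bounds the square of \<open>a.nb (u n)\<close> by three
        quarters of itself.\<close>
      have "(a.nb (u n))\<^sup>2 = a (\<lambda>x. u n x - v x) (u n) + a v (u n)"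
        using a.nb_sq[OF u(1)] a.b_diff[OF u(1) vD u(1)] by simp
      also have "\<dots> \<le> a.nb (\<lambda>x. u n x - v x) * a.nb (u n) + r\<^sup>2 / 4"
        using a.cauchy_schwarz[OF a.diff_in[OF u(1) vD] u(1), of n n] N'[of n] that by simp
      also have "\<dots> \<le> r / 2 * a.nb (u n) + r\<^sup>2 / 4"
        using mult_right_mono[OF nv a.nb_nonneg[OF u(1)]] by simp
      also have "\<dots> \<le> a.nb (u n) * a.nb (u n) / 2 + (a.nb (u n))\<^sup>2 / 4"
        using mult_right_mono[OF ge a.nb_nonneg[OF u(1)], of n] power_mono[OF ge, of 2] \<open>0 < r\<close> by simp
      finally have "(a.nb (u n))\<^sup>2 \<le> 0" by (simp add: power2_eq_square)
      then show False using ge \<open>0 < r\<close> by simp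
    qed
    then show "\<exists>N. \<forall>n\<ge>N. norm (a.nb (u n) - 0) < r"
      using a.nb_nonneg[OF u(1)] by (intro exI[of _ "max N N'"]) auto
  qed
qed

end

section \<open>Nests and quasi-continuity\<close>

text \<open>A Borel-Cantelli argument: by monotone convergence the supremum over \<open>N\<close>
  inherits the integral bound, so the series of these suprema is finite almost everywhere and its
  terms tend to 0.\<close>

lemma AE_uniformly_small:
  fixes f :: "nat \<Rightarrow> nat \<Rightarrow> 'a \<Rightarrow> real"
  assumes [measurable]: "\<And>k N. f k N \<in> borel_measurable M"
    and mono: "\<And>k N x. f k N x \<le> f k (Suc N) x"
    and int: "\<And>k N. (\<integral>\<^sup>+x. ennreal (f k N x) \<partial>M) \<le> ennreal (B * (1/2)^k)" and "0 \<le> B"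
  shows "AE x in M. \<forall>\<epsilon>>0. \<exists>K. \<forall>k\<ge>K. \<forall>N. f k N x \<le> \<epsilon>"
proof -
  define W where "W k x = (SUP N. ennreal (f k N x))" for k x
  have [measurable]: "W k \<in> borel_measurable M" for k unfolding W_def by measurable
  have W: "(\<integral>\<^sup>+x. W k x \<partial>M) \<le> ennreal (B * (1/2)^k)" for k
  proof -
    have "incseq (\<lambda>N x. ennreal (f k N x))"
      using mono by (intro incseq_SucI le_funI ennreal_leI)
    then have "(\<integral>\<^sup>+x. W k x \<partial>M) = (SUP N. \<integral>\<^sup>+x. ennreal (f k N x) \<partial>M)"
      unfolding W_def by (intro nn_integral_monotone_convergence_SUP) measurable
    then show ?thesis using int by (simp add: SUP_least)
  qed
  have "(\<integral>\<^sup>+x. (\<Sum>k. W k x) \<partial>M) = (\<Sum>k. \<integral>\<^sup>+x. W k x \<partial>M)"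
    by (rule nn_integral_suminf) measurable
  also have "\<dots> \<le> (\<Sum>k. ennreal (B * (1/2)^k))"
    by (intro suminf_le W) auto
  also have "\<dots> < \<infinity>"
  proof -
    have "summable (\<lambda>k. B * (1/2::real)^k)" by (intro summable_mult summable_geometric) simp
    then show ?thesis using \<open>0 \<le> B\<close> by (subst suminf_ennreal2) auto
  qed
  finally have "AE x in M. (\<Sum>k. W k x) \<noteq> \<infinity>"
    by (intro nn_integral_noteq_infinite) auto
  then show ?thesis
  proof eventually_elim
    case (elim x)
    then have "W k x \<noteq> \<infinity>" for k
      using ennreal_suminf_lessD[of "\<lambda>k. W k x" \<infinity> k] by (auto simp: less_top)
    then have eq: "W k x = ennreal (enn2real (W k x))" for k
      by (simp add: less_top)
    have "summable (\<lambda>k. enn2real (W k x))"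
      using elim eq by (intro summable_suminf_not_top) auto
    then have "(\<lambda>k. enn2real (W k x)) \<longlonglongrightarrow> 0" by (rule summable_LIMSEQ_zero)
    show ?case
    proof (intro allI impI)
      fix \<epsilon> :: real assume "0 < \<epsilon>"
      then have "\<forall>\<^sub>F k in sequentially. enn2real (W k x) < \<epsilon>"
        using \<open>(\<lambda>k. enn2real (W k x)) \<longlonglongrightarrow> 0\<close> by (intro order_tendstoD(2))
      then obtain K where K: "\<And>k. k \<ge> K \<Longrightarrow> enn2real (W k x) < \<epsilon>" by (auto simp: eventually_sequentially)
      have "f k N x \<le> \<epsilon>" if "k \<ge> K" for k N
      proof -
        have "ennreal (f k N x) \<le> W k x" unfolding W_def by (rule SUP_upper) simp
        also have "\<dots> \<le> ennreal \<epsilon>" using K[OF that] by (subst eq) (intro ennreal_leI, simp)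
        finally show ?thesis using \<open>0 < \<epsilon>\<close> by (simp add: ennreal_le_iff)
      qed
      then show "\<exists>K. \<forall>k\<ge>K. \<forall>N. f k N x \<le> \<epsilon>" by blast
    qed
  qed
qed

text \<open>Energy limits and pointwise limits agree, because both are limits in the weighted L1
  norm.\<close>

lemma (in transient_form) a_limit_AE:
  assumes v: "\<And>n. v n \<in> D" and u: "u \<in> D" "(\<lambda>n. a.nb (\<lambda>x. v n x - u x)) \<longlonglongrightarrow> 0"
    and z: "z \<in> borel_measurable borel" "AE x in m. (\<lambda>n. v n x) \<longlonglongrightarrow> z x"
  shows "AE x in m. z x = u x"
proof (rule close_eq_AE)
  fix \<epsilon> :: real assume "0 < \<epsilon>"
  obtain N where N: "\<And>i. i \<ge> N \<Longrightarrow> close (v i) z (\<epsilon> / 2)"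
    using Cauchy_close_limit[OF v a.Cauchy_if_tendsto[OF v u] z, of "\<epsilon> / 2"] \<open>0 < \<epsilon>\<close> by auto
  obtain N' where N': "\<And>i. i \<ge> N' \<Longrightarrow> \<bar>a.nb (\<lambda>x. v i x - u x)\<bar> < \<epsilon> / 6"
    using LIMSEQ_D[OF u(2), of "\<epsilon> / 6"] \<open>0 < \<epsilon>\<close> by auto
  define i where "i = max N N'"
  have "close (v i) u (\<epsilon> / 2)"
    using N'[of i] by (intro close_mono[OF close_D[OF v u(1)]]) (auto simp: i_def)
  then have "close z u (\<epsilon> / 2 + \<epsilon> / 2)"
    using N[of i] z(1) u(1) by (intro close_triangle[of _ _ "v i"]) (auto simp: i_def close_commute)
  then show "close z u \<epsilon>" by simp
qed

text \<open>\<open>lindelof\<close> is the topological content of the Lusin assumption. It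
  guarantees that \<open>m\<close> restricted to a closed set has a support carrying all its
  mass.\<close>

locale quasi_regular_form = transient_form m a D g
  for m :: "'a::metric_space measure" and a :: "'a form" and D :: "('a \<Rightarrow> real) set" and g +
  assumes dense_qc: "\<exists>A. form_dense m a D A \<and> (\<forall>u\<in>A. \<exists>u'. qc_version m a D u u')"
    and lindelof: "\<And>\<U> :: 'a set set. (\<And>U. U \<in> \<U> \<Longrightarrow> open U) \<Longrightarrow> \<exists>\<V>\<subseteq>\<U>. countable \<V> \<and> \<Union>\<V> = \<Union>\<U>"
begin

abbreviation "is_nest \<equiv> nest m a D"
abbreviation "exc \<equiv> exceptional m a D"
abbreviation "qc \<equiv> quasi_continuous m a D"

definition supported :: "(nat \<Rightarrow> 'a set) \<Rightarrow> ('a \<Rightarrow> real) set" where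
  "supported F = {v \<in> D. \<exists>k. AE x in m. x \<notin> F k \<longrightarrow> v x = 0}"

lemma nest_iff:
  "is_nest F \<longleftrightarrow> incseq F \<and> (\<forall>k. closed (F k)) \<and>
     (\<forall>u\<in>D. \<forall>\<epsilon>>0. \<exists>v\<in>supported F. e.nb (\<lambda>x. u x - v x) < \<epsilon>)"
proof -
  have "(\<Union>k. {u \<in> D. AE x in m. x \<notin> F k \<longrightarrow> u x = 0}) = supported F"
    by (auto simp: supported_def)
  moreover have "supported F \<subseteq> D" by (auto simp: supported_def)
  ultimately show ?thesis by (simp add: nest_def form_dense_def e.nb_def)
qed

lemma nest_incseq: "is_nest F \<Longrightarrow> incseq F" and nest_closed: "is_nest F \<Longrightarrow> closed (F k)"
  by (auto simp: nest_iff)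

lemma supported_D: "supported F \<subseteq> D"
  by (auto simp: supported_def)

lemma supported_lincomb:
  assumes "incseq F" "u \<in> supported F" "v \<in> supported F"
  shows "(\<lambda>x. s * u x + t * v x) \<in> supported F"
proof -
  obtain k l where k: "AE x in m. x \<notin> F k \<longrightarrow> u x = 0" and l: "AE x in m. x \<notin> F l \<longrightarrow> v x = 0"
    using assms(2,3) by (auto simp: supported_def)
  have sub: "F k \<subseteq> F (max k l)" "F l \<subseteq> F (max k l)" using incseqD[OF assms(1)] by simp_all
  have "AE x in m. x \<notin> F (max k l) \<longrightarrow> s * u x + t * v x = 0"
    using k l by eventually_elim (use sub in auto)
  then show ?thesis using assms(2,3) a.lincomb_in by (auto simp: supported_def)
qed

text \<open>The approximants of \<open>h\<close> are \<open>(h - C sup\<^sub>N w k N)\<^sup>+\<close>. The supremum itself need not lie in the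
  domain, hence the sequences in \<open>N\<close>.\<close>

lemma nest_criterion:
  assumes F: "incseq F" "\<And>k. closed (F k)"
    and w: "\<And>k N. w k N \<in> D" "\<And>k N x. 0 \<le> w k N x" "\<And>k N x. w k N x \<le> w k (Suc N) x"
      "\<And>k N. a.nb (w k N) \<le> B * (1/2)^k"
    and off: "\<And>k. AE x in m. x \<notin> F k \<longrightarrow> (\<exists>N. p x \<le> c * w k N x)" and "0 \<le> c"
  shows "is_nest F"
proof -
  have B: "0 \<le> B" using a.nb_nonneg[OF w(1)[of 0 0]] w(4)[of 0 0] by simp
  have wm [measurable]: "w k N \<in> borel_measurable borel" for k N using w(1) by measurable
  \<comment> \<open>Where \<open>p \<le> c * w k N\<close>, the bound \<open>h \<le> C * p\<close>
    makes the positive part of \<open>h - C * c * w k N\<close> vanish, so the limit in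
    \<open>N\<close> is supported by \<open>F k\<close>.\<close>
  have pos: "\<exists>v\<in>supported F. e.nb (\<lambda>x. h x - v x) < \<epsilon>"
    if h: "h \<in> D" "\<And>x. 0 \<le> h x" "AE x in m. h x \<le> C * p x" "0 \<le> C" and "0 < \<epsilon>" for h C \<epsilon>
  proof -
    have hm [measurable]: "h \<in> borel_measurable borel" using h(1) by measurable
    define z' where "z' k N x = max (h x - C * c * w k N x) 0" for k N x
    define z where "z k x = lim (\<lambda>N. z' k N x)" for k x
    have z'm [measurable]: "z' k N \<in> borel_measurable borel" for k N unfolding z'_def by measurable
    have zm [measurable]: "z k \<in> borel_measurable borel" for k unfolding z_def by measurable
    have Cc: "0 \<le> C * c" using h(4) \<open>0 \<le> c\<close> by simp
    have z'h: "0 \<le> z' k N x" "z' k N x \<le> h x" for k N x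
      using h(2)[of x] mult_nonneg_nonneg[OF Cc w(2)[of k N x]] by (auto simp: z'_def)
    have lim: "(\<lambda>N. z' k N x) \<longlonglongrightarrow> z k x" for k x
    proof -
      have "decseq (\<lambda>N. z' k N x)"
        using mult_left_mono[OF w(3)[of k _ x] Cc] unfolding z'_def
        by (intro decseq_SucI max.mono[OF _ order_refl] diff_left_mono)
      then show ?thesis using decseq_convergent[of "\<lambda>N. z' k N x" 0] z'h(1) unfolding z_def
        by (metis limI)
    qed
    have z_h: "0 \<le> z k x" "z k x \<le> h x" for k x
      using LIMSEQ_le_const[OF lim, of 0 k x] LIMSEQ_le_const2[OF lim, of k x "h x"] z'h by auto
    define M where "M = a.nb h + C * c * B"
    have z'D: "z' k N \<in> D" "a.nb (z' k N) \<le> M" for k N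
    proof -
      have s: "(\<lambda>x. C * c * w k N x) \<in> D" and d: "(\<lambda>x. h x - C * c * w k N x) \<in> D"
        using h(1) w(1) by (auto intro!: a.scale_in a.diff_in)
      have "(1/2)^k \<le> (1::real)" by (simp add: power_le_one)
      then have "a.nb (w k N) \<le> B" using w(4)[of k N] B by (meson mult_left_le order_trans)
      then have "a.nb (\<lambda>x. C * c * w k N x) \<le> C * c * B"
        using a.nb_scale[OF w(1), of "C * c"] Cc by (simp add: mult_left_mono)
      then show "z' k N \<in> D" "a.nb (z' k N) \<le> M"
        using pos_in[OF d] pos_le[OF d] a.nb_diff[OF h(1) s] by (auto simp: z'_def[abs_def] M_def)
    qed
    have zD: "z k \<in> D \<and> a.nb (z k) \<le> M \<and> (\<forall>\<epsilon>>0. \<exists>v\<in>D. e.nb (\<lambda>x. z k x - v x) < \<epsilon>)" for k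
      using z'h lim z'D h(1) by (intro D_limit[where v = "z' k" and h = h]) (auto simp: D_L2)
    have z_supp: "z k \<in> supported F" for k
    proof -
      have "AE x in m. x \<notin> F k \<longrightarrow> z k x = 0"
        using off[of k] h(3)
      proof eventually_elim
        case (elim x)
        show ?case
        proof
          assume "x \<notin> F k"
          then obtain N where "p x \<le> c * w k N x" using elim by blast
          then have "h x \<le> C * c * w k N x" using elim(2) mult_left_mono[OF _ h(4), of "p x" "c * w k N x"] by (simp add: mult.assoc)
          then have z0: "z' k N x = 0" by (simp add: z'_def)
          have "z k x \<le> z' k N x"
          proof (rule LIMSEQ_le_const2[OF lim], intro exI allI impI)
            fix n assume "N \<le> n"
            have "incseq (\<lambda>N. w k N x)" using w(3) by (rule incseq_SucI)
            then have "w k N x \<le> w k n x" using \<open>N \<le> n\<close> by (rule incseqD)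
            then show "z' k n x \<le> z' k N x" using mult_left_mono[OF _ Cc, of "w k N x" "w k n x"] by (auto simp: z'_def)
          qed
          then show "z k x = 0" using z0 z_h(1)[of k x] by simp
        qed
      qed
      then show ?thesis using zD by (auto simp: supported_def)
    qed
    \<comment> \<open>The energy bound becomes a bound of order 2^(-k) in the weighted L1 norm,
      uniformly in \<open>N\<close>. Hence the subtracted terms tend to 0 almost everywhere,
      uniformly in \<open>N\<close>.\<close>
    have "AE x in m. \<forall>\<epsilon>>0. \<exists>K. \<forall>k\<ge>K. \<forall>N. max 0 (w k N x * \<rho> x) \<le> \<epsilon>"
    proof (rule AE_uniformly_small[where B = "3 * B"])
      show "max 0 (w k N x * \<rho> x) \<le> max 0 (w k (Suc N) x * \<rho> x)" for k N x
      proof (cases "0 \<le> \<rho> x")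
        case True then show ?thesis using w(3)[of k N x] by (intro max.mono mult_right_mono) auto
      next
        case False
        then have "w k N x * \<rho> x \<le> 0" "w k (Suc N) x * \<rho> x \<le> 0"
          using w(2) by (auto intro!: mult_nonneg_nonpos)
        then show ?thesis by simp
      qed
      show "(\<integral>\<^sup>+x. ennreal (max 0 (w k N x * \<rho> x)) \<partial>m) \<le> ennreal (3 * B * (1/2)^k)" for k N
      proof -
        have "(\<integral>\<^sup>+x. ennreal (max 0 (w k N x * \<rho> x)) \<partial>m) = (\<integral>\<^sup>+x. ennreal (\<bar>w k N x\<bar> * \<rho> x) \<partial>m)"
          using rho_pos w(2) by (intro nn_integral_cong_AE) (auto elim!: eventually_mono)
        also have "\<dots> = ennreal (\<integral>x. \<bar>w k N x\<bar> * \<rho> x \<partial>m)"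
          by (rule nn_integral_eq_integral[OF rho_integrable[OF D_L2[OF w(1)]]])
            (use rho_pos in eventually_elim, simp)
        also have "\<dots> \<le> ennreal (3 * B * (1/2)^k)"
          using rho_le[OF w(1)[of k N]] w(4)[of k N] by (intro ennreal_leI) simp
        finally show ?thesis .
      qed
    qed (use B in simp_all)
    then have zlim: "AE x in m. (\<lambda>k. z k x) \<longlonglongrightarrow> h x"
      using rho_pos
    proof eventually_elim
      case (elim x)
      show ?case
      proof (rule LIMSEQ_I)
        fix r :: real assume "0 < r"
        \<comment> \<open>The summand 1 keeps the denominator positive when
          \<open>C * c = 0\<close>.\<close>
        define \<delta> where "\<delta> = r * \<rho> x / (2 * (C * c + 1))"
        have "0 < \<delta>" using \<open>0 < r\<close> elim(2) Cc by (simp add: \<delta>_def)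
        then obtain K where K: "\<And>k N. k \<ge> K \<Longrightarrow> max 0 (w k N x * \<rho> x) \<le> \<delta>" using elim(1) by blast
        have "norm (z k x - h x) < r" if "k \<ge> K" for k
        proof -
          have "h x - z' k N x \<le> r / 2" for N
          proof -
            have "w k N x \<le> r / (2 * (C * c + 1))"
            proof -
              have "w k N x * \<rho> x \<le> (r / (2 * (C * c + 1))) * \<rho> x"
                using K[OF that, of N] by (simp add: \<delta>_def)
              then show ?thesis using elim(2) by (simp only: mult_le_cancel_right_pos)
            qed
            then have "(C * c + 1) * w k N x \<le> r / 2" using Cc by (simp add: field_simps)
            then have "C * c * w k N x \<le> r / 2" using w(2)[of k N x] by (simp add: distrib_right)
            then show ?thesis using h(2)[of x] \<open>0 < r\<close> unfolding z'_def by linarith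
          qed
          then have "h x - r / 2 \<le> z' k N x" for N using \<open>\<And>N. h x - z' k N x \<le> r / 2\<close>[of N] by linarith
          then have "h x - r / 2 \<le> z k x" by (intro LIMSEQ_le_const[OF lim]) auto
          then show ?thesis using z_h(2)[of k x] \<open>0 < r\<close> by simp
        qed
        then show "\<exists>K. \<forall>k\<ge>K. norm (z k x - h x) < r" by blast
      qed
    qed
    \<comment> \<open>The \<open>z k\<close> converge only almost everywhere, with bounded energy.
      Approximation in energy within \<open>supported F\<close> follows by convexity, as
      \<open>F\<close> is increasing.\<close>
    have "h \<in> D \<and> a.nb h \<le> M \<and> (\<forall>\<epsilon>>0. \<exists>v\<in>supported F. e.nb (\<lambda>x. h x - v x) < \<epsilon>)"
    proof (rule weak_closure_seq[where v = z and h = h])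
      show "(\<lambda>x. (u x + v x) / 2) \<in> supported F" if "u \<in> supported F" "v \<in> supported F" for u v
        using supported_lincomb[OF F(1) that, of "1/2" "1/2"] by (simp add: field_simps)
    qed (use z_supp zD z_h zlim h D_L2 supported_D in auto)
    then show ?thesis using \<open>0 < \<epsilon>\<close> by blast
  qed
  show ?thesis unfolding nest_iff
  proof (intro conjI F allI ballI impI)
    fix u and \<epsilon> :: real assume u: "u \<in> D" and "0 < \<epsilon>"
    then obtain v where v: "v \<in> core" "e.nb (\<lambda>x. u x - v x) < \<epsilon> / 3" using core_dense[of u "\<epsilon>/3"] by auto
    then have vD: "v \<in> D" using core_D by blast
    obtain C where C: "0 \<le> C" "AE x in m. \<bar>v x\<bar> \<le> C * p x" using v(1) by (auto simp: core_def)
    have C1: "AE x in m. max (v x) 0 \<le> C * p x" and C2: "AE x in m. max (- v x) 0 \<le> C * p x"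
      using C(2) by (auto elim!: eventually_mono)
    obtain v1 where v1: "v1 \<in> supported F" "e.nb (\<lambda>x. max (v x) 0 - v1 x) < \<epsilon> / 3"
      using pos[OF pos_in[OF vD] _ C1 C(1), of "\<epsilon>/3"] \<open>0 < \<epsilon>\<close> by auto
    obtain v2 where v2: "v2 \<in> supported F" "e.nb (\<lambda>x. max (- v x) 0 - v2 x) < \<epsilon> / 3"
      using pos[OF pos_in[OF a.minus_in[OF vD]] _ C2 C(1), of "\<epsilon>/3"] \<open>0 < \<epsilon>\<close> by auto
    have D12: "v1 \<in> D" "v2 \<in> D" using v1 v2 supported_D by auto
    have d1: "(\<lambda>x. max (v x) 0 - v1 x) \<in> D" and d2: "(\<lambda>x. max (- v x) 0 - v2 x) \<in> D"
      using D12 pos_in[OF vD] pos_in[OF a.minus_in[OF vD]] by (auto intro!: a.diff_in)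
    have "(\<lambda>x. v x - (v1 x - v2 x)) = (\<lambda>x. (max (v x) 0 - v1 x) - (max (- v x) 0 - v2 x))"
      by (auto simp: fun_eq_iff)
    then have "e.nb (\<lambda>x. v x - (v1 x - v2 x)) < 2 * \<epsilon> / 3"
      using e.nb_diff[OF d1 d2] v1(2) v2(2) by simp
    then have "e.nb (\<lambda>x. u x - (v1 x - v2 x)) < \<epsilon>"
      using e.nb_triangle3[OF u vD a.diff_in[OF D12]] v(2) by simp
    moreover have "(\<lambda>x. v1 x - v2 x) \<in> supported F"
      using supported_lincomb[OF F(1) v1(1) v2(1), of 1 "-1"] by simp
    ultimately show "\<exists>v\<in>supported F. e.nb (\<lambda>x. u x - v x) < \<epsilon>" by (intro bexI[where x="\<lambda>x. v1 x - v2 x"])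
  qed
qed

text \<open>Let \<open>h\<close> be \<open>g\<close> off the union of the nest and 0 on it.
  Functions supported by some \<open>F k\<close> stay at L2 distance at least \<open>L.nb h\<close>
  from \<open>g\<close>, yet they are dense, so \<open>h\<close> vanishes.\<close>

lemma nest_AE:
  assumes "is_nest F"
  shows "AE x in m. \<exists>k. x \<in> F k"
proof -
  have [measurable]: "F k \<in> sets borel" for k using nest_closed[OF assms] by (rule borel_closed)
  define h where "h x = (if \<exists>k. x \<in> F k then 0 else g x)" for x
  have hm: "h \<in> borel_measurable m" unfolding h_def by measurable
  have hL: "h \<in> L2 m" by (rule L2_bound[OF g_L2 hm]) (simp add: h_def)
  have "L.nb h \<le> \<epsilon>" if "0 < \<epsilon>" for \<epsilon>
  proof -
    obtain u where u: "u \<in> D" "sqrt (\<integral>x. (g x - u x)\<^sup>2 \<partial>m) < \<epsilon> / 2"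
      using dense g_L2 half_gt_zero[OF \<open>0 < \<epsilon>\<close>] unfolding dense_in_L2_def by blast
    obtain v where v: "v \<in> supported F" "e.nb (\<lambda>x. u x - v x) < \<epsilon> / 2"
      using assms u(1) half_gt_zero[OF \<open>0 < \<epsilon>\<close>] unfolding nest_iff by blast
    have vD: "v \<in> D" using v supported_D by auto
    have "L.nb (\<lambda>x. g x - v x) \<le> L.nb (\<lambda>x. g x - u x) + L.nb (\<lambda>x. u x - v x)"
      by (intro L.nb_triangle3 g_L2 D_L2 u vD)
    also have "\<dots> < \<epsilon>"
      using u(2) v(2) L_le_e[OF a.diff_in[OF u(1) vD]] by (simp add: L.nb_def power2_eq_square)
    finally have *: "L.nb (\<lambda>x. g x - v x) < \<epsilon>" .
    obtain k where k: "AE x in m. x \<notin> F k \<longrightarrow> v x = 0" using v(1) by (auto simp: supported_def)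
    have "(\<integral>x. h x * h x \<partial>m) \<le> (\<integral>x. (g x - v x) * (g x - v x) \<partial>m)"
    proof (rule integral_mono_AE)
      show "AE x in m. h x * h x \<le> (g x - v x) * (g x - v x)"
        using k by eventually_elim (auto simp: h_def)
    qed (intro L2_mult_integrable L.diff_in hL g_L2 D_L2 vD)+
    then have "L.nb h \<le> L.nb (\<lambda>x. g x - v x)" by (simp add: L.nb_def)
    then show ?thesis using * by simp
  qed
  then have "L.nb h \<le> 0" by (rule field_le_epsilon) simp
  then have "L.nb h = 0" using L.nb_nonneg[OF hL] by simp
  then have "AE x in m. h x = 0" by (rule L_nb_zero[OF hL])
  then show ?thesis using g_pos by eventually_elim (auto simp: h_def split: if_splits)
qed

text \<open>Off \<open>F k\<close> the function \<open>\<bar>p - v\<bar>\<close> equals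
  \<open>p\<close>, so \<open>p\<close> is dominated there by an element of small energy. This plays
  the role of a small capacity of the complement and is the converse of
  \<open>nest_criterion\<close>.\<close>

lemma nest_cutoff:
  assumes "is_nest F" "0 < \<epsilon>"
  shows "\<exists>k v. v \<in> D \<and> (AE x in m. x \<notin> F k \<longrightarrow> v x = 0) \<and> a.nb (\<lambda>x. \<bar>p x - v x\<bar>) \<le> \<epsilon>"
proof -
  obtain v where v: "v \<in> supported F" "e.nb (\<lambda>x. p x - v x) < \<epsilon> / 2"
    using assms(1) p_in half_gt_zero[OF assms(2)] unfolding nest_iff by blast
  have vD: "v \<in> D" using v supported_D by auto
  have "a.nb (\<lambda>x. \<bar>p x - v x\<bar>) \<le> \<epsilon>"
    using abs_le[OF a.diff_in[OF p_in vD]] a_le_e[OF a.diff_in[OF p_in vD]] v(2) by simp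
  then show ?thesis using v(1) by (auto simp: supported_def)
qed

lemma sum_half_le: "(\<Sum>n\<le>N. (1/2::real)^n) \<le> 2"
  for N :: nat
proof -
  have "(\<Sum>n<Suc N. (1/2::real)^n) \<le> (\<Sum>n. (1/2)^n)"
    by (rule sum_le_suminf) (auto intro: summable_geometric)
  then show ?thesis by (simp add: suminf_geometric lessThan_Suc_atMost)
qed

text \<open>Cutoffs of energy norm 2^(-n-k) are summed over \<open>n\<close>: at a point missed by
  any of the countably many sets the sum dominates \<open>p\<close>, and its energy norm is at most
  2 * 2^(-k).\<close>

lemma nest_countable:
  assumes F: "\<And>n::nat. is_nest (F n)"
  shows "\<exists>G. is_nest G \<and> (\<forall>n k. \<exists>j. G k \<subseteq> F n j)"
proof -
  have "\<exists>j v. v \<in> D \<and> (AE x in m. x \<notin> F n j \<longrightarrow> v x = 0) \<and> a.nb (\<lambda>x. \<bar>p x - v x\<bar>) \<le> (1/2)^n * (1/2)^k" for n k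
    by (rule nest_cutoff[OF F]) simp
  then have "\<forall>n k. \<exists>j v. v \<in> D \<and> (AE x in m. x \<notin> F n j \<longrightarrow> v x = 0) \<and> a.nb (\<lambda>x. \<bar>p x - v x\<bar>) \<le> (1/2)^n * (1/2)^k"
    by blast
  from this[unfolded choice_iff] obtain j v where v: "\<And>n k. v n k \<in> D" "\<And>n k. AE x in m. x \<notin> F n (j n k) \<longrightarrow> v n k x = 0"
     "\<And>n k. a.nb (\<lambda>x. \<bar>p x - v n k x\<bar>) \<le> (1/2)^n * (1/2)^k" by blast
  \<comment> \<open>Partial sums are increasing in \<open>k\<close> and still at least
    \<open>j n k\<close>.\<close>
  define J where "J n k = (\<Sum>i\<le>k. j n i)" for n k
  have jJ: "j n k \<le> J n k" for n k unfolding J_def by (rule member_le_sum) auto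
  define G where "G k = (\<Inter>n. F n (J n k))" for k
  have dD: "(\<lambda>x. \<bar>p x - v n k x\<bar>) \<in> D" for n k by (intro abs_in a.diff_in p_in v)
  have "is_nest G"
  proof (rule nest_criterion[where w = "\<lambda>k N x. \<Sum>n\<le>N. \<bar>p x - v n k x\<bar>" and B = 2 and c = 1])
    show "incseq G"
    proof (rule incseq_SucI)
      have "F n (J n k) \<subseteq> F n (J n (Suc k))" for n k
        using nest_incseq[OF F] by (rule incseqD) (simp add: J_def)
      then show "G k \<subseteq> G (Suc k)" for k unfolding G_def by blast
    qed
    show "closed (G k)" for k unfolding G_def using nest_closed[OF F] by (intro closed_INT) auto
    show "(\<lambda>x. \<Sum>n\<le>N. \<bar>p x - v n k x\<bar>) \<in> D" for k N by (rule a.sum_in[OF dD])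
    show "a.nb (\<lambda>x. \<Sum>n\<le>N. \<bar>p x - v n k x\<bar>) \<le> 2 * (1/2)^k" for k N
    proof -
      have "a.nb (\<lambda>x. \<Sum>n\<le>N. \<bar>p x - v n k x\<bar>) \<le> (\<Sum>n\<le>N. (1/2)^n * (1/2)^k)"
        using a.nb_sum[of "{..N}", OF dD] sum_mono[of "{..N}", OF v(3)] by (rule order_trans)
      also have "\<dots> \<le> 2 * (1/2)^k"
        unfolding sum_distrib_right[symmetric] by (rule mult_right_mono[OF sum_half_le]) simp
      finally show ?thesis .
    qed
    show "AE x in m. x \<notin> G k \<longrightarrow> (\<exists>N. p x \<le> 1 * (\<Sum>n\<le>N. \<bar>p x - v n k x\<bar>))" for k
    proof -
      have "AE x in m. \<forall>n. x \<notin> F n (j n k) \<longrightarrow> v n k x = 0" using v(2) by (simp add: AE_all_countable)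
      then show ?thesis
      proof eventually_elim
        case (elim x)
        show ?case
        proof
          assume "x \<notin> G k"
          then obtain n where "x \<notin> F n (J n k)" by (auto simp: G_def)
          moreover have "F n (j n k) \<subseteq> F n (J n k)" using nest_incseq[OF F] jJ by (rule incseqD)
          ultimately have "v n k x = 0" using elim by blast
          then have "p x = \<bar>p x - v n k x\<bar>" by (simp add: p_nonneg)
          also have "\<dots> \<le> (\<Sum>n\<le>n. \<bar>p x - v n k x\<bar>)" by (rule member_le_sum) auto
          finally show "\<exists>N. p x \<le> 1 * (\<Sum>n\<le>N. \<bar>p x - v n k x\<bar>)" by auto
        qed
      qed
    qed
  qed (auto intro: sum_nonneg)
  moreover have "G k \<subseteq> F n (J n k)" for n k unfolding G_def by blast
  ultimately show ?thesis by blast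
qed

section \<open>Exceptional sets, quasi-continuous functions and quasi-everywhere convergence\<close>

lemma exc_subset: "exc N \<Longrightarrow> M \<subseteq> N \<Longrightarrow> exc M"
  unfolding exceptional_def by blast

lemma exc_UN:
  assumes "\<And>n::nat. exc (N n)"
  shows "exc (\<Union>n. N n)"
proof -
  obtain F where F: "\<And>n. is_nest (F n)" "\<And>n. N n \<subseteq> (\<Inter>k. - F n k)"
    using assms unfolding exceptional_def by metis
  obtain G where G: "is_nest G" "\<And>n k. \<exists>j. G k \<subseteq> F n j" using nest_countable[of F] F(1) by blast
  have "(\<Union>n. N n) \<subseteq> (\<Inter>k. - G k)"
  proof clarsimp
    fix x n k assume "x \<in> N n" "x \<in> G k"
    then show False using F(2)[of n] G(2)[of k n] by blast
  qed
  then show ?thesis using G(1) unfolding exceptional_def by blast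
qed

lemma exc_Un: "exc M \<Longrightarrow> exc N \<Longrightarrow> exc (M \<union> N)"
  using exc_UN[of "\<lambda>n. if n = 0 then M else N"] by (rule exc_subset) (auto split: if_splits)

lemma exc_AE:
  assumes "exc N"
  shows "AE x in m. x \<notin> N"
proof -
  obtain F where F: "is_nest F" "N \<subseteq> (\<Inter>k. - F k)"
    using assms unfolding exceptional_def by blast
  show ?thesis using nest_AE[OF F(1)] by eventually_elim (use F(2) in auto)
qed

lemma qc_common_nest:
  assumes "\<And>n::nat. qc (f n)"
  shows "\<exists>F. is_nest F \<and> (\<forall>n k. continuous_on (F k) (f n))"
proof -
  obtain F where F: "\<And>n. is_nest (F n)" "\<And>n k. continuous_on (F n k) (f n)"
    using assms unfolding quasi_continuous_def by metis
  obtain G where "is_nest G" "\<And>n k. \<exists>j. G k \<subseteq> F n j" using nest_countable[of F] F(1) by blast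
  then show ?thesis using F(2) continuous_on_subset by meson
qed

lemma qc_compose2:
  assumes "qc f" "qc h" and cont: "\<And>(A :: 'a set) u v. continuous_on A u \<Longrightarrow> continuous_on A v \<Longrightarrow> continuous_on A (\<lambda>x. H (u x) (v x))"
  shows "qc (\<lambda>x. H (f x) (h x))"
proof -
  have "qc (if n = 0 then f else h)" for n :: nat using assms(1,2) by simp
  then obtain F where F: "is_nest F" "\<And>(n::nat) k. continuous_on (F k) (if n = 0 then f else h)"
    using qc_common_nest[of "\<lambda>n::nat. if n = 0 then f else h"] by blast
  have "continuous_on (F k) (\<lambda>x. H (f x) (h x))" for k
    by (rule cont) (use F(2)[of k 0] F(2)[of k 1] in simp_all)
  then show ?thesis using F(1) unfolding quasi_continuous_def by (intro exI[of _ F]) simp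
qed

lemma qc_lincomb: "qc f \<Longrightarrow> qc h \<Longrightarrow> qc (\<lambda>x. s * f x + t * h x)"
  by (rule qc_compose2) (auto intro!: continuous_intros)

lemma qc_diff: "qc f \<Longrightarrow> qc h \<Longrightarrow> qc (\<lambda>x. f x - h x)"
  using qc_lincomb[of f h 1 "-1"] by simp

lemma qc_scale: "qc f \<Longrightarrow> qc (\<lambda>x. s * f x)"
  using qc_lincomb[of f f s 0] by simp

lemma qc_clip: "qc f \<Longrightarrow> qc (\<lambda>x. max c (min (f x) d))"
  by (rule qc_compose2[where H = "\<lambda>x y. max c (min x d)" and h = f]) (auto intro!: continuous_intros)

lemma qc_trunc: "qc f \<Longrightarrow> qc (\<lambda>x. min (max (f x) c) d)"
  by (rule qc_compose2[where H = "\<lambda>x y. min (max x c) d" and h = f]) (auto intro!: continuous_intros)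

lemma qc_min: "qc f \<Longrightarrow> qc (\<lambda>x. min (f x) d)"
  by (rule qc_compose2[where H = "\<lambda>x y. min x d" and h = f]) (auto intro!: continuous_intros)

text \<open>Off the union of the nest the value is reset to 0, which makes the function a pointwise
  limit of the Borel functions \<open>f\<close> restricted to \<open>F k\<close>. Quasi-continuity
  alone says nothing about measurability on the exceptional set.\<close>

lemma qc_borel_version:
  assumes "qc f"
  shows "\<exists>f'\<in>borel_measurable borel. qc f' \<and> exc {x. f' x \<noteq> f x}"
proof -
  obtain F where F: "is_nest F" "\<And>k. continuous_on (F k) f"
    using assms unfolding quasi_continuous_def by blast
  have Fb: "F k \<in> sets borel" for k using nest_closed[OF F(1)] by (rule borel_closed)
  define f' where "f' x = (if \<exists>k. x \<in> F k then f x else 0)" for x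
  have "f' \<in> borel_measurable borel"
  proof (rule borel_measurable_LIMSEQ_real)
    show "(\<lambda>x. indicator (F k) x *\<^sub>R f x) \<in> borel_measurable borel" for k
      by (rule borel_measurable_continuous_on_indicator[OF Fb F(2)])
    fix x :: 'a
    show "(\<lambda>k. indicator (F k) x *\<^sub>R f x) \<longlonglongrightarrow> f' x"
    proof (cases "\<exists>k. x \<in> F k")
      case True
      then obtain k where "x \<in> F k" by blast
      then have "x \<in> F j" if "j \<ge> k" for j using incseqD[OF nest_incseq[OF F(1)] that] by blast
      then have "\<forall>\<^sub>F j in sequentially. indicator (F j) x *\<^sub>R f x = f' x"
        unfolding eventually_sequentially f'_def by (intro exI[of _ k]) auto
      then show ?thesis by (rule tendsto_eventually)
    qed (auto simp: f'_def)
  qed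
  moreover have "qc f'"
  proof -
    have "continuous_on (F k) f'" for k
      using F(2)[of k] by (rule continuous_on_eq) (auto simp: f'_def)
    then show ?thesis using F(1) unfolding quasi_continuous_def by blast
  qed
  moreover have "exc {x. f' x \<noteq> f x}"
    unfolding exceptional_def using F(1) by (intro exI[of _ F]) (auto simp: f'_def)
  ultimately show ?thesis by blast
qed

text \<open>Replacing each \<open>F k\<close> by the support of \<open>m\<close> restricted to it yields a nest on which a continuous
  function vanishes as soon as it vanishes almost everywhere.\<close>

lemma qc_zero:
  assumes "qc f" "AE x in m. f x = 0"
  shows "exc {x. f x \<noteq> 0}"
proof -
  obtain F where F: "is_nest F" "\<And>k. continuous_on (F k) f"
    using assms unfolding quasi_continuous_def by blast
  have Fb [measurable]: "F k \<in> sets borel" for k using nest_closed[OF F(1)] by (rule borel_closed)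
  define \<U> where "\<U> k = {U. open U \<and> U \<inter> F k \<in> null_sets m}" for k
  define K where "K k = F k - \<Union>(\<U> k)" for k
  \<comment> \<open>The union may be uncountable; the Lindelof property replaces it by a countable
    one.\<close>
  have null: "F k \<inter> \<Union>(\<U> k) \<in> null_sets m" for k
  proof -
    obtain \<V> where V: "\<V> \<subseteq> \<U> k" "countable \<V>" "\<Union>\<V> = \<Union>(\<U> k)"
      using lindelof[of "\<U> k"] by (auto simp: \<U>_def)
    have "(\<Union>U\<in>\<V>. U \<inter> F k) \<in> null_sets m"
      using V(1,2) by (intro null_sets_UN') (auto simp: \<U>_def)
    moreover have "(\<Union>U\<in>\<V>. U \<inter> F k) = F k \<inter> \<Union>(\<U> k)" using V(3) by blast
    ultimately show ?thesis by simp
  qed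
  have F_mono: "F k \<subseteq> F (Suc k)" for k using nest_incseq[OF F(1)] by (simp add: incseq_Suc_iff)
  have "is_nest K"
    unfolding nest_iff
  proof (intro conjI allI ballI impI)
    show "incseq K"
    proof (rule incseq_SucI)
      fix k
      have "\<U> (Suc k) \<subseteq> \<U> k"
      proof
        fix U assume U: "U \<in> \<U> (Suc k)"
        then have "U \<inter> F k \<in> sets m" by (auto simp: \<U>_def sets_m)
        moreover have "U \<inter> F k \<subseteq> U \<inter> F (Suc k)" using F_mono by blast
        ultimately show "U \<in> \<U> k" using U null_sets_subset unfolding \<U>_def by blast
      qed
      then show "K k \<subseteq> K (Suc k)" using F_mono unfolding K_def by blast
    qed
    show "closed (K k)" for k unfolding K_def
      using nest_closed[OF F(1)] by (intro closed_Diff open_Union) (auto simp: \<U>_def)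
    have "supported F \<subseteq> supported K"
    proof
      fix v assume "v \<in> supported F"
      then obtain k where k: "v \<in> D" "AE x in m. x \<notin> F k \<longrightarrow> v x = 0" by (auto simp: supported_def)
      have "AE x in m. x \<notin> F k \<inter> \<Union>(\<U> k)" by (rule AE_not_in[OF null])
      then have "AE x in m. x \<notin> K k \<longrightarrow> v x = 0" using k(2) by eventually_elim (auto simp: K_def)
      then show "v \<in> supported K" using k(1) by (auto simp: supported_def)
    qed
    then show "\<exists>v\<in>supported K. e.nb (\<lambda>x. u x - v x) < \<epsilon>" if "u \<in> D" "0 < \<epsilon>" for u \<epsilon>
      using F(1) that unfolding nest_iff by blast
  qed
  moreover have "f x = 0" if "x \<in> K k" for x k
  proof (rule ccontr)
    assume "f x \<noteq> 0"
    \<comment> \<open>The part of \<open>F k\<close> where \<open>f\<close> is nonzero is relatively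
      open and null, so it was removed in \<open>K k\<close>.\<close>
    have "open (- {0::real})" by (rule open_Compl) simp
    then obtain U where U: "open U" "U \<inter> F k = f -` (- {0}) \<inter> F k"
      using F(2)[of k] unfolding continuous_on_open_invariant by blast
    have "AE x in m. x \<notin> U \<inter> F k"
      using assms(2) by eventually_elim (use U(2) in auto)
    moreover have "U \<inter> F k \<in> sets m" using U(1) by (simp add: sets_m)
    ultimately have "U \<inter> F k \<in> null_sets m" by (simp add: AE_iff_null_sets)
    then have "U \<in> \<U> k" using U(1) by (simp add: \<U>_def)
    moreover have "x \<in> U" using U(2) that \<open>f x \<noteq> 0\<close> by (auto simp: K_def)
    ultimately show False using that by (auto simp: K_def)
  qed
  ultimately show ?thesis unfolding exceptional_def by (intro exI[of _ K]) auto
qed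

lemma qc_unique:
  assumes "qc f" "qc h" "AE x in m. f x = h x"
  shows "exc {x. f x \<noteq> h x}"
  using qc_zero[OF qc_diff[OF assms(1,2)]] assms(3) by simp

text \<open>The rate (1/4)^n leaves summable energy norms after the increments are multiplied by 2^n
  in \<open>qe_limit\<close>.\<close>

lemma Cauchy_subsequence:
  assumes "form_Cauchy a v"
  shows "\<exists>r::nat \<Rightarrow> nat. strict_mono r \<and> (\<forall>n. a.nb (\<lambda>x. v (r (Suc n)) x - v (r n) x) \<le> (1/4)^n)"
proof -
  have "\<forall>n. \<exists>N. \<forall>i\<ge>N. \<forall>j\<ge>N. a.nb (\<lambda>x. v i x - v j x) < (1/4)^n"
    using assms unfolding a.form_Cauchy_iff by simp
  then obtain N where N: "\<And>n i j. i \<ge> N n \<Longrightarrow> j \<ge> N n \<Longrightarrow> a.nb (\<lambda>x. v i x - v j x) < (1/4)^n" by metis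
  define r where "r n = (\<Sum>i\<le>n. N i) + n" for n
  have "strict_mono r" by (rule strict_mono_Suc_iff[THEN iffD2]) (simp add: r_def)
  moreover have "N n \<le> r n" for n using member_le_sum[of n "{..n}" N] by (simp add: r_def)
  moreover have "r n \<le> r (Suc n)" for n by (simp add: r_def)
  ultimately show ?thesis using N by (meson less_imp_le order_trans)
qed

text \<open>Along a fast subsequence the increments are at most 2^(-n) outside sets of small size.
  The usual estimate of these sets by capacity is replaced by \<open>nest_criterion\<close>: where
  \<open>h n = 2^n \<bar>\<delta> n\<bar>\<close> exceeds 1, a multiple of it dominates the bounded
  function \<open>p\<close>.\<close>

lemma qe_limit:
  assumes v: "\<And>n. v n \<in> D" "\<And>n. qc (v n)" "form_Cauchy a v"
  shows "\<exists>r v'. strict_mono (r::nat \<Rightarrow> nat) \<and> v' \<in> borel_measurable borel \<and> qc v' \<and>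
     exc {x. \<not> (\<lambda>n. v (r n) x) \<longlonglongrightarrow> v' x}"
proof -
  obtain r where r: "strict_mono r" "\<And>n. a.nb (\<lambda>x. v (r (Suc n)) x - v (r n) x) \<le> (1/4)^n"
    using Cauchy_subsequence[OF v(3)] by blast
  define \<delta> where "\<delta> n x = v (r (Suc n)) x - v (r n) x" for n x
  have \<delta>D: "\<delta> n \<in> D" for n unfolding \<delta>_def by (intro a.diff_in v)
  define h where "h n x = 2^n * \<bar>\<delta> n x\<bar>" for n x
  have hD: "h n \<in> D" for n unfolding h_def by (intro a.scale_in abs_in \<delta>D)
  have h_le: "a.nb (h n) \<le> 2 * (1/2)^n" for n
  proof -
    have "a.nb (h n) = 2^n * a.nb (\<lambda>x. \<bar>\<delta> n x\<bar>)"
      unfolding h_def using a.nb_scale[OF abs_in[OF \<delta>D], of "2^n" n] by simp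
    also have "\<dots> \<le> 2^n * (2 * (1/4)^n)"
      using abs_le[OF \<delta>D, of n] r(2)[of n] by (intro mult_left_mono) (auto simp: \<delta>_def[abs_def])
    also have "\<dots> = 2 * (2 * (1/4))^n" by (simp only: power_mult_distrib mult_ac)
    also have "\<dots> = 2 * (1/2)^n" by simp
    finally show ?thesis .
  qed
  obtain G where G: "is_nest G" "\<And>n k. continuous_on (G k) (v n)" using qc_common_nest[of v] v(2) by blast
  have "\<exists>j q. q \<in> D \<and> (AE x in m. x \<notin> G j \<longrightarrow> q x = 0) \<and> a.nb (\<lambda>x. \<bar>p x - q x\<bar>) \<le> (1/2)^k" for k
    by (rule nest_cutoff[OF G(1)]) simp
  then have "\<forall>k. \<exists>j q. q \<in> D \<and> (AE x in m. x \<notin> G j \<longrightarrow> q x = 0) \<and> a.nb (\<lambda>x. \<bar>p x - q x\<bar>) \<le> (1/2)^k"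
    by blast
  from this[unfolded choice_iff] obtain j q where q: "\<And>k. q k \<in> D" "\<And>k. AE x in m. x \<notin> G (j k) \<longrightarrow> q k x = 0"
     "\<And>k. a.nb (\<lambda>x. \<bar>p x - q k x\<bar>) \<le> (1/2)^k" by blast
  define J where "J k = (\<Sum>i\<le>k. j i)" for k
  have jJ: "j k \<le> J k" for k unfolding J_def by (rule member_le_sum) auto
  \<comment> \<open>The condition on \<open>h\<close> gives uniform convergence on
    \<open>F k\<close>; lying in \<open>G (J k)\<close> makes every term continuous there.\<close>
  define F where "F k = (\<Inter>n\<in>{k..}. {x \<in> G (J k). h n x \<le> 1})" for k
  have F_alt: "x \<in> F k \<longleftrightarrow> x \<in> G (J k) \<and> (\<forall>n\<ge>k. h n x \<le> 1)" for x k by (auto simp: F_def)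
  have h_cont: "continuous_on (G k) (h n)" for n k
    unfolding h_def \<delta>_def by (intro continuous_intros G(2))
  obtain B where B: "0 \<le> B" "AE x in m. p x \<le> B" using p_bounded by blast
  have qD: "(\<lambda>x. \<bar>p x - q k x\<bar>) \<in> D" for k by (intro abs_in a.diff_in p_in q)
  \<comment> \<open>The energy constant 5 is 1 from the cutoff plus 2 * 2 from the geometric sum of
    the \<open>h n\<close>. In \<open>c = 1 + B\<close> the number \<open>B\<close> bounds
    \<open>p\<close>: the factor 1 suffices off \<open>G (J k)\<close>, the factor \<open>B\<close>
    where some \<open>h n\<close> exceeds 1.\<close>
  have "is_nest F"
  proof (rule nest_criterion[where w = "\<lambda>k N x. \<bar>p x - q k x\<bar> + (\<Sum>n\<le>N. h (k + n) x)" and B = 5 and c = "1 + B"])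
    show "incseq F"
    proof (rule incseq_SucI)
      have "G (J k) \<subseteq> G (J (Suc k))" for k
        using nest_incseq[OF G(1)] by (rule incseqD) (simp add: J_def)
      then show "F k \<subseteq> F (Suc k)" for k unfolding F_alt subset_iff by (meson Suc_leD)
    qed
    show "closed (F k)" for k unfolding F_def
      by (intro closed_INT ballI continuous_on_closed_Collect_le h_cont continuous_intros nest_closed[OF G(1)])
    show "(\<lambda>x. \<bar>p x - q k x\<bar> + (\<Sum>n\<le>N. h (k + n) x)) \<in> D" for k N
      by (intro a.add_in qD a.sum_in hD)
    show "a.nb (\<lambda>x. \<bar>p x - q k x\<bar> + (\<Sum>n\<le>N. h (k + n) x)) \<le> 5 * (1/2)^k" for k N
    proof -
      have "a.nb (\<lambda>x. \<Sum>n\<le>N. h (k + n) x) \<le> (\<Sum>n\<le>N. 2 * (1/2)^(k+n))"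
        using a.nb_sum[of "{..N}" "\<lambda>n. h (k + n)"] hD sum_mono[of "{..N}" "\<lambda>n. a.nb (h (k+n))", OF h_le]
        by (meson order_trans)
      also have "\<dots> = 2 * (1/2)^k * (\<Sum>n\<le>N. (1/2)^n)" by (simp add: power_add sum_distrib_left mult.assoc)
      also have "\<dots> \<le> 2 * (1/2)^k * 2" by (rule mult_left_mono[OF sum_half_le]) simp
      finally show ?thesis
        using a.nb_add[OF qD a.sum_in[of "{..N}" "\<lambda>n. h (k + n)"], of k] hD q(3)[of k] by simp
    qed
    show "0 \<le> \<bar>p x - q k x\<bar> + (\<Sum>n\<le>N. h (k + n) x)" for k N x
      by (intro add_nonneg_nonneg sum_nonneg) (auto simp: h_def)
    show "\<bar>p x - q k x\<bar> + (\<Sum>n\<le>N. h (k + n) x) \<le> \<bar>p x - q k x\<bar> + (\<Sum>n\<le>Suc N. h (k + n) x)" for k N x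
      by (simp add: h_def)
    show "AE x in m. x \<notin> F k \<longrightarrow> (\<exists>N. p x \<le> (1 + B) * (\<bar>p x - q k x\<bar> + (\<Sum>n\<le>N. h (k + n) x)))" for k
      using q(2)[of k] B(2)
    proof eventually_elim
      case (elim x)
      have hn: "0 \<le> h n x" for n by (simp add: h_def)
      show ?case
      proof
        assume "x \<notin> F k"
        then consider "x \<notin> G (J k)" | n where "n \<ge> k" "1 < h n x" by (auto simp: F_alt not_le)
        then show "\<exists>N. p x \<le> (1 + B) * (\<bar>p x - q k x\<bar> + (\<Sum>n\<le>N. h (k + n) x))"
        proof cases
          case 1
          then have "x \<notin> G (j k)" using incseqD[OF nest_incseq[OF G(1)] jJ[of k]] by blast
          then have "p x = \<bar>p x - q k x\<bar>" using elim p_nonneg[of x] by simp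
          also have "\<dots> \<le> \<bar>p x - q k x\<bar> + (\<Sum>n\<le>0. h (k + n) x)" using hn by simp
          also have "\<dots> \<le> (1 + B) * (\<bar>p x - q k x\<bar> + (\<Sum>n\<le>0. h (k + n) x))"
            using B(1) hn by (simp add: distrib_right)
          finally show ?thesis by blast
        next
          case 2
          have "1 \<le> h (k + (n - k)) x" using 2 by simp
          also have "\<dots> \<le> (\<Sum>i\<le>n - k. h (k + i) x)" using hn by (intro member_le_sum) auto
          finally have "1 \<le> \<bar>p x - q k x\<bar> + (\<Sum>i\<le>n - k. h (k + i) x)" by simp
          then have "(1 + B) * 1 \<le> (1 + B) * (\<bar>p x - q k x\<bar> + (\<Sum>i\<le>n - k. h (k + i) x))"
            using B(1) by (intro mult_left_mono) auto
          moreover have "p x \<le> (1 + B) * 1" using elim(2) by simp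
          ultimately have "p x \<le> (1 + B) * (\<bar>p x - q k x\<bar> + (\<Sum>i\<le>n - k. h (k + i) x))" by (rule order_trans[rotated])
          then show ?thesis by blast
        qed
      qed
    qed
  qed (use B in simp)
  define v' where "v' x = v (r 0) x + (\<Sum>i. \<delta> i x)" for x
  have unif: "uniform_limit (F k) (\<lambda>n x. \<Sum>i<n. \<delta> i x) (\<lambda>x. \<Sum>i. \<delta> i x) sequentially" for k
  proof (rule Weierstrass_m_test_ev[where M = "\<lambda>n. (1/2)^n"])
    have "norm (\<delta> n x) \<le> (1/2)^n" if "n \<ge> k" "x \<in> F k" for n x
    proof -
      have "2^n * \<bar>\<delta> n x\<bar> \<le> 1" using that by (auto simp: F_alt h_def)
      then show ?thesis by (simp add: power_divide field_simps)
    qed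
    then show "\<forall>\<^sub>F n in sequentially. \<forall>x\<in>F k. norm (\<delta> n x) \<le> (1/2)^n"
      unfolding eventually_sequentially by blast
  qed (simp add: summable_geometric)
  have tele: "v (r n) x = v (r 0) x + (\<Sum>i<n. \<delta> i x)" for n x
    by (induction n) (auto simp: \<delta>_def)
  have FG: "F k \<subseteq> G (J k)" for k by (auto simp: F_alt)
  have "continuous_on (F k) v'" for k
    unfolding v'_def
  proof (intro continuous_intros)
    show "continuous_on (F k) (v (r 0))" using G(2) FG continuous_on_subset by blast
    show "continuous_on (F k) (\<lambda>x. \<Sum>i. \<delta> i x)"
    proof (rule uniform_limit_theorem[OF _ unif])
      have "continuous_on (F k) (\<delta> i)" for i
        unfolding \<delta>_def using G(2) FG continuous_on_subset by (intro continuous_intros) blast+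
      then show "\<forall>\<^sub>F n in sequentially. continuous_on (F k) (\<lambda>x. \<Sum>i<n. \<delta> i x)"
        by (intro always_eventually allI continuous_intros)
    qed simp
  qed
  then have qc': "qc v'" using \<open>is_nest F\<close> unfolding quasi_continuous_def by blast
  have conv: "(\<lambda>n. v (r n) x) \<longlonglongrightarrow> v' x" if "x \<in> F k" for x k
  proof -
    have "(\<lambda>n. v (r n) x) = (\<lambda>n. v (r 0) x + (\<Sum>i<n. \<delta> i x))" using tele by (intro ext)
    then show ?thesis unfolding v'_def
      using tendsto_add[OF tendsto_const tendsto_uniform_limitI[OF unif that]] by simp
  qed
  have exc1: "exc {x. \<not> (\<lambda>n. v (r n) x) \<longlonglongrightarrow> v' x}"
    unfolding exceptional_def using \<open>is_nest F\<close> conv by (intro exI[of _ F]) auto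
  obtain v'' where v'': "v'' \<in> borel_measurable borel" "qc v''" "exc {x. v'' x \<noteq> v' x}"
    using qc_borel_version[OF qc'] by blast
  have "exc {x. \<not> (\<lambda>n. v (r n) x) \<longlonglongrightarrow> v'' x}"
    by (rule exc_subset[OF exc_Un[OF exc1 v''(3)]]) auto
  then show ?thesis using r(1) v'' by blast
qed

lemma qe_convergence:
  assumes v: "\<And>n. v n \<in> D" "\<And>n. qc (v n)" "form_Cauchy a v"
    and u: "qc u" "AE x in m. (\<lambda>n. v n x) \<longlonglongrightarrow> u x"
  shows "\<exists>r::nat \<Rightarrow> nat. strict_mono r \<and> exc {x. \<not> (\<lambda>n. v (r n) x) \<longlonglongrightarrow> u x}"
proof -
  obtain r v' where r: "strict_mono r" "qc v'" "exc {x. \<not> (\<lambda>n. v (r n) x) \<longlonglongrightarrow> v' x}"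
    using qe_limit[OF v] by blast
  have "AE x in m. v' x = u x"
    using exc_AE[OF r(3)] u(2)
  proof eventually_elim
    case (elim x)
    then have "(\<lambda>n. v (r n) x) \<longlonglongrightarrow> u x" using LIMSEQ_subseq_LIMSEQ[OF _ r(1)] by (auto simp: o_def)
    then show ?case using elim LIMSEQ_unique by auto
  qed
  then have "exc {x. v' x \<noteq> u x}" by (rule qc_unique[OF r(2) u(1)])
  then have "exc {x. \<not> (\<lambda>n. v (r n) x) \<longlonglongrightarrow> u x}"
    by (rule exc_subset[OF exc_Un[OF r(3)]]) auto
  then show ?thesis using r(1) by blast
qed

lemma qc_exists:
  assumes u: "u \<in> D"
  shows "\<exists>u'\<in>D. u' \<in> borel_measurable borel \<and> qc u' \<and> (AE x in m. u' x = u x)"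
proof -
  obtain A where A: "form_dense m a D A" "\<And>u. u \<in> A \<Longrightarrow> \<exists>u'. qc_version m a D u u'"
    using dense_qc by blast
  have "\<exists>v\<in>D. qc v \<and> e.nb (\<lambda>x. v x - u x) < 1 / Suc n" for n
  proof -
    obtain v where v: "v \<in> A" "e.nb (\<lambda>x. u x - v x) < 1 / Suc n"
      using A(1) u unfolding form_dense_def e.nb_def by (metis of_nat_0_less_iff zero_less_Suc zero_less_divide_1_iff)
    have vD: "v \<in> D" using v(1) A(1) by (auto simp: form_dense_def)
    obtain v' where v': "qc v'" "AE x in m. v' x = v x" using A(2)[OF v(1)] by (auto simp: qc_version_def)
    \<comment> \<open>Elements of \<open>D\<close> are measurable, so the approximant returns to
      \<open>D\<close> only through a Borel version.\<close>
    obtain w where w: "w \<in> borel_measurable borel" "qc w" "exc {x. w x \<noteq> v' x}"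
      using qc_borel_version[OF v'(1)] by blast
    have eq: "AE x in m. v x = w x" using v'(2) exc_AE[OF w(3)] by eventually_elim auto
    have wD: "w \<in> D" using D_version[OF vD _ eq] w(1) measurable_cong_sets[OF sets_m refl] by blast
    have "e.nb (\<lambda>x. w x - u x) = e.nb (\<lambda>x. v x - u x)"
      using eq by (intro e_nb_cong a.diff_in wD vD u) (auto elim!: eventually_mono)
    then show ?thesis using w(2) wD v(2) e.nb_diff_commute[OF u vD] by auto
  qed
  then obtain v where v: "\<And>n. v n \<in> D" "\<And>n. qc (v n)" "\<And>n. e.nb (\<lambda>x. v n x - u x) < 1 / Suc n" by metis
  have lim: "(\<lambda>n. a.nb (\<lambda>x. v n x - u x)) \<longlonglongrightarrow> 0"
  proof (rule LIMSEQ_norm_0)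
    show "norm (a.nb (\<lambda>x. v n x - u x)) < 1 / real (Suc n)" for n
      using a.nb_nonneg[OF a.diff_in[OF v(1) u]] a_le_e[OF a.diff_in[OF v(1) u], of n] v(3)[of n] by simp
  qed
  have "form_Cauchy a v" by (rule a.Cauchy_if_tendsto[OF v(1) u lim])
  then obtain r v' where r: "strict_mono r" "v' \<in> borel_measurable borel" "qc v'" "exc {x. \<not> (\<lambda>n. v (r n) x) \<longlonglongrightarrow> v' x}"
    using qe_limit[of v] v(1,2) by blast
  have "AE x in m. v' x = u x"
  proof (rule a_limit_AE)
    show "(\<lambda>n. a.nb (\<lambda>x. v (r n) x - u x)) \<longlonglongrightarrow> 0"
      using LIMSEQ_subseq_LIMSEQ[OF lim r(1)] by (simp add: o_def)
    show "AE x in m. (\<lambda>n. v (r n) x) \<longlonglongrightarrow> v' x" using exc_AE[OF r(4)] by eventually_elim simp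
  qed (use v u r in auto)
  moreover have "v' \<in> D"
  proof (rule D_version[OF u])
    show "v' \<in> borel_measurable m" using r(2) measurable_cong_sets[OF sets_m refl] by blast
    show "AE x in m. u x = v' x" using calculation by eventually_elim simp
  qed
  ultimately show ?thesis using r by blast
qed

end

section \<open>Decomposition on the domain\<close>

lemma (in finite_measure) bounded_L2:
  assumes "u \<in> borel_measurable M" "\<And>x. \<bar>u x\<bar> \<le> (c::real)"
  shows "u \<in> L2 M" "integrable M u"
proof -
  have "(u x)\<^sup>2 \<le> c\<^sup>2" for x using power_mono[OF assms(2)[of x], of 2] by simp
  then have "integrable M (\<lambda>x. (u x)\<^sup>2)"
    using assms(1) by (intro integrable_const_bound[where B = "c\<^sup>2"]) auto
  then show "u \<in> L2 M" using assms(1) by (simp add: L2_def)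
  show "integrable M u" using assms by (intro integrable_const_bound[where B = c]) auto
qed

lemma integrable_mult_bounded:
  fixes k h :: "'a \<Rightarrow> real"
  assumes "integrable M k" "h \<in> borel_measurable M" "\<And>x. \<bar>h x\<bar> \<le> c"
  shows "integrable M (\<lambda>x. k x * h x)"
proof (rule Bochner_Integration.integrable_bound[where f = "\<lambda>x. c * k x"])
  have "\<bar>h x\<bar> \<le> \<bar>c\<bar>" for x using assms(3)[of x] by linarith
  then show "AE x in M. norm (k x * h x) \<le> norm (c * k x)"
    by (simp add: abs_mult mult.commute[of "\<bar>k _\<bar>"] mult_right_mono)
qed (use assms in auto)

lemma AE_summable_norm:
  fixes f :: "nat \<Rightarrow> 'a \<Rightarrow> real"
  assumes "\<And>k. integrable M (f k)" "summable (\<lambda>k. \<integral>x. \<bar>f k x\<bar> \<partial>M)"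
  shows "AE x in M. summable (\<lambda>k. \<bar>f k x\<bar>)"
proof -
  have [measurable]: "f k \<in> borel_measurable M" for k using assms(1) by auto
  have "(\<integral>\<^sup>+x. (\<Sum>k. ennreal \<bar>f k x\<bar>) \<partial>M) = (\<Sum>k. \<integral>\<^sup>+x. ennreal \<bar>f k x\<bar> \<partial>M)"
    by (rule nn_integral_suminf) measurable
  also have "\<dots> = (\<Sum>k. ennreal (\<integral>x. \<bar>f k x\<bar> \<partial>M))"
    using assms(1) by (subst nn_integral_eq_integral) auto
  also have "\<dots> < \<infinity>" using assms(2) by (subst suminf_ennreal2) auto
  finally have "AE x in M. (\<Sum>k. ennreal \<bar>f k x\<bar>) \<noteq> \<infinity>"
    by (intro nn_integral_noteq_infinite) auto
  then show ?thesis by eventually_elim (auto intro: summable_suminf_not_top)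
qed

context quasi_regular_form
begin

definition no_charge :: "'a measure \<Rightarrow> bool" where
  "no_charge \<kappa> \<longleftrightarrow> sets \<kappa> = sets borel \<and> finite_measure \<kappa> \<and>
     (\<forall>B\<in>sets borel. exc B \<longrightarrow> emeasure \<kappa> B = 0)"

text \<open>An arbitrary exceptional set lies in the Borel exceptional set formed by the complements
  of a nest.\<close>

lemma no_charge_AE:
  assumes "no_charge \<kappa>" "exc N"
  shows "AE x in \<kappa>. x \<notin> N"
proof -
  obtain F where F: "is_nest F" "N \<subseteq> (\<Inter>k. - F k)" using assms(2) unfolding exceptional_def by blast
  have s: "(\<Inter>k. - F k) \<in> sets borel" using nest_closed[OF F(1)] by (intro sets.countable_INT') auto
  have "exc (\<Inter>k. - F k)" using F(1) unfolding exceptional_def by blast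
  then have "(\<Inter>k. - F k) \<in> null_sets \<kappa>"
    using assms(1) s unfolding no_charge_def null_sets_def by auto
  then show ?thesis by (rule AE_I'[OF _ ]) (use F(2) in auto)
qed

text \<open>The bounds on \<open>w\<close> hold everywhere and \<open>w\<close> is quasi-continuous,
  because \<open>w\<close> will be a density for \<open>\<kappa>\<close>, which may charge sets that
  are null for \<open>m\<close>.\<close>

definition penalized :: "'a measure \<Rightarrow> real \<Rightarrow> ('a \<Rightarrow> real) \<Rightarrow> bool" where
  "penalized \<kappa> \<alpha> w \<longleftrightarrow> 0 < \<alpha> \<and> w \<in> D \<and> qc w \<and> (\<forall>x. 0 \<le> w x \<and> w x \<le> 1) \<and>
    (\<forall>v\<in>D. qc v \<longrightarrow> v \<in> L2 \<kappa> \<longrightarrow>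
       a w v + \<alpha> * (\<integral>x. w x * v x \<partial>m) + (\<integral>x. w x * v x \<partial>\<kappa>) = (\<integral>x. v x \<partial>\<kappa>))"

lemma penalizedD:
  assumes "penalized \<kappa> \<alpha> w"
  shows "0 < \<alpha>" "w \<in> D" "qc w" "0 \<le> w x \<and> w x \<le> 1"
    "v \<in> D \<Longrightarrow> qc v \<Longrightarrow> v \<in> L2 \<kappa> \<Longrightarrow>
       a w v + \<alpha> * (\<integral>x. w x * v x \<partial>m) + (\<integral>x. w x * v x \<partial>\<kappa>) = (\<integral>x. v x \<partial>\<kappa>)"
  using assms by (auto simp: penalized_def)

text \<open>Riesz representation in the space \<open>V\<close> of quasi-continuous elements of
  \<open>D\<close> that are square integrable for \<open>\<kappa>\<close>. The main point is
  completeness, where the absence of charge on exceptional sets makes the limits for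
  \<open>m\<close> and for \<open>\<kappa>\<close> the same function.\<close>

lemma penalized_solution:
  assumes \<kappa>: "no_charge \<kappa>" and "0 < \<alpha>"
  shows "\<exists>w. penalized \<kappa> \<alpha> w"
proof -
  have sets_\<kappa> [measurable_cong]: "sets \<kappa> = sets borel" and "finite_measure \<kappa>"
    using \<kappa> by (auto simp: no_charge_def)
  interpret finite_measure \<kappa> by fact
  define V where "V = {v \<in> D. qc v \<and> v \<in> L2 \<kappa>}"
  define b where "b u v = form_alpha m a \<alpha> u v + (\<integral>x. u x * v x \<partial>\<kappa>)" for u v
  interpret K: psd_form "L2 \<kappa>" "\<lambda>u v. \<integral>x. u x * v x \<partial>\<kappa>" by (rule psd_form_L2)
  interpret A: psd_form D "form_alpha m a \<alpha>" using \<open>0 < \<alpha>\<close> by (intro psd_form_alpha) simp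
  have meas: "v \<in> borel_measurable \<kappa>" if "v \<in> D" for v using that by measurable
  have V_lin: "(\<lambda>x. s * u x + t * v x) \<in> V" if "u \<in> V" "v \<in> V" for s t u v
    using that a.lincomb_in K.lincomb_in qc_lincomb by (auto simp: V_def)
  have one: "(\<lambda>x. 1) \<in> L2 \<kappa>" by (rule bounded_L2[where c = 1]) auto
  interpret B: psd_form V b
  proof
    have G0: "G (\<lambda>x. 0) \<in> D" using G_core(2)[of "\<lambda>x. 0"] g_nonneg core_D by auto
    obtain u where u: "u \<in> D" "qc u" using qc_exists[OF G0] by blast
    have "qc (\<lambda>x. 0)" using qc_scale[OF u(2), of 0] by simp
    then show "(\<lambda>x. 0) \<in> V" using a.zero_in K.zero_in by (simp add: V_def)
    show "(\<lambda>x. u x + v x) \<in> V" if "u \<in> V" "v \<in> V" for u v using V_lin[OF that, of 1 1] by simp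
    show "(\<lambda>x. c * u x) \<in> V" if "u \<in> V" for c u using V_lin[OF that that, of c 0] by simp
    show "b u v = b v u" if "u \<in> V" "v \<in> V" for u v
      using that A.b_sym[of u v] K.b_sym[of u v] unfolding b_def V_def by simp
    show "b (\<lambda>x. u x + u' x) v = b u v + b u' v" if "u \<in> V" "u' \<in> V" "v \<in> V" for u u' v
      using that A.b_add[of u u' v] K.b_add[of u u' v] unfolding b_def V_def by simp
    show "b (\<lambda>x. c * u x) v = c * b u v" if "u \<in> V" "v \<in> V" for c u v
    proof -
      have "form_alpha m a \<alpha> (\<lambda>x. c * u x) v = c * form_alpha m a \<alpha> u v"
        "(\<integral>x. (c * u x) * v x \<partial>\<kappa>) = c * (\<integral>x. u x * v x \<partial>\<kappa>)"
        using that A.b_scale K.b_scale unfolding V_def by blast+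
      then show ?thesis unfolding b_def by (simp only: distrib_left)
    qed
    show "0 \<le> b u u" if "u \<in> V" for u
      using that A.b_nonneg[of u] K.b_nonneg[of u] unfolding b_def V_def by simp
  qed
  have K_le: "K.nb v \<le> B.nb v" if "v \<in> V" for v
    using that A.b_nonneg[of v] by (simp add: B.nb_def K.nb_def b_def V_def)
  \<comment> \<open>The term 1 covers the energy, the term \<open>1 / \<alpha>\<close> recovers the
    unweighted L2 part from the part weighted by \<open>\<alpha>\<close>.\<close>
  define C where "C = sqrt (1 + 1 / \<alpha>)"
  have e_le_B: "e.nb v \<le> C * B.nb v" if "v \<in> V" for v
  proof -
    have v: "v \<in> D" "v \<in> L2 \<kappa>" using that by (auto simp: V_def)
    define X Y Z where "X = a v v" and "Y = (\<integral>x. v x * v x \<partial>m)" and "Z = (\<integral>x. v x * v x \<partial>\<kappa>)"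
    have nn: "0 \<le> X" "0 \<le> Y" "0 \<le> Z"
      using nonneg[OF v(1)] L.b_nonneg[OF D_L2[OF v(1)]] K.b_nonneg[OF v(2)] by (simp_all add: X_def Y_def Z_def)
    have "X + Y \<le> (1 + 1 / \<alpha>) * (X + \<alpha> * Y + Z)"
    proof -
      have "(1 + 1 / \<alpha>) * (X + \<alpha> * Y + Z) = X + Y + (\<alpha> * Y + Z + (X + Z) / \<alpha>)"
        using \<open>0 < \<alpha>\<close> by (simp add: field_simps)
      then show ?thesis using nn \<open>0 < \<alpha>\<close> by simp
    qed
    then have "sqrt (X + Y) \<le> sqrt ((1 + 1 / \<alpha>) * (X + \<alpha> * Y + Z))" by (rule real_sqrt_le_mono)
    then show ?thesis
      by (simp add: e.nb_def e_eq B.nb_def b_def form_alpha_def C_def real_sqrt_mult X_def Y_def Z_def)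
  qed
  have C0: "0 < C" using \<open>0 < \<alpha>\<close> by (simp add: C_def add_pos_pos)
  have complete: "B.complete"
    unfolding B.complete_def
  proof (intro allI impI)
    fix u :: "nat \<Rightarrow> 'a \<Rightarrow> real" assume "\<forall>n. u n \<in> V" and Cauchy: "form_Cauchy b u"
    then have uV: "u n \<in> V" for n by simp
    have uD: "u n \<in> D" and uqc: "qc (u n)" and uK: "u n \<in> L2 \<kappa>" for n using uV[of n] by (auto simp: V_def)
    have e_C: "form_Cauchy (form_alpha m a 1) u" unfolding e.form_Cauchy_iff
    proof (intro allI impI)
      fix \<epsilon> :: real assume "0 < \<epsilon>"
      then obtain N where N: "\<And>i j. i \<ge> N \<Longrightarrow> j \<ge> N \<Longrightarrow> B.nb (\<lambda>x. u i x - u j x) < \<epsilon> / C"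
        using Cauchy C0 unfolding B.form_Cauchy_iff by (meson divide_pos_pos)
      have "e.nb (\<lambda>x. u i x - u j x) < \<epsilon>" if "i \<ge> N" "j \<ge> N" for i j
        using e_le_B[OF B.diff_in[OF uV uV], of i j] N[OF that] C0 by (simp add: field_simps)
      then show "\<exists>N. \<forall>i\<ge>N. \<forall>j\<ge>N. e.nb (\<lambda>x. u i x - u j x) < \<epsilon>" by blast
    qed
    have a_C: "form_Cauchy a u" unfolding a.form_Cauchy_iff
      using e_C unfolding e.form_Cauchy_iff using a_le_e[OF a.diff_in[OF uD uD]] by (meson le_less_trans)
    obtain w where w: "w \<in> D" "(\<lambda>n. e.nb (\<lambda>x. u n x - w x)) \<longlonglongrightarrow> 0"
      using e_complete e_C uD unfolding e.complete_def by blast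
    \<comment> \<open>The limit \<open>w\<close> in \<open>D\<close> is a class only. Its
      quasi-continuous version \<open>v\<close> is a quasi-everywhere limit along a subsequence,
      hence also a limit almost everywhere for \<open>\<kappa>\<close>.\<close>
    obtain r v where r: "strict_mono r" "v \<in> borel_measurable borel" "qc v" "exc {x. \<not> (\<lambda>n. u (r n) x) \<longlonglongrightarrow> v x}"
      using qe_limit[of u] uD uqc a_C by blast
    have sub: "(\<lambda>n. e.nb (\<lambda>x. u (r n) x - w x)) \<longlonglongrightarrow> 0"
      using LIMSEQ_subseq_LIMSEQ[OF w(2) r(1)] by (simp add: o_def)
    have vw: "AE x in m. v x = w x"
    proof (rule a_limit_AE)
      show "(\<lambda>n. a.nb (\<lambda>x. u (r n) x - w x)) \<longlonglongrightarrow> 0"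
        using a_le_e[OF a.diff_in[OF uD w(1)]] a.nb_nonneg[OF a.diff_in[OF uD w(1)]]
        by (intro tendsto_sandwich[OF _ _ tendsto_const sub]) auto
      show "AE x in m. (\<lambda>n. u (r n) x) \<longlonglongrightarrow> v x" using exc_AE[OF r(4)] by eventually_elim simp
    qed (use uD w r in auto)
    have vD: "v \<in> D"
    proof (rule D_version[OF w(1)])
      show "v \<in> borel_measurable m" using r(2) measurable_cong_sets[OF sets_m refl] by blast
      show "AE x in m. w x = v x" using vw by eventually_elim simp
    qed
    have ev: "(\<lambda>n. e.nb (\<lambda>x. u n x - v x)) \<longlonglongrightarrow> 0"
    proof -
      have "e.nb (\<lambda>x. u n x - v x) = e.nb (\<lambda>x. u n x - w x)" for n
        using vw by (intro e_nb_cong a.diff_in uD vD w(1)) (auto elim!: eventually_mono)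
      then show ?thesis using w(2) by simp
    qed
    have \<kappa>lim: "AE x in \<kappa>. (\<lambda>n. u (r n) x) \<longlonglongrightarrow> v x" using no_charge_AE[OF \<kappa> r(4)] by eventually_elim simp
    have um [measurable]: "u n \<in> borel_measurable borel" for n using uD[of n] by measurable
    note [measurable] = r(2)
    \<comment> \<open>Fatou's lemma along the subsequence transfers the Cauchy estimate for
      \<open>\<kappa>\<close> to the limit \<open>v\<close>.\<close>
    have K_small: "\<exists>N. \<forall>i\<ge>N. (\<lambda>x. u i x - v x) \<in> L2 \<kappa> \<and> K.nb (\<lambda>x. u i x - v x) \<le> \<epsilon>" if "0 < \<epsilon>" for \<epsilon>
    proof -
      obtain N where N: "\<And>i j. i \<ge> N \<Longrightarrow> j \<ge> N \<Longrightarrow> B.nb (\<lambda>x. u i x - u j x) < \<epsilon>"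
        using Cauchy \<open>0 < \<epsilon>\<close> unfolding B.form_Cauchy_iff by meson
      have "(\<lambda>x. u i x - v x) \<in> L2 \<kappa> \<and> K.nb (\<lambda>x. u i x - v x) \<le> \<epsilon>" if "i \<ge> N" for i
      proof -
        have "integrable \<kappa> (\<lambda>x. (u i x - v x)\<^sup>2) \<and> (\<integral>x. (u i x - v x)\<^sup>2 \<partial>\<kappa>) \<le> \<epsilon>\<^sup>2"
        proof (rule integral_Fatou[where f = "\<lambda>j x. (u i x - u (r j) x)\<^sup>2"])
          have d: "(\<lambda>x. u i x - u (r j) x) \<in> L2 \<kappa>" for j using uK by (intro K.diff_in)
          then show "integrable \<kappa> (\<lambda>x. (u i x - u (r j) x)\<^sup>2)" for j by (simp add: L2_def)
          show "AE x in \<kappa>. (\<lambda>j. (u i x - u (r j) x)\<^sup>2) \<longlonglongrightarrow> (u i x - v x)\<^sup>2"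
            using \<kappa>lim by eventually_elim (intro tendsto_intros)
          fix j assume "N \<le> j"
          then have rj: "N \<le> r j" using seq_suble[OF r(1), of j] by simp
          have "(\<integral>x. (u i x - u (r j) x)\<^sup>2 \<partial>\<kappa>) = (K.nb (\<lambda>x. u i x - u (r j) x))\<^sup>2"
            using K.nb_sq[OF d] by (simp add: power2_eq_square)
          also have "\<dots> \<le> \<epsilon>\<^sup>2"
            using K_le[OF B.diff_in[OF uV uV], of i "r j"] N[OF that rj] K.nb_nonneg[OF d, of j]
            by (intro power_mono) auto
          finally show "(\<integral>x. (u i x - u (r j) x)\<^sup>2 \<partial>\<kappa>) \<le> \<epsilon>\<^sup>2" .
        qed simp_all
        then have int: "integrable \<kappa> (\<lambda>x. (u i x - v x)\<^sup>2)" and "(\<integral>x. (u i x - v x)\<^sup>2 \<partial>\<kappa>) \<le> \<epsilon>\<^sup>2" by simp_all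
        then have "sqrt (\<integral>x. (u i x - v x)\<^sup>2 \<partial>\<kappa>) \<le> \<epsilon>" using \<open>0 < \<epsilon>\<close> by (simp add: real_le_lsqrt)
        then show ?thesis using int by (simp add: L2_def K.nb_def power2_eq_square)
      qed
      then show ?thesis by blast
    qed
    obtain N where N: "(\<lambda>x. u N x - v x) \<in> L2 \<kappa>" using K_small[of 1] by auto
    have vK: "v \<in> L2 \<kappa>" using K.diff_in[OF uK[of N] N] by simp
    have vV: "v \<in> V" using vD vK r(3) by (simp add: V_def)
    have Klim: "(\<lambda>n. K.nb (\<lambda>x. u n x - v x)) \<longlonglongrightarrow> 0"
    proof (rule LIMSEQ_I)
      fix \<epsilon> :: real assume "0 < \<epsilon>"
      then obtain N where "\<forall>i\<ge>N. K.nb (\<lambda>x. u i x - v x) \<le> \<epsilon> / 2" using K_small[of "\<epsilon>/2"] by auto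
      then show "\<exists>N. \<forall>n\<ge>N. norm (K.nb (\<lambda>x. u n x - v x) - 0) < \<epsilon>"
        using \<open>0 < \<epsilon>\<close> K.nb_nonneg[OF K.diff_in[OF uK vK]] by (intro exI[of _ N]) (auto intro: le_less_trans)
    qed
    have B_le: "B.nb z \<le> sqrt (1 + \<alpha>) * e.nb z + K.nb z" if "z \<in> V" for z
    proof -
      have z: "z \<in> D" "z \<in> L2 \<kappa>" using that by (auto simp: V_def)
      have nn: "0 \<le> a z z" "0 \<le> (\<integral>x. z x * z x \<partial>m)" "0 \<le> (\<integral>x. z x * z x \<partial>\<kappa>)"
        using nonneg[OF z(1)] L.b_nonneg[OF D_L2[OF z(1)]] K.b_nonneg[OF z(2)] by simp_all
      have "form_alpha m a \<alpha> z z \<le> (1 + \<alpha>) * form_alpha m a 1 z z"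
        using nn \<open>0 < \<alpha>\<close> by (simp add: form_alpha_def algebra_simps)
      then have "sqrt (form_alpha m a \<alpha> z z) \<le> sqrt (1 + \<alpha>) * e.nb z"
        using real_sqrt_le_mono real_sqrt_mult by (metis e.nb_def)
      moreover have "B.nb z \<le> sqrt (form_alpha m a \<alpha> z z) + K.nb z"
        unfolding B.nb_def b_def K.nb_def by (intro sqrt_add_le_add_sqrt A.b_nonneg z nn)
      ultimately show ?thesis by simp
    qed
    have "(\<lambda>n. sqrt (1 + \<alpha>) * e.nb (\<lambda>x. u n x - v x) + K.nb (\<lambda>x. u n x - v x)) \<longlonglongrightarrow> sqrt (1 + \<alpha>) * 0 + 0"
      by (intro tendsto_intros ev Klim)
    then have up: "(\<lambda>n. sqrt (1 + \<alpha>) * e.nb (\<lambda>x. u n x - v x) + K.nb (\<lambda>x. u n x - v x)) \<longlonglongrightarrow> 0" by simp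
    have "(\<lambda>n. B.nb (\<lambda>x. u n x - v x)) \<longlonglongrightarrow> 0"
    proof (rule tendsto_sandwich[OF _ _ tendsto_const up])
      show "\<forall>\<^sub>F n in sequentially. 0 \<le> B.nb (\<lambda>x. u n x - v x)"
        by (intro always_eventually allI B.nb_nonneg B.diff_in uV vV)
      show "\<forall>\<^sub>F n in sequentially. B.nb (\<lambda>x. u n x - v x) \<le> sqrt (1 + \<alpha>) * e.nb (\<lambda>x. u n x - v x) + K.nb (\<lambda>x. u n x - v x)"
        by (intro always_eventually allI B_le B.diff_in uV vV)
    qed
    then show "\<exists>w\<in>V. (\<lambda>n. B.nb (\<lambda>x. u n x - w x)) \<longlonglongrightarrow> 0" using vV by blast
  qed
  have int: "integrable \<kappa> v" if "v \<in> L2 \<kappa>" for v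
    using L2_mult_integrable[OF one that] by simp
  have "\<exists>w\<in>V. \<forall>v\<in>V. b w v = (\<integral>x. v x \<partial>\<kappa>)"
  proof (rule B.riesz[OF complete])
    show "\<bar>\<integral>x. v x \<partial>\<kappa>\<bar> \<le> K.nb (\<lambda>x. 1) * B.nb v" if "v \<in> V" for v
    proof -
      have "v \<in> L2 \<kappa>" using that by (simp add: V_def)
      then show ?thesis
        using K.cauchy_schwarz[OF one, of v] mult_left_mono[OF K_le[OF that] K.nb_nonneg[OF one]] by simp
    qed
  qed (auto simp: V_def int)
  then obtain w where w: "w \<in> V" "\<And>v. v \<in> V \<Longrightarrow> b w v = (\<integral>x. v x \<partial>\<kappa>)" by blast
  have wD: "w \<in> D" "qc w" "w \<in> L2 \<kappa>" using w(1) by (auto simp: V_def)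
  \<comment> \<open>Up to a constant, \<open>w\<close> minimises the shifted energy of
    \<open>v\<close> plus the \<open>\<kappa>\<close>-integral of \<open>(1 - v)\<^sup>2\<close>.
    Truncation to the unit interval decreases every term, so \<open>t\<close> has
    \<open>b\<close>-distance 0 from \<open>w\<close> and solves the same equation.\<close>
  define t where "t x = min (max (w x) 0) 1" for x
  have tD: "t \<in> D" unfolding t_def by (rule trunc_in[OF wD(1)]) simp
  have tw: "\<bar>t x\<bar> \<le> \<bar>w x\<bar>" for x by (simp add: t_def)
  have tK: "t \<in> L2 \<kappa>" using tw by (intro L2_bound[OF wD(3) meas[OF tD]]) simp
  have tV: "t \<in> V" using tD tK qc_trunc[OF wD(2), of 0 1] by (simp add: V_def t_def[abs_def])
  have 1: "a t t \<le> a w w" using trunc_le[OF wD(1), of 1] by (simp add: t_def[abs_def] a.nb_def)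
  have 2: "(\<integral>x. t x * t x \<partial>m) \<le> (\<integral>x. w x * w x \<partial>m)"
  proof (rule integral_mono)
    show "t x * t x \<le> w x * w x" for x
      using tw[of x] unfolding abs_le_square_iff power2_eq_square .
  qed (intro L2_mult_integrable D_L2 tD wD(1))+
  have 3: "(\<integral>x. t x * t x - 2 * t x \<partial>\<kappa>) \<le> (\<integral>x. w x * w x - 2 * w x \<partial>\<kappa>)"
  proof (rule integral_mono)
    show "t x * t x - 2 * t x \<le> w x * w x - 2 * w x" for x
    proof -
      have "\<bar>1 - t x\<bar> \<le> \<bar>1 - w x\<bar>" by (simp add: t_def min_def max_def)
      then have "(1 - t x) * (1 - t x) \<le> (1 - w x) * (1 - w x)" unfolding abs_le_square_iff power2_eq_square .
      then show ?thesis by (simp add: algebra_simps)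
    qed
  qed (intro Bochner_Integration.integrable_diff L2_mult_integrable integrable_mult_right int tK wD(3))+
  have "b (\<lambda>x. w x - t x) (\<lambda>x. w x - t x) = (\<integral>x. w x \<partial>\<kappa>) - 2 * (\<integral>x. t x \<partial>\<kappa>) + b t t"
    using B.b_quad_diff[OF w(1) tV] w(2)[OF tV] w(2)[OF w(1)] by simp
  also have "\<dots> \<le> 0"
  proof -
    have "b t t - 2 * (\<integral>x. t x \<partial>\<kappa>) \<le> b w w - 2 * (\<integral>x. w x \<partial>\<kappa>)"
    proof -
      have "\<alpha> * (\<integral>x. t x * t x \<partial>m) \<le> \<alpha> * (\<integral>x. w x * w x \<partial>m)" using 2 \<open>0 < \<alpha>\<close> by simp
      moreover have "(\<integral>x. t x * t x \<partial>\<kappa>) - 2 * (\<integral>x. t x \<partial>\<kappa>) \<le> (\<integral>x. w x * w x \<partial>\<kappa>) - 2 * (\<integral>x. w x \<partial>\<kappa>)"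
        using 3 int[OF tK] int[OF wD(3)] L2_mult_integrable[OF tK tK] L2_mult_integrable[OF wD(3) wD(3)] by simp
      ultimately show ?thesis using 1 unfolding b_def form_alpha_def by linarith
    qed
    then show ?thesis using w(2)[OF w(1)] by simp
  qed
  finally have "b (\<lambda>x. w x - t x) (\<lambda>x. w x - t x) = 0"
    using B.b_nonneg[OF B.diff_in[OF w(1) tV]] by simp
  then have zero: "B.nb (\<lambda>x. w x - t x) = 0" by (simp add: B.nb_def)
  have "b t v = (\<integral>x. v x \<partial>\<kappa>)" if "v \<in> V" for v
    using B.cauchy_schwarz[OF B.diff_in[OF w(1) tV] that] zero B.b_diff[OF w(1) tV that] w(2)[OF that] by simp
  then have "penalized \<kappa> \<alpha> t"
    using \<open>0 < \<alpha>\<close> tV by (auto simp: penalized_def V_def b_def form_alpha_def t_def)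
  then show ?thesis by blast
qed

text \<open>Otherwise the solutions for \<open>\<alpha> \<rightarrow> \<infinity>\<close>, which are bounded in energy and tend to \<open>0\<close> in \<open>L\<^sup>2\<close>, lie in
  a convex set of functions with \<open>\<kappa>\<close>-integral at least \<open>\<epsilon>\<close>. That set then contains a sequence tending
  to \<open>0\<close> quasi-everywhere, which contradicts dominated convergence.\<close>

lemma penalized_small:
  assumes \<kappa>: "no_charge \<kappa>" and "0 < \<epsilon>"
  shows "\<exists>\<alpha> w. penalized \<kappa> \<alpha> w \<and> (\<integral>x. w x \<partial>\<kappa>) \<le> \<epsilon>"
proof (rule ccontr)
  assume neg: "\<not> ?thesis"
  have sets_\<kappa> [measurable_cong]: "sets \<kappa> = sets borel" and "finite_measure \<kappa>"
    using \<kappa> by (auto simp: no_charge_def)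
  interpret finite_measure \<kappa> by fact
  interpret K: psd_form "L2 \<kappa>" "\<lambda>u v. \<integral>x. u x * v x \<partial>\<kappa>" by (rule psd_form_L2)
  define M where "M = measure \<kappa> UNIV"
  have space: "space \<kappa> = UNIV" using sets_eq_imp_space_eq[OF sets_\<kappa>] by simp
  define S where "S = {v \<in> D. qc v \<and> (\<forall>x. 0 \<le> v x \<and> v x \<le> 1) \<and> \<epsilon> \<le> (\<integral>x. v x \<partial>\<kappa>)}"
  have SD: "S \<subseteq> D" by (auto simp: S_def)
  have m\<kappa>: "v \<in> borel_measurable \<kappa>" if "v \<in> D" for v using that by measurable
  have bd: "v \<in> L2 \<kappa>" "integrable \<kappa> v" if "v \<in> D" "\<And>x. 0 \<le> v x \<and> v x \<le> 1" for v
    using bounded_L2[of v 1] m\<kappa> that by auto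
  have approx: "\<exists>v\<in>S. a v v \<le> M \<and> L.nb (\<lambda>x. v x - 0) \<le> \<eta>" if "0 < \<eta>" for \<eta> :: real
  proof -
    \<comment> \<open>Testing the equation with \<open>w\<close> itself bounds
      \<open>\<alpha>\<close> times the squared L2 norm of \<open>w\<close> by \<open>M\<close>;
      this choice makes that norm at most \<open>\<eta>\<close>. The summand 1 keeps
      \<open>\<alpha>\<close> positive when \<open>M = 0\<close>.\<close>
    define \<alpha> where "\<alpha> = M / \<eta>\<^sup>2 + 1"
    have "0 < \<alpha>" unfolding \<alpha>_def M_def by (simp add: add_nonneg_pos)
    obtain w where pw: "penalized \<kappa> \<alpha> w"
      using penalized_solution[OF \<kappa> \<open>0 < \<alpha>\<close>] by blast
    note w = penalizedD(2-5)[OF pw]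
    have "\<epsilon> < (\<integral>x. w x \<partial>\<kappa>)" using neg pw by (meson not_le)
    then have "w \<in> S" using w by (simp add: S_def)
    have "(\<integral>x. w x \<partial>\<kappa>) \<le> (\<integral>x. 1 \<partial>\<kappa>)" using bd(2)[OF w(1,3)] w(3) by (intro integral_mono) auto
    then have le: "a w w + \<alpha> * (\<integral>x. w x * w x \<partial>m) + (\<integral>x. w x * w x \<partial>\<kappa>) \<le> M"
      using w(4)[OF w(1,2) bd(1)[OF w(1,3)]] by (simp add: M_def space)
    have nn: "0 \<le> a w w" "0 \<le> (\<integral>x. w x * w x \<partial>m)" "0 \<le> (\<integral>x. w x * w x \<partial>\<kappa>)"
      using nonneg[OF w(1)] by simp_all
    have "\<alpha> * (\<integral>x. w x * w x \<partial>m) \<le> M" using le nn by linarith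
    also have "M \<le> \<alpha> * \<eta>\<^sup>2" using \<open>0 < \<eta>\<close> by (simp add: \<alpha>_def distrib_right)
    finally have "(\<integral>x. w x * w x \<partial>m) \<le> \<eta>\<^sup>2" using \<open>0 < \<alpha>\<close> by simp
    then have "L.nb w \<le> \<eta>" using \<open>0 < \<eta>\<close> unfolding L.nb_def by (simp add: real_le_lsqrt)
    moreover have "a w w \<le> M" using le nn mult_nonneg_nonneg[OF less_imp_le[OF \<open>0 < \<alpha>\<close>] nn(2)] by linarith
    ultimately show ?thesis using \<open>w \<in> S\<close> by auto
  qed
  have conv: "\<forall>\<eta>>0. \<exists>v\<in>S. e.nb (\<lambda>x. 0 - v x) < \<eta>"
  proof -
    have mid: "(\<lambda>x. (u x + v x) / 2) \<in> S" if "u \<in> S" "v \<in> S" for u v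
    proof -
      have uv: "u \<in> D" "v \<in> D" "\<And>x. 0 \<le> u x \<and> u x \<le> 1" "\<And>x. 0 \<le> v x \<and> v x \<le> 1"
        "qc u" "qc v" "\<epsilon> \<le> (\<integral>x. u x \<partial>\<kappa>)" "\<epsilon> \<le> (\<integral>x. v x \<partial>\<kappa>)"
        using that by (auto simp: S_def)
      have "qc (\<lambda>x. (u x + v x) / 2)" using qc_lincomb[OF uv(5,6), of "1/2" "1/2"] by (simp add: field_simps)
      moreover have "0 \<le> (u x + v x) / 2 \<and> (u x + v x) / 2 \<le> 1" for x using uv(3,4)[of x] by auto
      moreover have "(\<integral>x. (u x + v x) / 2 \<partial>\<kappa>) = ((\<integral>x. u x \<partial>\<kappa>) + (\<integral>x. v x \<partial>\<kappa>)) / 2"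
        using bd(2) uv by simp
      ultimately show ?thesis using uv a.mid_in by (simp add: S_def)
    qed
    have "(\<lambda>x. 0) \<in> D \<and> a (\<lambda>x. 0) (\<lambda>x. 0) \<le> M \<and> (\<forall>\<eta>>0. \<exists>v\<in>S. e.nb (\<lambda>x. 0 - v x) < \<eta>)"
      using SD mid D_L2[OF a.zero_in] approx by (rule weak_closure)
    then show ?thesis by blast
  qed
  have "\<exists>v\<in>S. e.nb v < 1 / Suc n" for n
  proof -
    obtain v where "v \<in> S" "e.nb (\<lambda>x. 0 - v x) < 1 / Suc n"
      using conv by (metis of_nat_0_less_iff zero_less_Suc zero_less_divide_1_iff)
    moreover from this have "v \<in> D" using SD by auto
    ultimately show ?thesis using e.nb_minus[of v] by (intro bexI[of _ v]) auto
  qed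
  then obtain v where v: "\<And>n. v n \<in> S" "\<And>n. e.nb (v n) < 1 / Suc n" by metis
  have vD: "v n \<in> D" and vqc: "qc (v n)" and v01: "0 \<le> v n x \<and> v n x \<le> 1" and v\<epsilon>: "\<epsilon> \<le> (\<integral>x. v n x \<partial>\<kappa>)" for n x
    using v(1)[of n] by (auto simp: S_def)
  have lim: "(\<lambda>n. a.nb (v n)) \<longlonglongrightarrow> 0"
  proof (rule LIMSEQ_norm_0)
    show "norm (a.nb (v n)) < 1 / real (Suc n)" for n
      using a.nb_nonneg[OF vD] a_le_e[OF vD, of n] v(2)[of n] by simp
  qed
  have "form_Cauchy a v"
    by (rule a.Cauchy_if_tendsto[OF vD a.zero_in]) (use lim in simp)
  then obtain r z where r: "strict_mono r" "z \<in> borel_measurable borel" "qc z" "exc {x. \<not> (\<lambda>n. v (r n) x) \<longlonglongrightarrow> z x}"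
    using qe_limit[of v] vD vqc by blast
  have z0: "AE x in m. z x = 0"
  proof (rule a_limit_AE[where v = "\<lambda>n. v (r n)"])
    show "(\<lambda>n. a.nb (\<lambda>x. v (r n) x - 0)) \<longlonglongrightarrow> 0"
      using LIMSEQ_subseq_LIMSEQ[OF lim r(1)] by (simp add: o_def)
    show "AE x in m. (\<lambda>n. v (r n) x) \<longlonglongrightarrow> z x" using exc_AE[OF r(4)] by eventually_elim simp
  qed (use vD r a.zero_in in auto)
  \<comment> \<open>The limit \<open>z\<close> is first known to vanish only for \<open>m\<close>;
    quasi-continuity upgrades this to quasi-everywhere, hence to \<open>\<kappa>\<close>.\<close>
  have \<kappa>0: "AE x in \<kappa>. (\<lambda>n. v (r n) x) \<longlonglongrightarrow> 0"
    using no_charge_AE[OF \<kappa> r(4)] no_charge_AE[OF \<kappa> qc_zero[OF r(3) z0]] by eventually_elim auto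
  have "(\<lambda>n. \<integral>x. v (r n) x \<partial>\<kappa>) \<longlonglongrightarrow> (\<integral>x. 0 \<partial>\<kappa>)"
    by (rule integral_dominated_convergence[where w = "\<lambda>_. 1"]) (use m\<kappa> vD v01 \<kappa>0 in auto)
  then have "\<epsilon> \<le> 0" using v\<epsilon> by (intro LIMSEQ_le_const[where X = "\<lambda>n. \<integral>x. v (r n) x \<partial>\<kappa>"]) auto
  then show False using \<open>0 < \<epsilon>\<close> by simp
qed

text \<open>The constant 1 need not belong to \<open>D\<close>. The test functions
  \<open>min ((n + 1) w) 1\<close> replace it: they increase to 1 where \<open>w > 0\<close>, and
  \<open>a_min_nonneg\<close> lets the energy term be dropped.\<close>

lemma penalized_mass:
  assumes \<kappa>: "no_charge \<kappa>" and pw: "penalized \<kappa> \<alpha> w"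
  shows "integrable m w" "\<alpha> * (\<integral>x. w x \<partial>m) \<le> measure \<kappa> UNIV"
proof -
  have sets_\<kappa> [measurable_cong]: "sets \<kappa> = sets borel" and "finite_measure \<kappa>"
    using \<kappa> by (auto simp: no_charge_def)
  interpret finite_measure \<kappa> by fact
  note \<alpha> = penalizedD(1)[OF pw] and w = penalizedD(2-4)[OF pw] and eq = penalizedD(5)[OF pw]
  have space: "space \<kappa> = UNIV" using sets_eq_imp_space_eq[OF sets_\<kappa>] by simp
  have [measurable]: "w \<in> borel_measurable borel" using w(1) by measurable
  define M where "M = measure \<kappa> UNIV"
  define v where "v n x = real (Suc n) * min (w x) (1 / Suc n)" for n x
  have vD: "v n \<in> D" for n
    using trunc_in[OF w(1), of "1 / Suc n"] w(3) unfolding v_def by (intro a.scale_in) (simp add: max_absorb1)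
  have v01: "0 \<le> v n x \<and> v n x \<le> 1" for n x
    using w(3)[of x] by (auto simp: v_def min_def field_simps)
  have vqc: "qc (v n)" for n unfolding v_def by (intro qc_scale qc_min w(2))
  have [measurable]: "v n \<in> borel_measurable borel" for n using vD by measurable
  have vK: "v n \<in> L2 \<kappa>" "integrable \<kappa> (v n)" for n using v01 by (auto intro!: bounded_L2[where c = 1])
  have wK: "w \<in> L2 \<kappa>" using w(3) by (auto intro!: bounded_L2[where c = 1])
  have le: "\<alpha> * (\<integral>x. w x * v n x \<partial>m) \<le> M" for n
  proof -
    have "a (v n) w = real (Suc n) * a (\<lambda>x. min (w x) (1 / Suc n)) w"
      unfolding v_def using trunc_in[OF w(1), of "1 / Suc n"] w(3) w(1)
      by (intro a.b_scale) (simp_all add: max_absorb1)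
    then have "0 \<le> a w (v n)"
      using a_min_nonneg[OF w(1), of "1 / Suc n"] w(3) a.b_sym[OF w(1) vD] by simp
    moreover have "0 \<le> (\<integral>x. w x * v n x \<partial>\<kappa>)" using w(3) v01 by (intro Bochner_Integration.integral_nonneg) simp
    moreover have "(\<integral>x. v n x \<partial>\<kappa>) \<le> (\<integral>x. 1 \<partial>\<kappa>)" using vK v01 by (intro integral_mono) auto
    ultimately show ?thesis using eq[OF vD vqc vK(1), of n] by (simp add: M_def space)
  qed
  have "integrable m (\<lambda>x. \<alpha> * w x) \<and> (\<integral>x. \<alpha> * w x \<partial>m) \<le> M"
  proof (rule integral_Fatou[where f = "\<lambda>n x. \<alpha> * (w x * v n x)"])
    show "integrable m (\<lambda>x. \<alpha> * (w x * v n x))" for n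
      by (intro integrable_mult_right L2_mult_integrable D_L2 w(1) vD)
    show "AE x in m. 0 \<le> \<alpha> * (w x * v n x)" for n using \<alpha> w(3) v01 by simp
    have "(\<lambda>n. \<alpha> * (w x * v n x)) \<longlonglongrightarrow> \<alpha> * w x" for x
    proof (cases "w x = 0")
      case False
      then have pos: "0 < w x" using w(3)[of x] by simp
      obtain N where N: "1 / real (Suc N) < w x" using reals_Archimedean[OF pos] by (auto simp: inverse_eq_divide)
      have "v n x = 1" if "n \<ge> N" for n
      proof -
        have "1 / real (Suc n) \<le> 1 / real (Suc N)" using that by (simp add: frac_le)
        then have "min (w x) (1 / Suc n) = 1 / Suc n" using N by simp
        then show ?thesis by (simp add: v_def)
      qed
      then show ?thesis
        by (intro tendsto_eventually, unfold eventually_sequentially, intro exI[of _ N]) simp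
    qed simp
    then show "AE x in m. (\<lambda>n. \<alpha> * (w x * v n x)) \<longlonglongrightarrow> \<alpha> * w x" by simp
    show "(\<integral>x. \<alpha> * (w x * v n x) \<partial>m) \<le> M" if "0 \<le> n" for n using le[of n] by simp
  qed measurable
  then show "integrable m w" "\<alpha> * (\<integral>x. w x \<partial>m) \<le> measure \<kappa> UNIV" using \<alpha> by (simp_all add: M_def)
qed

section \<open>Iteration of the penalized problem\<close>

definition step :: "'a measure \<Rightarrow> real \<Rightarrow> real \<times> ('a \<Rightarrow> real)" where
  "step \<kappa> \<epsilon> = (SOME p. penalized \<kappa> (fst p) (snd p) \<and> (\<integral>x. snd p x \<partial>\<kappa>) \<le> \<epsilon>)"

lemma step:
  assumes "no_charge \<kappa>" "0 < \<epsilon>"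
  shows "penalized \<kappa> (fst (step \<kappa> \<epsilon>)) (snd (step \<kappa> \<epsilon>)) \<and> (\<integral>x. snd (step \<kappa> \<epsilon>) x \<partial>\<kappa>) \<le> \<epsilon>"
  unfolding step_def by (rule someI_ex) (use penalized_small[OF assms] in auto)

text \<open>The tolerance \<open>(1/4)^k\<close> bounds mass and energy; its square root
  \<open>(1/2)^k\<close> is summable too, as the energy norms require.\<close>

primrec remainder :: "'a measure \<Rightarrow> nat \<Rightarrow> 'a measure" where
  "remainder \<kappa> 0 = \<kappa>"
| "remainder \<kappa> (Suc k) = density (remainder \<kappa> k) (\<lambda>x. ennreal (snd (step (remainder \<kappa> k) ((1/4)^k)) x))"

lemma no_charge_density:
  assumes "no_charge \<kappa>" "w \<in> D" "\<And>x. 0 \<le> w x \<and> w x \<le> 1"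
  shows "no_charge (density \<kappa> (\<lambda>x. ennreal (w x)))"
    "measure (density \<kappa> (\<lambda>x. ennreal (w x))) UNIV = (\<integral>x. w x \<partial>\<kappa>)"
proof -
  have sets_\<kappa> [measurable_cong]: "sets \<kappa> = sets borel" and "finite_measure \<kappa>"
    using assms(1) by (auto simp: no_charge_def)
  interpret finite_measure \<kappa> by fact
  have space: "space \<kappa> = UNIV" using sets_eq_imp_space_eq[OF sets_\<kappa>] by simp
  have [measurable]: "w \<in> borel_measurable borel" using assms(2) by measurable
  have int: "integrable \<kappa> w" using assms(3) by (auto intro!: bounded_L2[where c = 1])
  have em: "emeasure (density \<kappa> (\<lambda>x. ennreal (w x))) UNIV = ennreal (\<integral>x. w x \<partial>\<kappa>)"
    using nn_integral_eq_integral[OF int] assms(3) sets.top[of \<kappa>] by (simp add: emeasure_density space)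
  then show "measure (density \<kappa> (\<lambda>x. ennreal (w x))) UNIV = (\<integral>x. w x \<partial>\<kappa>)"
    using assms(3) by (simp add: measure_def)
  have "finite_measure (density \<kappa> (\<lambda>x. ennreal (w x)))"
    by (rule finite_measureI) (use em in \<open>simp add: space\<close>)
  moreover have "emeasure (density \<kappa> (\<lambda>x. ennreal (w x))) B = 0" if "B \<in> sets borel" "exc B" for B
  proof -
    have "AE x in \<kappa>. ennreal (w x) * indicator B x = 0"
      using no_charge_AE[OF assms(1) that(2)] by eventually_elim simp
    then show ?thesis using that(1) by (subst emeasure_density) (auto simp: sets_\<kappa> nn_integral_0_iff_AE)
  qed
  ultimately show "no_charge (density \<kappa> (\<lambda>x. ennreal (w x)))"
    by (simp add: no_charge_def sets_\<kappa>)
qed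

text \<open>The penalized equation for step \<open>k\<close> is the difference of two consecutive
  remainders, so the sum telescopes, and bounded test functions see the last remainder vanish. The
  functional is expressed by the Cauchy sequence \<open>W\<close> because the sum of the
  \<open>w k\<close> need not lie in \<open>D\<close>.\<close>

theorem decomposition_positive:
  assumes \<kappa>: "no_charge \<kappa>"
  shows "\<exists>f W. integrable m f \<and> (\<forall>n. W n \<in> D) \<and> form_Cauchy a W \<and>
    (\<forall>v\<in>D. qc v \<longrightarrow> (\<exists>c. \<forall>x. \<bar>v x\<bar> \<le> c) \<longrightarrow>
       (\<lambda>n. a (W n) v) \<longlonglongrightarrow> (\<integral>x. v x \<partial>\<kappa>) - (\<integral>x. f x * v x \<partial>m))"
proof -
  define R where "R = remainder \<kappa>"
  define \<alpha> where "\<alpha> k = fst (step (R k) ((1/4)^k))" for k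
  define w where "w k = snd (step (R k) ((1/4)^k))" for k
  have R0: "R 0 = \<kappa>" and RS: "R (Suc k) = density (R k) (\<lambda>x. ennreal (w k x))" for k
    by (simp_all add: R_def w_def)
  have st: "penalized (R k) (\<alpha> k) (w k) \<and> (\<integral>x. w k x \<partial>R k) \<le> (1/4)^k" if "no_charge (R k)" for k
    unfolding \<alpha>_def w_def by (rule step[OF that]) simp
  have R: "no_charge (R k)" for k
  proof (induction k)
    case (Suc k)
    then show ?case unfolding RS
      using st[OF Suc] by (intro no_charge_density) (auto simp: penalized_def)
  qed (use \<kappa> R0 in simp)
  note pw = st[OF R, THEN conjunct1] and w_small = st[OF R, THEN conjunct2]
  note \<alpha>_pos = penalizedD(1)[OF pw] and wD = penalizedD(2)[OF pw] and wqc = penalizedD(3)[OF pw]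
    and w01 = penalizedD(4)[OF pw] and w_eq = penalizedD(5)[OF pw]
  have sets_R [measurable_cong]: "sets (R k) = sets borel" and fin_R: "finite_measure (R k)" for k
    using R[of k] by (auto simp: no_charge_def)
  have space_R: "space (R k) = UNIV" for k using sets_eq_imp_space_eq[OF sets_R] by simp
  have [measurable]: "w k \<in> borel_measurable borel" for k using wD by measurable
  have mass_S: "measure (R (Suc k)) UNIV \<le> (1/4)^k" for k
    unfolding RS using no_charge_density(2)[OF R wD w01] w_small[of k] by simp
  define f where "f k x = \<alpha> k * w k x" for k x
  have f_int: "integrable m (f k)" and f_mass: "(\<integral>x. \<bar>f k x\<bar> \<partial>m) \<le> measure (R k) UNIV" for k
  proof -
    note pm = penalized_mass[OF R pw, of k]
    show "integrable m (f k)" using pm(1) by (simp add: f_def[abs_def])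
    have "\<bar>f k x\<bar> = \<alpha> k * w k x" for x using \<alpha>_pos[of k] w01[of k x] by (simp add: f_def)
    then show "(\<integral>x. \<bar>f k x\<bar> \<partial>m) \<le> measure (R k) UNIV" using pm(2) by simp
  qed
  \<comment> \<open>The mass of \<open>R 0 = \<kappa>\<close> is arbitrary; the geometric bound
    holds from index 1 on.\<close>
  have f_summable: "summable (\<lambda>k. \<integral>x. \<bar>f k x\<bar> \<partial>m)"
  proof (subst summable_Suc_iff[symmetric], rule summable_comparison_test')
    show "summable (\<lambda>k. (1/4::real)^k)" by (simp add: summable_geometric)
    show "norm (\<integral>x. \<bar>f (Suc k) x\<bar> \<partial>m) \<le> (1/4)^k" for k
      using f_mass[of "Suc k"] mass_S[of k] by simp
  qed
  have f_AE: "AE x in m. summable (\<lambda>k. \<bar>f k x\<bar>)" by (rule AE_summable_norm[OF f_int f_summable])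
  define F where "F x = (\<Sum>k. f k x)" for x
  have F_int: "integrable m F" unfolding F_def
    by (rule integrable_suminf[OF f_int]) (use f_AE f_summable in auto)
  define W where "W n x = (\<Sum>k<n. w k x)" for n x
  have WD: "W n \<in> D" for n unfolding W_def by (intro a.sum_in wD)
  have a_small: "a.nb (w k) \<le> (1/2)^k" for k
  proof -
    interpret finite_measure "R k" by (rule fin_R)
    have "w k \<in> L2 (R k)" using w01 by (auto intro!: bounded_L2[where c = 1])
    then have eq: "a (w k) (w k) + \<alpha> k * (\<integral>x. w k x * w k x \<partial>m) + (\<integral>x. w k x * w k x \<partial>R k) = (\<integral>x. w k x \<partial>R k)"
      by (rule w_eq[OF wD wqc])
    have "0 \<le> \<alpha> k * (\<integral>x. w k x * w k x \<partial>m)" "0 \<le> (\<integral>x. w k x * w k x \<partial>R k)"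
      using \<alpha>_pos[of k] by simp_all
    then have "a (w k) (w k) \<le> (1/4)^k" using eq w_small[of k] by linarith
    also have "\<dots> = ((1/2)^k)\<^sup>2" by (simp add: power2_eq_square flip: power_mult_distrib)
    finally show ?thesis unfolding a.nb_def by (intro real_le_lsqrt) auto
  qed
  have "form_Cauchy a W"
    unfolding a.form_Cauchy_iff
  proof (intro allI impI)
    fix \<epsilon> :: real assume "0 < \<epsilon>"
    have s: "summable (\<lambda>k. (1/2::real)^k)" by (simp add: summable_geometric)
    then obtain N where N: "\<And>i j. i \<ge> N \<Longrightarrow> norm (sum (\<lambda>k. (1/2::real)^k) {i..<j}) < \<epsilon>"
      using \<open>0 < \<epsilon>\<close> unfolding summable_Cauchy by blast
    have le: "a.nb (\<lambda>x. W j x - W i x) < \<epsilon>" if "i \<ge> N" "i \<le> j" for i j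
    proof -
      have "(\<lambda>x. W j x - W i x) = (\<lambda>x. \<Sum>k\<in>{i..<j}. w k x)"
        using that(2) by (simp add: W_def fun_eq_iff sum_diff_nat_ivl lessThan_atLeast0)
      then have "a.nb (\<lambda>x. W j x - W i x) \<le> (\<Sum>k\<in>{i..<j}. a.nb (w k))" using a.nb_sum[of "{i..<j}" w] wD by simp
      also have "\<dots> \<le> (\<Sum>k\<in>{i..<j}. (1/2)^k)" by (rule sum_mono) (rule a_small)
      also have "\<dots> < \<epsilon>" using N[OF that(1), of j] by simp
      finally show ?thesis .
    qed
    have "a.nb (\<lambda>x. W i x - W j x) < \<epsilon>" if "i \<ge> N" "j \<ge> N" for i j
      using le[of i j] le[of j i] that a.nb_diff_commute[OF WD WD, of i j] by (cases "i \<le> j") auto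
    then show "\<exists>N. \<forall>i\<ge>N. \<forall>j\<ge>N. a.nb (\<lambda>x. W i x - W j x) < \<epsilon>" by blast
  qed
  moreover have "(\<lambda>n. a (W n) v) \<longlonglongrightarrow> (\<integral>x. v x \<partial>\<kappa>) - (\<integral>x. F x * v x \<partial>m)"
    if v: "v \<in> D" "qc v" "\<And>x. \<bar>v x\<bar> \<le> c" for v c
  proof -
    have [measurable]: "v \<in> borel_measurable borel" using v(1) by measurable
    have c: "0 \<le> c" using v(3)[of undefined] by linarith
    have vR: "v \<in> L2 (R k)" "integrable (R k) v" for k
      by (rule finite_measure.bounded_L2[OF fin_R _ v(3)], measurable)+
    have one: "(\<integral>x. v x \<partial>R k) - (\<integral>x. v x \<partial>R (Suc k)) = a (w k) v + (\<integral>x. f k x * v x \<partial>m)" for k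
    proof -
      have "(\<integral>x. v x \<partial>R (Suc k)) = (\<integral>x. w k x * v x \<partial>R k)"
        unfolding RS using w01 by (subst integral_density) auto
      moreover have "(\<integral>x. f k x * v x \<partial>m) = \<alpha> k * (\<integral>x. w k x * v x \<partial>m)" by (simp add: f_def mult.assoc)
      ultimately show ?thesis using w_eq[OF v(1,2) vR(1), of k] by simp
    qed
    have sum_eq: "(\<integral>x. v x \<partial>\<kappa>) - (\<integral>x. v x \<partial>R n) = a (W n) v + (\<Sum>k<n. \<integral>x. f k x * v x \<partial>m)" for n
    proof -
      have "(\<integral>x. v x \<partial>\<kappa>) - (\<integral>x. v x \<partial>R n) = (\<Sum>k<n. (\<integral>x. v x \<partial>R k) - (\<integral>x. v x \<partial>R (Suc k)))"
        by (subst sum_lessThan_telescope') (simp add: R0)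
      also have "\<dots> = (\<Sum>k<n. a (w k) v) + (\<Sum>k<n. \<integral>x. f k x * v x \<partial>m)"
        by (simp add: one sum.distrib)
      also have "(\<Sum>k<n. a (w k) v) = a (W n) v" unfolding W_def using a.b_sum[of "{..<n}" w v] wD v(1) by simp
      finally show ?thesis .
    qed
    have R_lim: "(\<lambda>n. \<integral>x. v x \<partial>R n) \<longlonglongrightarrow> 0"
    proof (rule LIMSEQ_imp_Suc, rule Lim_null_comparison)
      have "\<bar>\<integral>x. v x \<partial>R (Suc n)\<bar> \<le> c * (1/4)^n" for n
      proof -
        interpret finite_measure "R (Suc n)" by (rule fin_R)
        have "\<bar>\<integral>x. v x \<partial>R (Suc n)\<bar> \<le> (\<integral>x. \<bar>v x\<bar> \<partial>R (Suc n))" by (rule integral_abs_bound)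
        also have "\<dots> \<le> (\<integral>x. c \<partial>R (Suc n))" using vR(2)[of "Suc n"] v(3) by (intro integral_mono) auto
        also have "\<dots> = c * measure (R (Suc n)) UNIV" by (simp add: space_R)
        also have "\<dots> \<le> c * (1/4)^n" using mass_S c by (intro mult_left_mono)
        finally show ?thesis .
      qed
      then show "\<forall>\<^sub>F n in sequentially. norm (\<integral>x. v x \<partial>R (Suc n)) \<le> c * (1/4)^n" by simp
      show "(\<lambda>n. c * (1/4)^n) \<longlonglongrightarrow> 0" by (intro tendsto_mult_right_zero LIMSEQ_power_zero) simp
    qed
    have f_lim: "(\<lambda>n. \<Sum>k<n. \<integral>x. f k x * v x \<partial>m) \<longlonglongrightarrow> (\<integral>x. F x * v x \<partial>m)"
    proof -
      have fv_le: "norm (f k x * v x) \<le> c * \<bar>f k x\<bar>" for k x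
        using mult_left_mono[OF v(3)[of x], of "\<bar>f k x\<bar>"] by (simp add: abs_mult mult.commute)
      have fv_int: "integrable m (\<lambda>x. f k x * v x)" for k
        by (rule integrable_mult_bounded[OF f_int _ v(3)]) measurable
      have "(\<lambda>k. \<integral>x. f k x * v x \<partial>m) sums (\<integral>x. (\<Sum>k. f k x * v x) \<partial>m)"
      proof (rule sums_integral[OF fv_int])
        show "AE x in m. summable (\<lambda>k. norm (f k x * v x))"
          using f_AE
        proof eventually_elim
          case (elim x)
          show ?case by (rule summable_comparison_test'[OF summable_mult[OF elim, of c]]) (use fv_le in simp)
        qed
        show "summable (\<lambda>k. \<integral>x. norm (f k x * v x) \<partial>m)"
        proof (rule summable_comparison_test'[OF summable_mult[OF f_summable, of c]])
          have "(\<integral>x. norm (f k x * v x) \<partial>m) \<le> (\<integral>x. c * \<bar>f k x\<bar> \<partial>m)" for k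
            using fv_int f_int fv_le by (intro integral_mono) auto
          then show "norm (\<integral>x. norm (f k x * v x) \<partial>m) \<le> c * (\<integral>x. \<bar>f k x\<bar> \<partial>m)" for k by simp
        qed
      qed
      moreover have "(\<integral>x. (\<Sum>k. f k x * v x) \<partial>m) = (\<integral>x. F x * v x \<partial>m)"
      proof (rule integral_cong_AE)
        show "AE x in m. (\<Sum>k. f k x * v x) = F x * v x"
          using f_AE by eventually_elim (simp add: F_def suminf_mult2[symmetric] summable_rabs_cancel)
      qed (auto simp: F_def f_def)
      ultimately show ?thesis by (simp add: sums_def)
    qed
    have "a (W n) v = (\<integral>x. v x \<partial>\<kappa>) - (\<integral>x. v x \<partial>R n) - (\<Sum>k<n. \<integral>x. f k x * v x \<partial>m)" for n
      using sum_eq[of n] by simp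
    moreover have "(\<lambda>n. (\<integral>x. v x \<partial>\<kappa>) - (\<integral>x. v x \<partial>R n) - (\<Sum>k<n. \<integral>x. f k x * v x \<partial>m))
       \<longlonglongrightarrow> (\<integral>x. v x \<partial>\<kappa>) - 0 - (\<integral>x. F x * v x \<partial>m)"
      by (intro tendsto_intros R_lim f_lim)
    ultimately show ?thesis by simp
  qed
  ultimately show ?thesis using F_int WD by (intro exI[of _ F] exI[of _ W]) auto
qed

end

section \<open>The extended Dirichlet space\<close>

lemma abs_mid_le:
  fixes x y :: real
  assumes "\<bar>x - l\<bar> \<le> c" "\<bar>y - l\<bar> \<le> c"
  shows "\<bar>(x + y) / 2 - l\<bar> \<le> c"
proof -
  have "x \<le> l + c" "l - c \<le> x" "y \<le> l + c" "l - c \<le> y" using assms by linarith+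
  then show ?thesis by (intro abs_leI) (simp_all add: field_simps)
qed

context quasi_regular_form
begin

abbreviation "F\<^sub>e \<equiv> extended_domain m a D"

lemma approximating_iff:
  "approximating m a D u un \<longleftrightarrow> (\<forall>n. un n \<in> D) \<and> form_Cauchy a un \<and> (AE x in m. (\<lambda>n. un n x) \<longlonglongrightarrow> u x)"
  by (simp add: approximating_def form_Cauchy_def sym_part_def)

lemma approximating_D: "approximating m a D u un \<Longrightarrow> un n \<in> D"
  and approximating_Cauchy: "approximating m a D u un \<Longrightarrow> form_Cauchy a un"
  and approximating_AE: "approximating m a D u un \<Longrightarrow> AE x in m. (\<lambda>n. un n x) \<longlonglongrightarrow> u x"
  by (simp_all add: approximating_iff)

lemma F_measurable: "u \<in> F\<^sub>e \<Longrightarrow> u \<in> borel_measurable borel"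
  unfolding extended_domain_def using measurable_cong_sets[OF sets_m refl] by blast

lemma F_I: "u \<in> borel_measurable borel \<Longrightarrow> approximating m a D u un \<Longrightarrow> u \<in> F\<^sub>e"
  unfolding extended_domain_def using measurable_cong_sets[OF sets_m refl] by blast

lemma F_E: "u \<in> F\<^sub>e \<Longrightarrow> \<exists>un. approximating m a D u un"
  unfolding extended_domain_def by blast

lemma approximating_lincomb:
  assumes "approximating m a D u un" "approximating m a D v vn"
  shows "approximating m a D (\<lambda>x. s * u x + t * v x) (\<lambda>n x. s * un n x + t * vn n x)"
  unfolding approximating_iff
proof (intro conjI allI)
  show "form_Cauchy a (\<lambda>n x. s * un n x + t * vn n x)"
    using assms by (intro a.Cauchy_lincomb) (simp_all add: approximating_iff)
  show "AE x in m. (\<lambda>n. s * un n x + t * vn n x) \<longlonglongrightarrow> s * u x + t * v x"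
    using approximating_AE[OF assms(1)] approximating_AE[OF assms(2)]
    by eventually_elim (intro tendsto_intros)
qed (use assms in \<open>simp add: a.lincomb_in approximating_iff\<close>)

text \<open>The difference of the two sequences approximates 0, so closability applies.\<close>

lemma approximating_unique:
  assumes "approximating m a D u un" "approximating m a D u vn"
  shows "(\<lambda>n. a.nb (\<lambda>x. un n x - vn n x)) \<longlonglongrightarrow> 0"
proof (rule closable)
  have "approximating m a D (\<lambda>x. 1 * u x + (-1) * u x) (\<lambda>n x. 1 * un n x + (-1) * vn n x)"
    by (rule approximating_lincomb[OF assms])
  then show "form_Cauchy a (\<lambda>n x. un n x - vn n x)" "AE x in m. (\<lambda>n. un n x - vn n x) \<longlonglongrightarrow> 0"
    "(\<lambda>x. un n x - vn n x) \<in> D" for n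
    by (simp_all add: approximating_iff)
qed

lemma Cauchy_nb_convergent:
  assumes "\<And>n. un n \<in> D" "form_Cauchy a un"
  shows "convergent (\<lambda>n. a.nb (un n))"
proof (rule Cauchy_convergent, rule metric_CauchyI)
  fix e :: real assume "0 < e"
  then obtain N where N: "\<And>i j. i \<ge> N \<Longrightarrow> j \<ge> N \<Longrightarrow> a.nb (\<lambda>x. un i x - un j x) < e"
    using assms(2) unfolding a.form_Cauchy_iff by meson
  have "dist (a.nb (un i)) (a.nb (un j)) < e" if "i \<ge> N" "j \<ge> N" for i j
    using a.nb_triangle[OF assms(1,1), of i j] a.nb_triangle[OF assms(1,1), of j i] N[OF that] N[OF that(2,1)]
    by (simp add: dist_real_def)
  then show "\<exists>M. \<forall>i\<ge>M. \<forall>j\<ge>M. dist (a.nb (un i)) (a.nb (un j)) < e" by blast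
qed

text \<open>All approximating sequences share the limit of their energies, which justifies the
  definite description in \<open>extended_energy\<close>.\<close>

lemma extended_energy_tendsto:
  assumes "approximating m a D u un"
  shows "(\<lambda>n. a (un n) (un n)) \<longlonglongrightarrow> extended_energy m a D u"
proof -
  have sq: "(\<lambda>n. a (vn n) (vn n)) = (\<lambda>n. (a.nb (vn n))\<^sup>2)" if "approximating m a D u vn" for vn
    using a.nb_sq[OF approximating_D[OF that]] by simp
  obtain l where l: "(\<lambda>n. a.nb (un n)) \<longlonglongrightarrow> l"
    using Cauchy_nb_convergent assms unfolding convergent_def approximating_iff by blast
  have other: "(\<lambda>n. a.nb (vn n)) \<longlonglongrightarrow> l" if vn: "approximating m a D u vn" for vn
  proof -
    have "(\<lambda>n. a.nb (vn n) - a.nb (un n)) \<longlonglongrightarrow> 0"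
    proof (rule Lim_null_comparison[OF _ approximating_unique[OF vn assms]], rule always_eventually, rule allI)
      fix n
      note D = approximating_D[OF vn, of n] approximating_D[OF assms, of n]
      show "norm (a.nb (vn n) - a.nb (un n)) \<le> a.nb (\<lambda>x. vn n x - un n x)"
        using a.nb_triangle[OF D] a.nb_triangle[OF D(2,1)] a.nb_diff_commute[OF D] by simp
    qed
    from tendsto_add[OF this l] show ?thesis by simp
  qed
  have "extended_energy m a D u = l\<^sup>2"
    unfolding extended_energy_def
  proof (rule the_equality)
    show "\<exists>un. approximating m a D u un \<and> (\<lambda>n. a (un n) (un n)) \<longlonglongrightarrow> l\<^sup>2"
      using assms tendsto_power[OF l, of 2] sq[OF assms] by auto
    fix l' assume "\<exists>un. approximating m a D u un \<and> (\<lambda>n. a (un n) (un n)) \<longlonglongrightarrow> l'"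
    then obtain vn where vn: "approximating m a D u vn" "(\<lambda>n. a (vn n) (vn n)) \<longlonglongrightarrow> l'" by blast
    have "(\<lambda>n. a (vn n) (vn n)) \<longlonglongrightarrow> l\<^sup>2"
      unfolding sq[OF vn(1)] by (rule tendsto_power[OF other[OF vn(1)]])
    then show "l' = l\<^sup>2" using vn(2) LIMSEQ_unique by blast
  qed
  then show ?thesis unfolding sq[OF assms] using tendsto_power[OF l, of 2] by simp
qed

text \<open>The geometric rate yields convergence without passing to a subsequence; the index
  \<open>N\<close> of \<open>AE_uniformly_small\<close> is a dummy here.\<close>

lemma close_AE_limit:
  assumes [measurable]: "\<And>k. v k \<in> borel_measurable borel" "u \<in> borel_measurable borel"
    and c: "\<And>k. close (v k) u ((1/2)^k)"
  shows "AE x in m. (\<lambda>k. v k x) \<longlonglongrightarrow> u x"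
proof -
  have "AE x in m. \<forall>\<epsilon>>0. \<exists>K. \<forall>k\<ge>K. \<forall>N::nat. \<bar>v k x - u x\<bar> * \<rho> x \<le> \<epsilon>"
  proof (rule AE_uniformly_small[where B = 1 and f = "\<lambda>k N x. \<bar>v k x - u x\<bar> * \<rho> x"])
    fix k N :: nat
    have "(\<integral>\<^sup>+x. ennreal (\<bar>v k x - u x\<bar> * \<rho> x) \<partial>m) = ennreal (\<integral>x. \<bar>v k x - u x\<bar> * \<rho> x \<partial>m)"
      by (rule nn_integral_eq_integral) (use c rho_pos in \<open>auto simp: close_def elim!: eventually_mono\<close>)
    also have "\<dots> \<le> ennreal (1 * (1/2)^k)" using c by (intro ennreal_leI) (simp add: close_def)
    finally show "(\<integral>\<^sup>+x. ennreal (\<bar>v k x - u x\<bar> * \<rho> x) \<partial>m) \<le> ennreal (1 * (1/2)^k)" .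
  next
    show "(\<lambda>x. \<bar>v k x - u x\<bar> * \<rho> x) \<in> borel_measurable m" for k by measurable
  qed simp_all
  then show ?thesis using rho_pos
  proof eventually_elim
    case (elim x)
    show ?case
    proof (rule LIMSEQ_I)
      fix r :: real assume "0 < r"
      then have "0 < r * \<rho> x / 2" using elim(2) by simp
      then obtain K where K: "\<And>k. k \<ge> K \<Longrightarrow> \<bar>v k x - u x\<bar> * \<rho> x \<le> r * \<rho> x / 2" using elim(1) by blast
      have "norm (v k x - u x) < r" if "k \<ge> K" for k
      proof -
        have "\<bar>v k x - u x\<bar> * \<rho> x \<le> (r / 2) * \<rho> x" using K[OF that] by simp
        then have "\<bar>v k x - u x\<bar> \<le> r / 2" using elim(2) by (simp only: mult_le_cancel_right_pos)
        then show ?thesis using \<open>0 < r\<close> by simp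
      qed
      then show "\<exists>K. \<forall>k\<ge>K. norm (v k x - u x) < r" by blast
    qed
  qed
qed

text \<open>The elements given by the last hypothesis need not form a Cauchy sequence; convexity repairs
  this.\<close>

lemma approximating_in_convex:
  assumes u [measurable]: "u \<in> borel_measurable borel"
    and S: "\<And>k. S k \<subseteq> D" "\<And>k. S (Suc k) \<subseteq> S k"
      "\<And>k u v. u \<in> S k \<Longrightarrow> v \<in> S k \<Longrightarrow> (\<lambda>x. (u x + v x) / 2) \<in> S k"
    and ex: "\<And>k. \<exists>v\<in>S k. a.nb v \<le> M \<and> close v u ((1/2)^k)"
  shows "\<exists>v. (\<forall>k. v k \<in> S k \<and> a.nb (v k) \<le> M) \<and> approximating m a D u v"
proof -
  define C where "C k = {v \<in> S k. a.nb v \<le> M \<and> close v u ((1/2)^k)}" for k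
  have CD: "v \<in> D" if "v \<in> C k" for v k using S(1) that by (auto simp: C_def)
  have a_M: "a v v \<le> M\<^sup>2" if "v \<in> D" "a.nb v \<le> M" for v
    using power_mono[OF that(2) a.nb_nonneg[OF that(1)], of 2] a.nb_sq[OF that(1)] by simp
  have "\<exists>v. (\<forall>k. v k \<in> C k) \<and> form_Cauchy a v"
  proof (rule a.convex_Cauchy)
    show "C k \<subseteq> D" for k using CD by blast
    have "(1/2::real)^Suc k \<le> (1/2)^k" for k by simp
    then show "C (Suc k) \<subseteq> C k" for k unfolding C_def using S(2) close_mono by blast
    show "\<exists>v\<in>C k. a v v \<le> M\<^sup>2" for k
    proof -
      obtain v where "v \<in> C k" using ex[of k] by (auto simp: C_def)
      then show ?thesis using a_M[OF CD] by (intro bexI[of _ v]) (auto simp: C_def)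
    qed
    show "(\<lambda>x. (y x + z x) / 2) \<in> C k" if yz: "y \<in> C k" "z \<in> C k" for k y z
    proof -
      note D = CD[OF yz(1)] CD[OF yz(2)]
      have "a.nb y \<le> M" "a.nb z \<le> M" using yz by (auto simp: C_def)
      then have "a.nb (\<lambda>x. (y x + z x) / 2) \<le> M"
        using a.b_mid_le[OF D a_M[OF D(1)] a_M[OF D(2)]] order_trans[OF a.nb_nonneg[OF D(1)]]
        unfolding a.nb_def[of "\<lambda>x. (y x + z x) / 2"] by (intro real_le_lsqrt) auto
      then show ?thesis using S(3) yz D u by (auto simp: C_def intro!: close_mid)
    qed
  qed
  then obtain v where v: "\<And>k. v k \<in> C k" "form_Cauchy a v" by blast
  have vD: "v k \<in> D" for k using CD[OF v(1)] .
  have "AE x in m. (\<lambda>k. v k x) \<longlonglongrightarrow> u x"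
    using v(1) vD by (intro close_AE_limit) (auto simp: C_def)
  then have "approximating m a D u v" using v vD by (simp add: approximating_iff)
  then show ?thesis using v(1) by (auto simp: C_def)
qed

abbreviation clip :: "real \<Rightarrow> real \<Rightarrow> real" where
  "clip c y \<equiv> max (- c) (min y c)"

lemma clip_lipschitz: "\<bar>clip c y - clip c z\<bar> \<le> \<bar>y - z\<bar>"
  by (auto simp: min_def max_def)

lemma clip_bounded: "0 \<le> c \<Longrightarrow> \<bar>clip c y\<bar> \<le> c"
  by (auto simp: min_def max_def)

lemma clip_tendsto: "(\<lambda>n. clip (real (Suc n)) y) \<longlonglongrightarrow> y"
proof (rule tendsto_eventually)
  obtain N where N: "\<bar>y\<bar> \<le> real N" using real_arch_simple by blast
  have "clip (real (Suc n)) y = y" if "N \<le> n" for n using N that by linarith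
  then show "\<forall>\<^sub>F n in sequentially. clip (real (Suc n)) y = y"
    unfolding eventually_sequentially by blast
qed

text \<open>Clipping quasi-continuous versions of the \<open>un\<close> gives functions close to the
  clip of \<open>u\<close> in the weighted L1 norm, with energy norm at most \<open>2 * M\<close>,
  but not a Cauchy sequence. \<open>approximating_in_convex\<close> repairs this, as the constraints
  survive midpoints.\<close>

lemma clip_approximating:
  assumes u: "u \<in> F\<^sub>e" "approximating m a D u un" "\<And>n. a.nb (un n) \<le> M" and "0 < c"
  shows "\<exists>v. (\<forall>k. v k \<in> D \<and> qc (v k) \<and> (\<forall>x. \<bar>v k x\<bar> \<le> c) \<and> a.nb (v k) \<le> 2 * M) \<and>
     approximating m a D (\<lambda>x. clip c (u x)) v"
proof -
  have um [measurable]: "u \<in> borel_measurable borel" by (rule F_measurable[OF u(1)])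
  define S where "S = {v \<in> D. qc v \<and> (\<forall>x. \<bar>v x\<bar> \<le> c)}"
  have "\<exists>v. (\<forall>k. v k \<in> S \<and> a.nb (v k) \<le> 2 * M) \<and> approximating m a D (\<lambda>x. clip c (u x)) v"
  proof (rule approximating_in_convex)
    show "(\<lambda>x. (y x + z x) / 2) \<in> S" if "y \<in> S" "z \<in> S" for y z
    proof -
      have "\<bar>(y x + z x) / 2\<bar> \<le> c" for x
      proof -
        have "\<bar>y x\<bar> \<le> c" "\<bar>z x\<bar> \<le> c" using that by (auto simp: S_def)
        then show ?thesis using abs_mid_le[of "y x" 0 c "z x"] by simp
      qed
      moreover have "qc (\<lambda>x. (y x + z x) / 2)"
        using qc_lincomb[of y z "1/2" "1/2"] that by (simp add: S_def field_simps)
      ultimately show ?thesis using a.mid_in that by (simp add: S_def)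
    qed
    fix k :: nat
    obtain N where N: "close (un N) u ((1/2)^k)"
      using Cauchy_close_limit[OF approximating_D[OF u(2)] approximating_Cauchy[OF u(2)] um approximating_AE[OF u(2)], of "(1/2)^k"]
      by auto
    obtain z where z: "z \<in> D" "qc z" "AE x in m. z x = un N x" using qc_exists[OF approximating_D[OF u(2)], of N] by blast
    define v where "v x = clip c (z x)" for x
    have vD: "v \<in> D" unfolding v_def by (rule clip_in[OF z(1) \<open>0 < c\<close>])
    have "v \<in> S" using vD qc_clip[OF z(2)] clip_bounded \<open>0 < c\<close> by (simp add: S_def v_def[abs_def])
    moreover have "a.nb v \<le> 2 * M"
      using clip_le[OF z(1) \<open>0 < c\<close>] a_nb_cong[OF z(1) approximating_D[OF u(2)] z(3)] u(3)[of N]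
      by (simp add: v_def[abs_def])
    moreover have "AE x in m. \<bar>v x - clip c (u x)\<bar> \<le> \<bar>un N x - u x\<bar>"
      using z(3) by eventually_elim (simp add: v_def clip_lipschitz)
    then have "close v (\<lambda>x. clip c (u x)) ((1/2)^k)"
      by (rule close_contraction[OF D_measurable[OF vD] _ N, rotated]) measurable
    ultimately show "\<exists>v\<in>S. a.nb v \<le> 2 * M \<and> close v (\<lambda>x. clip c (u x)) ((1/2)^k)" by blast
  qed (auto simp: S_def)
  then show ?thesis by (auto simp: S_def)
qed

end

section \<open>The functional on the extended space\<close>

text \<open>\<open>\<kappa>1\<close> and \<open>\<kappa>2\<close> stand for the Jordan parts of a
  signed measure, \<open>f\<close> and \<open>W\<close> for the differences of the data obtained
  from each. Keeping the parts separate allows dominated convergence under each of them.\<close>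

locale decomposed_measure = quasi_regular_form m a D g
  for m :: "'a::metric_space measure" and a :: "'a form" and D :: "('a \<Rightarrow> real) set" and g +
  fixes \<kappa>1 \<kappa>2 :: "'a measure" and f :: "'a \<Rightarrow> real" and W :: "nat \<Rightarrow> 'a \<Rightarrow> real"
  assumes \<kappa>1: "no_charge \<kappa>1" and \<kappa>2: "no_charge \<kappa>2" and f_integrable: "integrable m f"
    and W_in: "\<And>n. W n \<in> D" and W_Cauchy: "form_Cauchy a W"
    and W_eq: "\<And>v. v \<in> D \<Longrightarrow> qc v \<Longrightarrow> \<exists>c. \<forall>x. \<bar>v x\<bar> \<le> c \<Longrightarrow>
       (\<lambda>n. a (W n) v) \<longlonglongrightarrow> (\<integral>x. v x \<partial>\<kappa>1) - (\<integral>x. v x \<partial>\<kappa>2) - (\<integral>x. f x * v x \<partial>m)"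
begin

lemma sets_\<kappa>1 [measurable_cong]: "sets \<kappa>1 = sets borel" and sets_\<kappa>2 [measurable_cong]: "sets \<kappa>2 = sets borel"
  and finite_\<kappa>1: "finite_measure \<kappa>1" and finite_\<kappa>2: "finite_measure \<kappa>2"
  using \<kappa>1 \<kappa>2 by (auto simp: no_charge_def)

lemma f_measurable [measurable]: "f \<in> borel_measurable borel"
  using borel_measurable_integrable[OF f_integrable] measurable_cong_sets[OF sets_m refl] by blast

text \<open>Formally the pairing of \<open>v\<close> with the energy limit of the
  \<open>W n\<close>; that limit may lie outside \<open>D\<close>, so the limit is taken after
  pairing.\<close>

definition \<Lambda> :: "('a \<Rightarrow> real) \<Rightarrow> real" where "\<Lambda> v = lim (\<lambda>n. a (W n) v)"

lemma \<Lambda>_tendsto: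
  assumes "v \<in> D"
  shows "(\<lambda>n. a (W n) v) \<longlonglongrightarrow> \<Lambda> v"
proof -
  have "Cauchy (\<lambda>n. a (W n) v)"
  proof (rule metric_CauchyI)
    fix e :: real assume "0 < e"
    define d where "d = e / (a.nb v + 1)"
    have d: "0 < d" using \<open>0 < e\<close> a.nb_nonneg[OF assms] by (simp add: d_def)
    then obtain N where N: "\<And>i j. i \<ge> N \<Longrightarrow> j \<ge> N \<Longrightarrow> a.nb (\<lambda>x. W i x - W j x) < d"
      using W_Cauchy unfolding a.form_Cauchy_iff by meson
    have "dist (a (W i) v) (a (W j) v) < e" if "i \<ge> N" "j \<ge> N" for i j
    proof -
      have "dist (a (W i) v) (a (W j) v) = \<bar>a (\<lambda>x. W i x - W j x) v\<bar>"
        using a.b_diff[OF W_in W_in assms] by (simp add: dist_real_def)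
      also have "\<dots> \<le> a.nb (\<lambda>x. W i x - W j x) * a.nb v"
        by (rule a.cauchy_schwarz[OF a.diff_in[OF W_in W_in] assms])
      also have "\<dots> \<le> d * a.nb v" using N[OF that] a.nb_nonneg[OF assms] by (intro mult_right_mono) auto
      also have "\<dots> < d * (a.nb v + 1)" using d by simp
      also have "\<dots> = e" using a.nb_nonneg[OF assms] by (simp add: d_def)
      finally show ?thesis .
    qed
    then show "\<exists>M. \<forall>i\<ge>M. \<forall>j\<ge>M. dist (a (W i) v) (a (W j) v) < e" by blast
  qed
  then show ?thesis unfolding \<Lambda>_def by (simp add: Cauchy_convergent convergent_LIMSEQ_iff[THEN iffD1])
qed

lemma \<Lambda>_eq:
  "v \<in> D \<Longrightarrow> qc v \<Longrightarrow> \<exists>c. \<forall>x. \<bar>v x\<bar> \<le> c \<Longrightarrow>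
    \<Lambda> v = (\<integral>x. v x \<partial>\<kappa>1) - (\<integral>x. v x \<partial>\<kappa>2) - (\<integral>x. f x * v x \<partial>m)"
  using LIMSEQ_unique[OF \<Lambda>_tendsto W_eq] .

lemma \<Lambda>_lincomb:
  assumes "u \<in> D" "v \<in> D"
  shows "\<Lambda> (\<lambda>x. s * u x + t * v x) = s * \<Lambda> u + t * \<Lambda> v"
proof (rule LIMSEQ_unique[OF \<Lambda>_tendsto])
  show "(\<lambda>x. s * u x + t * v x) \<in> D" by (rule a.lincomb_in[OF assms])
  show "(\<lambda>n. a (W n) (\<lambda>x. s * u x + t * v x)) \<longlonglongrightarrow> s * \<Lambda> u + t * \<Lambda> v"
    unfolding a.b_lincomb_right[OF assms W_in] by (intro tendsto_intros \<Lambda>_tendsto assms)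
qed

lemma \<Lambda>_bound: "\<exists>C\<ge>0. \<forall>v\<in>D. \<bar>\<Lambda> v\<bar> \<le> C * a.nb v"
proof -
  obtain C where C: "C \<ge> 0" "\<And>n. a.nb (W n) \<le> C" using a.Cauchy_bounded[OF W_in W_Cauchy] by blast
  have "\<bar>\<Lambda> v\<bar> \<le> C * a.nb v" if "v \<in> D" for v
  proof (rule LIMSEQ_le_const2[OF tendsto_rabs[OF \<Lambda>_tendsto[OF that]]], intro exI allI impI)
    show "\<bar>a (W n) v\<bar> \<le> C * a.nb v" for n
      using a.cauchy_schwarz[OF W_in that, of n] mult_right_mono[OF C(2)[of n] a.nb_nonneg[OF that]] by simp
  qed
  then show ?thesis using C(1) by blast
qed

lemma \<Lambda>_null:
  assumes "\<And>n. v n \<in> D" "(\<lambda>n. a.nb (v n)) \<longlonglongrightarrow> 0"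
  shows "(\<lambda>n. \<Lambda> (v n)) \<longlonglongrightarrow> 0"
proof -
  obtain C where C: "\<And>v. v \<in> D \<Longrightarrow> \<bar>\<Lambda> v\<bar> \<le> C * a.nb v" using \<Lambda>_bound by blast
  show ?thesis
    by (rule Lim_null_comparison[OF _ tendsto_mult_right_zero[OF assms(2), of C]]) (use C assms(1) in simp)
qed

text \<open>The continuous extension of \<open>\<Lambda>\<close> to the extended space; the chosen
  sequence is immaterial by \<open>\<L>_tendsto\<close>.\<close>

definition \<L> :: "('a \<Rightarrow> real) \<Rightarrow> real" where
  "\<L> u = lim (\<lambda>n. \<Lambda> ((SOME un. approximating m a D u un) n))"

lemma \<L>_tendsto:
  assumes "approximating m a D u un"
  shows "(\<lambda>n. \<Lambda> (un n)) \<longlonglongrightarrow> \<L> u"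
proof -
  define vn where "vn = (SOME un. approximating m a D u un)"
  have vn: "approximating m a D u vn" unfolding vn_def by (rule someI[of "approximating m a D u", OF assms])
  have vD: "vn n \<in> D" for n by (rule approximating_D[OF vn])
  obtain C where C: "0 \<le> C" "\<And>v. v \<in> D \<Longrightarrow> \<bar>\<Lambda> v\<bar> \<le> C * a.nb v" using \<Lambda>_bound by blast
  have "Cauchy (\<lambda>n. \<Lambda> (vn n))"
  proof (rule metric_CauchyI)
    fix e :: real assume "0 < e"
    define d where "d = e / (C + 1)"
    have "0 < d" using \<open>0 < e\<close> C(1) by (simp add: d_def)
    then obtain N where N: "\<And>i j. i \<ge> N \<Longrightarrow> j \<ge> N \<Longrightarrow> a.nb (\<lambda>x. vn i x - vn j x) < d"
      using approximating_Cauchy[OF vn] unfolding a.form_Cauchy_iff by meson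
    have "dist (\<Lambda> (vn i)) (\<Lambda> (vn j)) < e" if "i \<ge> N" "j \<ge> N" for i j
    proof -
      have "dist (\<Lambda> (vn i)) (\<Lambda> (vn j)) = \<bar>\<Lambda> (\<lambda>x. vn i x - vn j x)\<bar>"
        using \<Lambda>_lincomb[OF vD vD, of 1 i "-1" j] by (simp add: dist_real_def)
      also have "\<dots> \<le> C * a.nb (\<lambda>x. vn i x - vn j x)" by (rule C(2)[OF a.diff_in[OF vD vD]])
      also have "\<dots> \<le> C * d" using N[OF that] C(1) by (intro mult_left_mono) auto
      also have "\<dots> < (C + 1) * d" using \<open>0 < d\<close> by (simp add: distrib_right)
      also have "\<dots> = e" using C(1) by (simp add: d_def)
      finally show ?thesis .
    qed
    then show "\<exists>M. \<forall>i\<ge>M. \<forall>j\<ge>M. dist (\<Lambda> (vn i)) (\<Lambda> (vn j)) < e" by blast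
  qed
  then have lim: "(\<lambda>n. \<Lambda> (vn n)) \<longlonglongrightarrow> \<L> u"
    unfolding \<L>_def vn_def[symmetric] by (simp add: Cauchy_convergent convergent_LIMSEQ_iff[THEN iffD1])
  have "(\<lambda>n. \<Lambda> (\<lambda>x. un n x - vn n x)) \<longlonglongrightarrow> 0"
    by (rule \<Lambda>_null[OF a.diff_in approximating_unique[OF assms vn]]) (use approximating_D assms vn in auto)
  moreover have "\<Lambda> (\<lambda>x. un n x - vn n x) = \<Lambda> (un n) - \<Lambda> (vn n)" for n
    using \<Lambda>_lincomb[OF approximating_D[OF assms] vD, of 1 n "-1" n] by simp
  ultimately show ?thesis using tendsto_add[OF _ lim, of "\<lambda>n. \<Lambda> (un n) - \<Lambda> (vn n)" 0] by simp
qed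

lemma \<L>_lincomb:
  assumes "u \<in> F\<^sub>e" "v \<in> F\<^sub>e"
  shows "\<L> (\<lambda>x. s * u x + t * v x) = s * \<L> u + t * \<L> v"
proof -
  obtain un vn where n: "approximating m a D u un" "approximating m a D v vn" using assms F_E by meson
  have "(\<lambda>k. \<Lambda> (\<lambda>x. s * un k x + t * vn k x)) = (\<lambda>k. s * \<Lambda> (un k) + t * \<Lambda> (vn k))"
    by (intro ext \<Lambda>_lincomb approximating_D[OF n(1)] approximating_D[OF n(2)])
  then have "(\<lambda>k. s * \<Lambda> (un k) + t * \<Lambda> (vn k)) \<longlonglongrightarrow> \<L> (\<lambda>x. s * u x + t * v x)"
    using \<L>_tendsto[OF approximating_lincomb[OF n, of s t]] by simp
  moreover have "(\<lambda>k. s * \<Lambda> (un k) + t * \<Lambda> (vn k)) \<longlonglongrightarrow> s * \<L> u + t * \<L> v"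
    by (intro tendsto_intros \<L>_tendsto n)
  ultimately show ?thesis by (rule LIMSEQ_unique)
qed

lemma \<L>_dual: "\<L> \<in> extended_dual m a D"
  unfolding extended_dual_def
proof (intro CollectI conjI ballI allI)
  show "\<L> (\<lambda>x. u x + v x) = \<L> u + \<L> v" if "u \<in> F\<^sub>e" "v \<in> F\<^sub>e" for u v
    using \<L>_lincomb[OF that, of 1 1] by simp
  show "\<L> (\<lambda>x. c * u x) = c * \<L> u" if "u \<in> F\<^sub>e" for c u
    using \<L>_lincomb[OF that that, of c 0] by simp
  obtain C where C: "\<And>v. v \<in> D \<Longrightarrow> \<bar>\<Lambda> v\<bar> \<le> C * a.nb v" using \<Lambda>_bound by blast
  have "\<bar>\<L> u\<bar> \<le> C * sqrt (extended_energy m a D u)" if "u \<in> F\<^sub>e" for u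
  proof -
    obtain un where un: "approximating m a D u un" using F_E[OF \<open>u \<in> F\<^sub>e\<close>] by blast
    show ?thesis
    proof (rule LIMSEQ_le[OF tendsto_rabs[OF \<L>_tendsto[OF un]]])
      show "(\<lambda>n. C * a.nb (un n)) \<longlonglongrightarrow> C * sqrt (extended_energy m a D u)"
        unfolding a.nb_def by (intro tendsto_intros extended_energy_tendsto[OF un])
    qed (use C approximating_D[OF un] in blast)
  qed
  then show "\<exists>C. \<forall>u\<in>F\<^sub>e. \<bar>\<L> u\<bar> \<le> C * sqrt (extended_energy m a D u)" by blast
qed

text \<open>The clipped approximants share a bound and converge quasi-everywhere to
  \<open>u'\<close> along a subsequence, hence almost everywhere for both measures. Dominated
  convergence then carries \<open>\<Lambda>_eq\<close> over.\<close>

lemma \<L>_bounded: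
  assumes u: "u \<in> F\<^sub>e" and c: "AE x in m. \<bar>u x\<bar> \<le> c"
    and u': "u' \<in> borel_measurable borel" "qc u'" "AE x in m. u' x = u x"
  shows "integrable \<kappa>1 u'" "integrable \<kappa>2 u'"
    "(\<integral>x. u' x \<partial>\<kappa>1) - (\<integral>x. u' x \<partial>\<kappa>2) = (\<integral>x. f x * u x \<partial>m) + \<L> u"
proof -
  note [measurable] = u'(1) F_measurable[OF u]
  obtain un where un: "approximating m a D u un" using F_E[OF u] by blast
  obtain M where M: "\<And>n. a.nb (un n) \<le> M"
    using a.Cauchy_bounded[OF approximating_D[OF un] approximating_Cauchy[OF un]] by blast
  define c' where "c' = max c 1"
  have c': "0 < c'" "AE x in m. \<bar>u x\<bar> \<le> c'" using c by (auto simp: c'_def elim!: eventually_mono)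
  obtain v where v: "\<And>k. v k \<in> D" "\<And>k. qc (v k)" "\<And>k x. \<bar>v k x\<bar> \<le> c'"
    "approximating m a D (\<lambda>x. clip c' (u x)) v"
    using clip_approximating[OF u un M c'(1)] by blast
  have v_app: "approximating m a D u v"
  proof -
    have "AE x in m. (\<lambda>k. v k x) \<longlonglongrightarrow> u x"
      using approximating_AE[OF v(4)] c'(2)
    proof eventually_elim
      case (elim x)
      then have "clip c' (u x) = u x" by linarith
      then show ?case using elim(1) by simp
    qed
    then show ?thesis using v(4) by (simp add: approximating_iff)
  qed
  have lim_u': "AE x in m. (\<lambda>k. v k x) \<longlonglongrightarrow> u' x"
    using approximating_AE[OF v_app] u'(3) by eventually_elim simp
  obtain r where r: "strict_mono r" "exc {x. \<not> (\<lambda>k. v (r k) x) \<longlonglongrightarrow> u' x}"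
    using qe_convergence[OF v(1,2) approximating_Cauchy[OF v_app] u'(2) lim_u'] by blast
  have [measurable]: "v k \<in> borel_measurable borel" for k using v(1) by measurable
  have dom: "integrable \<kappa> u' \<and> (\<lambda>k. \<integral>x. v (r k) x \<partial>\<kappa>) \<longlonglongrightarrow> (\<integral>x. u' x \<partial>\<kappa>)" if "no_charge \<kappa>" for \<kappa>
  proof -
    have sets_\<kappa> [measurable_cong]: "sets \<kappa> = sets borel" and "finite_measure \<kappa>"
      using that by (auto simp: no_charge_def)
    interpret finite_measure \<kappa> by fact
    have conv: "AE x in \<kappa>. (\<lambda>k. v (r k) x) \<longlonglongrightarrow> u' x" using no_charge_AE[OF that r(2)] by eventually_elim simp
    show ?thesis
    proof
      show "integrable \<kappa> u'"
        by (rule integrable_dominated_convergence[where w = "\<lambda>_. c'", OF _ _ _ conv]) (use v(3) in auto)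
      show "(\<lambda>k. \<integral>x. v (r k) x \<partial>\<kappa>) \<longlonglongrightarrow> (\<integral>x. u' x \<partial>\<kappa>)"
        by (rule integral_dominated_convergence[where w = "\<lambda>_. c'", OF _ _ _ conv]) (use v(3) in auto)
    qed
  qed
  show int: "integrable \<kappa>1 u'" "integrable \<kappa>2 u'" using dom[OF \<kappa>1] dom[OF \<kappa>2] by auto
  have f_lim: "(\<lambda>k. \<integral>x. f x * v (r k) x \<partial>m) \<longlonglongrightarrow> (\<integral>x. f x * u x \<partial>m)"
  proof (rule integral_dominated_convergence[where w = "\<lambda>x. c' * \<bar>f x\<bar>"])
    show "integrable m (\<lambda>x. c' * \<bar>f x\<bar>)" using f_integrable by simp
    show "AE x in m. (\<lambda>k. f x * v (r k) x) \<longlonglongrightarrow> f x * u x"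
      using approximating_AE[OF v_app]
    proof eventually_elim
      case (elim x)
      from LIMSEQ_subseq_LIMSEQ[OF elim r(1)] show ?case by (intro tendsto_intros) (simp add: o_def)
    qed
    show "AE x in m. norm (f x * v (r k) x) \<le> c' * \<bar>f x\<bar>" for k
      using mult_right_mono[OF v(3)[of "r k"], of "\<bar>f _\<bar>"] by (simp add: abs_mult mult.commute)
  qed measurable
  have \<L>_lim: "(\<lambda>k. \<Lambda> (v (r k))) \<longlonglongrightarrow> \<L> u"
    using LIMSEQ_subseq_LIMSEQ[OF \<L>_tendsto[OF v_app] r(1)] by (simp add: o_def)
  have "\<Lambda> (v (r k)) = (\<integral>x. v (r k) x \<partial>\<kappa>1) - (\<integral>x. v (r k) x \<partial>\<kappa>2) - (\<integral>x. f x * v (r k) x \<partial>m)" for k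
    using v(3) by (intro \<Lambda>_eq v(1,2) exI[of _ c']) simp
  moreover have "(\<lambda>k. (\<integral>x. v (r k) x \<partial>\<kappa>1) - (\<integral>x. v (r k) x \<partial>\<kappa>2) - (\<integral>x. f x * v (r k) x \<partial>m)) \<longlonglongrightarrow>
     (\<integral>x. u' x \<partial>\<kappa>1) - (\<integral>x. u' x \<partial>\<kappa>2) - (\<integral>x. f x * u x \<partial>m)"
    using dom[OF \<kappa>1] dom[OF \<kappa>2] f_lim by (intro tendsto_intros) auto
  ultimately have "\<L> u = (\<integral>x. u' x \<partial>\<kappa>1) - (\<integral>x. u' x \<partial>\<kappa>2) - (\<integral>x. f x * u x \<partial>m)"
    using LIMSEQ_unique[OF \<L>_lim] by simp
  then show "(\<integral>x. u' x \<partial>\<kappa>1) - (\<integral>x. u' x \<partial>\<kappa>2) = (\<integral>x. f x * u x \<partial>m) + \<L> u" by simp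
qed

text \<open>Reaches unbounded \<open>u\<close>. Approximants of the clips are close to
  \<open>u\<close> in the weighted L1 norm with bounded energy, but need not be Cauchy. Since
  closeness of \<open>\<Lambda> v\<close> to \<open>l\<close> is a convex constraint, they can be
  repaired to an approximating sequence of \<open>u\<close> along which \<open>\<Lambda>\<close>
  still tends to \<open>l\<close>.\<close>

lemma \<L>_clip:
  assumes u: "u \<in> F\<^sub>e" and lim: "(\<lambda>n. \<L> (\<lambda>x. clip (real (Suc n)) (u x))) \<longlonglongrightarrow> l"
  shows "\<L> u = l"
proof -
  note um [measurable] = F_measurable[OF u]
  obtain un where un: "approximating m a D u un" using F_E[OF u] by blast
  obtain M where M: "\<And>n. a.nb (un n) \<le> M"
    using a.Cauchy_bounded[OF approximating_D[OF un] approximating_Cauchy[OF un]] by blast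
  define S where "S k = {v \<in> D. \<bar>\<Lambda> v - l\<bar> \<le> 1 / Suc k}" for k
  have clip_le: "\<bar>clip (real (Suc n)) y - y\<bar> \<le> \<bar>y\<bar>" for n y by (auto simp: min_def max_def)
  \<comment> \<open>As \<open>u\<close> need not lie in L2, integrability is borrowed from an
    element of \<open>D\<close> close to it.\<close>
  have u_rho: "integrable m (\<lambda>x. \<bar>u x\<bar> * \<rho> x)"
  proof -
    obtain N where "close (un N) u 1"
      using Cauchy_close_limit[OF approximating_D[OF un] approximating_Cauchy[OF un] um approximating_AE[OF un], of 1] by auto
    then have "close u (un N) 1" by (simp add: close_commute)
    then have "close u (\<lambda>x. 0) (1 + 3 * a.nb (\<lambda>x. un N x - 0))"
      by (intro close_triangle[OF um _ _ close_D] approximating_D[OF un] a.zero_in) auto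
    then show ?thesis by (simp add: close_def)
  qed
  have clip_close: "\<exists>N. \<forall>n\<ge>N. close (\<lambda>x. clip (real (Suc n)) (u x)) u \<epsilon>" if "0 < \<epsilon>" for \<epsilon>
  proof -
    have bd: "AE x in m. norm (\<bar>clip (real (Suc n)) (u x) - u x\<bar> * \<rho> x) \<le> \<bar>u x\<bar> * \<rho> x" for n
      using rho_pos by eventually_elim (simp add: abs_mult mult_right_mono clip_le)
    have conv: "AE x in m. (\<lambda>n. \<bar>clip (real (Suc n)) (u x) - u x\<bar> * \<rho> x) \<longlonglongrightarrow> 0"
      by (intro AE_I2 tendsto_mult_left_zero tendsto_rabs_zero LIM_zero clip_tendsto)
    have "(\<lambda>n. \<integral>x. \<bar>clip (real (Suc n)) (u x) - u x\<bar> * \<rho> x \<partial>m) \<longlonglongrightarrow> (\<integral>x. 0 \<partial>m)"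
      by (rule integral_dominated_convergence[OF _ _ u_rho conv bd]) measurable
    from LIMSEQ_D[OF this that] obtain N where
      N: "\<And>n. n \<ge> N \<Longrightarrow> \<bar>\<integral>x. \<bar>clip (real (Suc n)) (u x) - u x\<bar> * \<rho> x \<partial>m\<bar> < \<epsilon>" by auto
    have "close (\<lambda>x. clip (real (Suc n)) (u x)) u \<epsilon>" if "n \<ge> N" for n
    proof (rule close_dominated[where h = "\<lambda>x. \<bar>clip (real (Suc n)) (u x) - u x\<bar> * \<rho> x"])
      show "integrable m (\<lambda>x. \<bar>clip (real (Suc n)) (u x) - u x\<bar> * \<rho> x)"
        by (rule Bochner_Integration.integrable_bound[OF u_rho])
          (measurable, use bd[of n] in eventually_elim, simp)
    qed (use N[OF that] in auto)
    then show ?thesis by blast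
  qed
  have "\<exists>v. (\<forall>k. v k \<in> S k \<and> a.nb (v k) \<le> 2 * M) \<and> approximating m a D u v"
  proof (rule approximating_in_convex[OF um])
    have "1 / real (Suc (Suc k)) \<le> 1 / real (Suc k)" for k by (simp add: frac_le)
    then show "S (Suc k) \<subseteq> S k" for k unfolding S_def using order_trans by blast
    show "(\<lambda>x. (y x + z x) / 2) \<in> S k" if "y \<in> S k" "z \<in> S k" for k y z
    proof -
      have D: "y \<in> D" "z \<in> D" and yz: "\<bar>\<Lambda> y - l\<bar> \<le> 1 / Suc k" "\<bar>\<Lambda> z - l\<bar> \<le> 1 / Suc k" using that by (auto simp: S_def)
      have "\<Lambda> (\<lambda>x. (y x + z x) / 2) = (\<Lambda> y + \<Lambda> z) / 2"
        using \<Lambda>_lincomb[OF D, of "1/2" "1/2"] by (simp add: field_simps)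
      then have "\<bar>\<Lambda> (\<lambda>x. (y x + z x) / 2) - l\<bar> \<le> 1 / Suc k" using abs_mid_le[OF yz] by (simp only:)
      then show ?thesis using a.mid_in[OF D] by (simp add: S_def)
    qed
    fix k :: nat
    define \<eta> where "\<eta> = 1 / real (Suc k)"
    have "0 < \<eta> / 2" "0 < (1/2::real)^k / 2" by (simp_all add: \<eta>_def)
    note pos = this
    obtain N1 where N1: "\<And>n. n \<ge> N1 \<Longrightarrow> close (\<lambda>x. clip (real (Suc n)) (u x)) u ((1/2)^k / 2)"
      using clip_close[OF pos(2)] by blast
    obtain N2 where N2: "\<And>n. n \<ge> N2 \<Longrightarrow> \<bar>\<L> (\<lambda>x. clip (real (Suc n)) (u x)) - l\<bar> < \<eta> / 2"
      using LIMSEQ_D[OF lim pos(1)] by auto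
    define n where "n = max N1 N2"
    define z where "z x = clip (real (Suc n)) (u x)" for x
    have z_u: "close z u ((1/2)^k / 2)" and z_l: "\<bar>\<L> z - l\<bar> < \<eta> / 2"
      using N1[of n] N2[of n] by (simp_all add: n_def z_def[abs_def])
    have zm [measurable]: "z \<in> borel_measurable borel" unfolding z_def by measurable
    obtain v where v: "\<And>k. a.nb (v k) \<le> 2 * M" "approximating m a D z v"
      using clip_approximating[OF u un M, of "real (Suc n)"] unfolding z_def[abs_def] by auto
    note vD = approximating_D[OF v(2)]
    obtain N where N: "\<And>i. i \<ge> N \<Longrightarrow> close (v i) z ((1/2)^k / 2)"
      using Cauchy_close_limit[OF vD approximating_Cauchy[OF v(2)] zm approximating_AE[OF v(2)] pos(2)] by blast
    obtain N' where N': "\<And>i. i \<ge> N' \<Longrightarrow> \<bar>\<Lambda> (v i) - \<L> z\<bar> < \<eta> / 2"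
      using LIMSEQ_D[OF \<L>_tendsto[OF v(2)] pos(1)] by auto
    define i where "i = max N N'"
    have "\<bar>\<Lambda> (v i) - l\<bar> \<le> \<eta>" using N'[of i] z_l unfolding i_def by linarith
    then have "v i \<in> S k" using vD by (simp add: S_def \<eta>_def)
    moreover have "close (v i) u ((1/2)^k / 2 + (1/2)^k / 2)"
      using vD N[of i] by (intro close_triangle[OF _ um _ z_u]) (auto simp: i_def)
    ultimately show "\<exists>v\<in>S k. a.nb v \<le> 2 * M \<and> close v u ((1/2)^k)" using v(1) by auto
  qed (auto simp: S_def)
  then obtain v where v: "\<And>k. v k \<in> S k" "approximating m a D u v" by blast
  have "(\<lambda>k. \<Lambda> (v k) - l) \<longlonglongrightarrow> 0"
  proof (rule Lim_null_comparison)
    show "\<forall>\<^sub>F k in sequentially. norm (\<Lambda> (v k) - l) \<le> 1 / real (Suc k)" using v(1) by (simp add: S_def)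
    show "(\<lambda>n. 1 / real (Suc n)) \<longlonglongrightarrow> 0" using LIMSEQ_Suc[OF lim_1_over_n] .
  qed
  then have "(\<lambda>k. \<Lambda> (v k)) \<longlonglongrightarrow> l" by (simp add: LIM_zero_iff)
  then show ?thesis using LIMSEQ_unique[OF \<L>_tendsto[OF v(2)]] by blast
qed

end

section \<open>Signed measures\<close>

text \<open>A monotone class principle. The uniform bounds handed to the cases
  \<open>lincomb\<close> and \<open>lim\<close> make integrals against finite measures linear and
  allow dominated convergence.\<close>

lemma bounded_borel_induct [consumes 2, case_names set lincomb lim]:
  fixes h :: "'a::topological_space \<Rightarrow> real"
  assumes h: "h \<in> borel_measurable borel" "\<And>x. \<bar>h x\<bar> \<le> c"
    and set: "\<And>A. A \<in> sets borel \<Longrightarrow> P (indicator A)"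
    and lincomb: "\<And>u v s t c. u \<in> borel_measurable borel \<Longrightarrow> v \<in> borel_measurable borel \<Longrightarrow>
       (\<And>x. \<bar>u x\<bar> \<le> c) \<Longrightarrow> (\<And>x. \<bar>v x\<bar> \<le> c) \<Longrightarrow> P u \<Longrightarrow> P v \<Longrightarrow> P (\<lambda>x. s * u x + t * v x)"
    and lim: "\<And>U u c. (\<And>i::nat. U i \<in> borel_measurable borel) \<Longrightarrow> (\<And>i x. \<bar>U i x\<bar> \<le> c) \<Longrightarrow>
       u \<in> borel_measurable borel \<Longrightarrow> (\<And>x. (\<lambda>i. U i x) \<longlonglongrightarrow> u x) \<Longrightarrow> (\<And>i. P (U i)) \<Longrightarrow> P u"
  shows "P h"
proof -
  have zero: "P (\<lambda>x. 0)"
    using lincomb[of "indicator {}" "indicator {}" 0 0 0] set[of "{}"] by simp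
  have pos: "(\<exists>c. \<forall>x. u x \<le> c) \<longrightarrow> P u" if "u \<in> borel_measurable borel" "\<And>x. 0 \<le> u x" for u :: "'a \<Rightarrow> real"
    using that
  proof (induction u rule: borel_measurable_induct_real)
    case (mult u k)
    show ?case
    proof (intro impI, elim exE)
      fix c assume c: "\<forall>x. k * u x \<le> c"
      show "P (\<lambda>x. k * u x)"
      proof (cases "k = 0")
        case False
        then have "u x \<le> c / k" for x using c mult by (simp add: field_simps)
        then show ?thesis using lincomb[of u u "c / k" k 0] mult by fastforce
      qed (use zero in simp)
    qed
  next
    case (add u v)
    show ?case
    proof (intro impI, elim exE)
      fix c assume c: "\<forall>x. v x + u x \<le> c"
      have "0 \<le> u x" "0 \<le> v x" for x using add by auto
      then have uv: "u x \<le> c" "v x \<le> c" for x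
        using c[rule_format, of x] by (smt (verit))+
      have "P u" "P v" using add uv by blast+
      then show "P (\<lambda>x. v x + u x)"
        using lincomb[of v u c 1 1] add uv by simp
    qed
  next
    case (seq U)
    show ?case
    proof (intro impI, elim exE)
      fix c assume c: "\<forall>x. u x \<le> c"
      have inc: "incseq U" by fact
      have nn: "0 \<le> U i x" for i x by fact
      have lim': "(\<lambda>i. U i x) \<longlonglongrightarrow> u x" for x using seq by simp
      have le: "U i x \<le> u x" for i x
        using inc by (intro incseq_le[OF _ lim']) (auto simp: incseq_def le_fun_def)
      have "\<bar>U i x\<bar> \<le> c" for i x using le[of i x] c nn[of i x] by (metis abs_of_nonneg order_trans)
      moreover have "P (U i)" for i using seq.IH[of i] le c order_trans by blast
      moreover have "u \<in> borel_measurable borel" by (rule borel_measurable_LIMSEQ_real[OF lim' seq.hyps(1)])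
      ultimately show "P u" using lim[of U c u] seq.hyps(1) lim' by blast
    qed
  qed (use set in blast)
  have b: "\<bar>max (h x) 0\<bar> \<le> c" "\<bar>max (- h x) 0\<bar> \<le> c" for x
    using h(2)[of x] by linarith+
  have "P (\<lambda>x. max (h x) 0)"
    using pos[of "\<lambda>x. max (h x) 0"] h(1) b(1) by (auto intro: order_trans[OF abs_ge_self])
  moreover have "P (\<lambda>x. max (- h x) 0)"
    using pos[of "\<lambda>x. max (- h x) 0"] h(1) b(2) by (auto intro: order_trans[OF abs_ge_self])
  ultimately have "P (\<lambda>x. 1 * max (h x) 0 + (-1) * max (- h x) 0)"
    using h(1) b by (intro lincomb) auto
  moreover have "(\<lambda>x. 1 * max (h x) 0 + (-1) * max (- h x) 0) = h" by (auto simp: fun_eq_iff)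
  ultimately show ?thesis by simp
qed

lemma finite_pos_part:
  assumes "\<nu> \<in> bounded_measures"
  shows "finite_measure (pos_part \<nu>)" "finite_measure (neg_part \<nu>)" "finite_measure (total_var \<nu>)"
proof -
  have "emeasure (pos_part \<nu>) UNIV + emeasure (neg_part \<nu>) UNIV < \<infinity>" "emeasure (total_var \<nu>) UNIV < \<infinity>"
    using assms emeasure_total_var[of UNIV \<nu>] by (auto simp: bounded_measures_def)
  moreover have "space (pos_part \<nu>) = UNIV" "space (neg_part \<nu>) = UNIV" "space (total_var \<nu>) = UNIV"
    using sets_eq_imp_space_eq[OF sets_pos_part, of \<nu>] sets_eq_imp_space_eq[OF sets_neg_part, of \<nu>]
      sets_eq_imp_space_eq[OF sets_total_var, of \<nu>] by simp_all
  ultimately show "finite_measure (pos_part \<nu>)" "finite_measure (neg_part \<nu>)" "finite_measure (total_var \<nu>)"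
    by (auto intro!: finite_measureI simp: less_top)
qed

text \<open>For \<open>B \<subseteq> A\<close> additivity gives
  \<open>\<nu> B = \<nu> A - \<nu> (A - B)\<close>, and the last term is at most the negative
  variation of \<open>A\<close>; then take the supremum over \<open>B\<close>. Applied to
  \<open>\<nu>\<close> and to its negative, this is the Jordan decomposition.\<close>

lemma jordan_aux:
  assumes \<nu>: "signed_measure \<nu>" and A: "A \<in> sets borel"
    and fin: "upper_var \<nu> A \<noteq> \<infinity>" "upper_var (\<lambda>A. - \<nu> A) A \<noteq> \<infinity>"
  shows "enn2real (upper_var \<nu> A) \<le> \<nu> A + enn2real (upper_var (\<lambda>A. - \<nu> A) A)"
proof -
  define N where "N = enn2real (upper_var (\<lambda>A. - \<nu> A) A)"
  have N: "- \<nu> B \<le> N" if "B \<in> sets borel" "B \<subseteq> A" for B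
  proof -
    have "ennreal (- \<nu> B) \<le> upper_var (\<lambda>A. - \<nu> A) A"
      unfolding upper_var_def using that by (intro SUP_upper) auto
    also have "\<dots> = ennreal N" using fin(2) by (simp add: N_def less_top)
    finally show ?thesis by (cases "0 \<le> - \<nu> B") (auto simp: N_def ennreal_le_iff intro: order_trans[OF _ enn2real_nonneg])
  qed
  have "upper_var \<nu> A \<le> ennreal (\<nu> A + N)"
    unfolding upper_var_def
  proof (intro SUP_least ennreal_leI)
    fix B assume B: "B \<in> {B \<in> sets borel. B \<subseteq> A}"
    then have "\<nu> (B \<union> (A - B)) = \<nu> B + \<nu> (A - B)" using A by (intro signed_measure_add \<nu>) auto
    moreover have "B \<union> (A - B) = A" using B by auto
    ultimately show "\<nu> B \<le> \<nu> A + N" using N[of "A - B"] A B by auto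
  qed
  then have "ennreal (enn2real (upper_var \<nu> A)) \<le> ennreal (\<nu> A + N)" using fin(1) by (simp add: less_top)
  moreover have "0 \<le> \<nu> A + N" using N[OF A] by simp
  ultimately show ?thesis by (simp add: N_def ennreal_le_iff)
qed

lemma jordan_decomposition:
  assumes "\<nu> \<in> bounded_measures" and A: "A \<in> sets borel"
  shows "measure (pos_part \<nu>) A - measure (neg_part \<nu>) A = \<nu> A"
proof -
  have \<nu>: "signed_measure \<nu>" using assms(1) by (simp add: bounded_measures_def)
  interpret p: finite_measure "pos_part \<nu>" by (rule finite_pos_part[OF assms(1)])
  interpret n: finite_measure "neg_part \<nu>" by (rule finite_pos_part[OF assms(1)])
  have p: "upper_var \<nu> A \<noteq> \<infinity>" using p.emeasure_finite[of A] emeasure_pos_part[OF \<nu> A] by simp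
  have n: "upper_var (\<lambda>A. - \<nu> A) A \<noteq> \<infinity>" using n.emeasure_finite[of A] emeasure_neg_part[OF \<nu> A] by simp
  have "enn2real (upper_var \<nu> A) \<le> \<nu> A + enn2real (upper_var (\<lambda>A. - \<nu> A) A)"
    by (rule jordan_aux[OF \<nu> A p n])
  moreover have "enn2real (upper_var (\<lambda>A. - \<nu> A) A) \<le> - \<nu> A + enn2real (upper_var \<nu> A)"
    using jordan_aux[OF signed_measure_uminus[OF \<nu>] A n] p by simp
  ultimately show ?thesis
    by (simp add: measure_def emeasure_pos_part[OF \<nu> A] emeasure_neg_part[OF \<nu> A])
qed

lemma bounded_signed_integrable:
  assumes "\<nu> \<in> bounded_measures" "h \<in> borel_measurable borel" "\<And>x. \<bar>h x\<bar> \<le> c"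
  shows "signed_integrable \<nu> h"
  unfolding signed_integrable_def
  by (rule finite_measure.bounded_L2[OF finite_pos_part(3)[OF assms(1)] _ assms(3)])
    (use assms(2) measurable_cong_sets[OF sets_total_var refl] in blast)

lemma total_var_integrable:
  fixes h :: "'a::topological_space \<Rightarrow> real"
  assumes "integrable (total_var \<nu>) h"
  shows "integrable (pos_part \<nu>) h" "integrable (neg_part \<nu>) h"
proof -
  have le: "emeasure (pos_part \<nu>) A \<le> emeasure (total_var \<nu>) A"
    "emeasure (neg_part \<nu>) A \<le> emeasure (total_var \<nu>) A" if "A \<in> sets borel" for A
    using emeasure_total_var[OF that, of \<nu>] by auto
  have "pos_part \<nu> \<le> total_var \<nu>" "neg_part \<nu> \<le> total_var \<nu>"
    using le by (auto simp: le_measure)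
  then have "(\<integral>\<^sup>+x. ennreal (norm (h x)) \<partial>pos_part \<nu>) \<le> (\<integral>\<^sup>+x. ennreal (norm (h x)) \<partial>total_var \<nu>)"
    "(\<integral>\<^sup>+x. ennreal (norm (h x)) \<partial>neg_part \<nu>) \<le> (\<integral>\<^sup>+x. ennreal (norm (h x)) \<partial>total_var \<nu>)"
    by (intro nn_integral_mono_measure; simp)+
  moreover have "h \<in> borel_measurable (pos_part \<nu>)" "h \<in> borel_measurable (neg_part \<nu>)"
    using borel_measurable_integrable[OF assms] by (simp_all cong: measurable_cong_sets)
  moreover have "(\<integral>\<^sup>+x. ennreal (norm (h x)) \<partial>total_var \<nu>) < \<infinity>"
    using assms unfolding integrable_iff_bounded by (elim conjE)
  ultimately show "integrable (pos_part \<nu>) h" "integrable (neg_part \<nu>) h"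
    unfolding integrable_iff_bounded by (blast intro: le_less_trans)+
qed

lemma signed_measure_diff:
  fixes M N :: "'a::topological_space measure"
  assumes "finite_measure M" "finite_measure N" "sets M = sets borel" "sets N = sets borel"
  shows "signed_measure (\<lambda>A. measure M A - measure N A)"
  unfolding signed_measure_def
proof (intro allI impI sums_diff)
  fix A :: "nat \<Rightarrow> 'a set" assume A: "range A \<subseteq> sets borel" "disjoint_family A"
  show "(\<lambda>n. measure M (A n)) sums measure M (\<Union>n. A n)"
    by (rule finite_measure.finite_measure_UNION[OF assms(1)]) (use A assms(3) in simp_all)
  show "(\<lambda>n. measure N (A n)) sums measure N (\<Union>n. A n)"
    by (rule finite_measure.finite_measure_UNION[OF assms(2)]) (use A assms(4) in simp_all)
qed

lemma signed_measure_diff2: "signed_measure \<mu> \<Longrightarrow> signed_measure \<nu> \<Longrightarrow> signed_measure (\<lambda>A. \<mu> A - \<nu> A)"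
  unfolding signed_measure_def by (auto intro!: sums_diff)

lemma bounded_measuresI:
  assumes "signed_measure \<nu>" "\<And>A. A \<in> sets borel \<Longrightarrow> \<bar>\<nu> A\<bar> \<le> c"
  shows "\<nu> \<in> bounded_measures"
proof -
  have le: "\<nu> A \<le> c" "- \<nu> A \<le> c" if "A \<in> sets borel" for A
    using assms(2)[OF that] by linarith+
  have "upper_var \<nu> UNIV \<le> ennreal c" "upper_var (\<lambda>A. - \<nu> A) UNIV \<le> ennreal c"
    unfolding upper_var_def using le by (auto intro!: SUP_least ennreal_leI)
  then have "emeasure (total_var \<nu>) UNIV \<le> ennreal c + ennreal c"
    using emeasure_total_var[of UNIV \<nu>] emeasure_pos_part[OF assms(1), of UNIV] emeasure_neg_part[OF assms(1), of UNIV]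
    by (simp add: add_mono)
  also have "\<dots> < \<infinity>" by simp
  finally show ?thesis using assms(1) by (simp add: bounded_measures_def)
qed

section \<open>Lusin spaces\<close>

text \<open>Preimages under the continuous bijection are open in a second countable space. For every
  basic set contained in some preimage one member of the cover is chosen.\<close>

lemma lusin_lindelof:
  assumes "lusin_space (euclidean :: 'a::topological_space topology)" and \<U>: "\<And>U. U \<in> \<U> \<Longrightarrow> open (U :: 'a set)"
  shows "\<exists>\<V>\<subseteq>\<U>. countable \<V> \<and> \<Union>\<V> = \<Union>\<U>"
proof -
  obtain Y :: "'a topology" and h where Yh: "second_countable Y" "continuous_map Y euclidean h"
    "bij_betw h (topspace Y) (topspace (euclidean :: 'a topology))"
    using assms(1) unfolding lusin_space_def by (elim conjE exE)
  note Y = Yh(1,2) bij_betw_imp_surj_on[OF Yh(3), unfolded topspace_euclidean]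
  obtain \<B> where B': "countable \<B>" "\<forall>V x. openin Y V \<and> x \<in> V \<longrightarrow> (\<exists>B\<in>\<B>. x \<in> B \<and> B \<subseteq> V)"
    using Y(1) unfolding second_countable_def by (elim conjE exE)
  note B = B'(1) B'(2)[rule_format, OF conjI]
  define \<C> where "\<C> = {B \<in> \<B>. \<exists>U\<in>\<U>. B \<subseteq> {y \<in> topspace Y. h y \<in> U}}"
  have "\<forall>B\<in>\<C>. \<exists>U. U \<in> \<U> \<and> B \<subseteq> {y \<in> topspace Y. h y \<in> U}"
    by (auto simp: \<C>_def)
  from bchoice[OF this] obtain s where s: "\<And>B. B \<in> \<C> \<Longrightarrow> s B \<in> \<U> \<and> B \<subseteq> {y \<in> topspace Y. h y \<in> s B}"
    by blast
  have "\<Union>\<U> \<subseteq> \<Union>(s ` \<C>)"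
  proof
    fix x assume "x \<in> \<Union>\<U>"
    then obtain U where U: "U \<in> \<U>" "x \<in> U" by blast
    obtain y where y: "y \<in> topspace Y" "h y = x" using Y(3) by (metis UNIV_I imageE)
    have "openin Y {y \<in> topspace Y. h y \<in> U}"
      using Y(2) \<U>[OF U(1)] by (intro openin_continuous_map_preimage) auto
    then obtain B where "B \<in> \<B>" "y \<in> B" "B \<subseteq> {y \<in> topspace Y. h y \<in> U}"
      using B(2)[of _ y] U(2) y by blast
    then have "B \<in> \<C>" "y \<in> B" using U(1) by (auto simp: \<C>_def)
    then show "x \<in> \<Union>(s ` \<C>)" using s[of B] y by blast
  qed
  moreover have "s ` \<C> \<subseteq> \<U>" using s by blast
  moreover have "countable (s ` \<C>)" using B(1) by (auto simp: \<C>_def)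
  ultimately show ?thesis by (intro exI[of _ "s ` \<C>"]) blast
qed

section \<open>The decomposition theorem\<close>

text \<open>As a set function, \<open>\<nu>\<close> is \<open>\<kappa>1 - \<kappa>2\<close> minus
  the measure with density \<open>f\<close>. Its functional is \<open>\<L>\<close>: on clipped
  elements by \<open>\<L>_bounded\<close>, and for every integrable version by clipping, dominated
  convergence and \<open>\<L>_clip\<close>.\<close>

lemma (in decomposed_measure) dual_measure:
  "\<exists>\<nu>\<in>dual_bounded_measures m a D. \<forall>h c. h \<in> borel_measurable borel \<longrightarrow> (\<forall>x. \<bar>h x\<bar> \<le> c) \<longrightarrow>
     signed_integral \<nu> h = (\<integral>x. h x \<partial>\<kappa>1) - (\<integral>x. h x \<partial>\<kappa>2) - (\<integral>x. f x * h x \<partial>m)"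
proof -
  define N1 where "N1 = density m (\<lambda>x. ennreal (max 0 (f x)))"
  define N2 where "N2 = density m (\<lambda>x. ennreal (max 0 (- f x)))"
  define \<nu> where "\<nu> A = (measure \<kappa>1 A - measure \<kappa>2 A) - (measure N1 A - measure N2 A)" for A
  have sets_N [measurable_cong, simp]: "sets N1 = sets borel" "sets N2 = sets borel"
    by (simp_all add: N1_def N2_def sets_m)
  have sp: "space m = UNIV" using sets_eq_imp_space_eq[OF sets_m] by simp
  have fin_density: "finite_measure (density m (\<lambda>x. ennreal (max 0 (k x))))" if "integrable m k" for k :: "'a \<Rightarrow> real"
  proof (rule finite_measureI)
    have [measurable]: "k \<in> borel_measurable m" using that by simp
    have "integrable m (\<lambda>x. max 0 (k x))" using that by (intro integrable_max) auto
    then have "(\<integral>\<^sup>+x. ennreal (max 0 (k x)) \<partial>m) < \<infinity>"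
      by (subst nn_integral_eq_integral) auto
    then show "emeasure (density m (\<lambda>x. ennreal (max 0 (k x)))) (space (density m (\<lambda>x. ennreal (max 0 (k x))))) \<noteq> \<infinity>"
      by (simp add: emeasure_density)
  qed
  have fin_N: "finite_measure N1" "finite_measure N2"
    using fin_density[OF f_integrable] fin_density[of "\<lambda>x. - f x"] f_integrable by (simp_all add: N1_def N2_def)
  have N_int: "(\<integral>x. h x \<partial>N1) - (\<integral>x. h x \<partial>N2) = (\<integral>x. f x * h x \<partial>m)"
    if [measurable]: "h \<in> borel_measurable borel" and h: "\<And>x. \<bar>h x\<bar> \<le> c" for h c
  proof -
    have int: "integrable m (\<lambda>x. max 0 (k x) * h x)" if "integrable m k" for k :: "'a \<Rightarrow> real"
      using that h by (intro integrable_mult_bounded integrable_max) auto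
    have "(\<integral>x. h x \<partial>N1) - (\<integral>x. h x \<partial>N2) = (\<integral>x. max 0 (f x) * h x \<partial>m) - (\<integral>x. max 0 (- f x) * h x \<partial>m)"
      unfolding N1_def N2_def by (simp add: integral_density)
    also have "\<dots> = (\<integral>x. max 0 (f x) * h x - max 0 (- f x) * h x \<partial>m)"
      using int[OF f_integrable] int[of "\<lambda>x. - f x"] f_integrable by simp
    also have "(\<lambda>x. max 0 (f x) * h x - max 0 (- f x) * h x) = (\<lambda>x. f x * h x)"
      by (auto simp: fun_eq_iff max_def)
    finally show ?thesis .
  qed
  have \<nu>_bounded: "\<nu> \<in> bounded_measures"
  proof (rule bounded_measuresI)
    show "signed_measure \<nu>"
      unfolding \<nu>_def[abs_def]
      by (intro signed_measure_diff2 signed_measure_diff finite_\<kappa>1 finite_\<kappa>2 fin_N sets_\<kappa>1 sets_\<kappa>2 sets_N)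
    fix A
    have "0 \<le> measure M A" "measure M A \<le> measure M (space M)" if "finite_measure M" for M :: "'a measure"
      using finite_measure.bounded_measure[OF that] by simp_all
    from this[OF finite_\<kappa>1] this[OF finite_\<kappa>2] this[OF fin_N(1)] this[OF fin_N(2)]
    show "\<bar>\<nu> A\<bar> \<le> measure \<kappa>1 (space \<kappa>1) + measure \<kappa>2 (space \<kappa>2) + measure N1 (space N1) + measure N2 (space N2)"
      unfolding \<nu>_def by linarith
  qed
  note fin = finite_\<kappa>1 finite_\<kappa>2 fin_N finite_pos_part(1,2)[OF \<nu>_bounded]
  \<comment> \<open>\<open>signed_integral\<close> uses the Jordan parts of \<open>\<nu>\<close>, in
    which mass shared by the four measures cancels. The identity is therefore checked on indicators
    and extended by the monotone class principle.\<close>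
  have \<nu>_int: "signed_integral \<nu> h = (\<integral>x. h x \<partial>\<kappa>1) - (\<integral>x. h x \<partial>\<kappa>2) - ((\<integral>x. h x \<partial>N1) - (\<integral>x. h x \<partial>N2))"
    if "h \<in> borel_measurable borel" "\<And>x. \<bar>h x\<bar> \<le> c" for h c
    using that
  proof (induction rule: bounded_borel_induct)
    case (set A)
    have "integral\<^sup>L M (indicator A) = measure M A" if "sets M = sets borel" for M :: "'a measure"
      using sets_eq_imp_space_eq[OF that] set by (simp add: that)
    note ind = this[OF sets_\<kappa>1] this[OF sets_\<kappa>2] this[OF sets_N(1)] this[OF sets_N(2)]
      this[OF sets_pos_part] this[OF sets_neg_part]
    show ?case
      unfolding signed_integral_def ind jordan_decomposition[OF \<nu>_bounded set] by (rule \<nu>_def)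
  next
    case (lincomb u v s t c)
    have "(\<integral>x. s * u x + t * v x \<partial>M) = s * (\<integral>x. u x \<partial>M) + t * (\<integral>x. v x \<partial>M)"
      if "finite_measure M" "sets M = sets borel" for M :: "'a measure"
    proof -
      have "u \<in> borel_measurable M" "v \<in> borel_measurable M"
        using lincomb(1,2) measurable_cong_sets[OF that(2) refl] by blast+
      then have "integrable M u" "integrable M v"
        using finite_measure.bounded_L2(2)[OF that(1)] lincomb(3,4) by blast+
      then show ?thesis by simp
    qed
    from this[OF fin(1) sets_\<kappa>1] this[OF fin(2) sets_\<kappa>2] this[OF fin(3) sets_N(1)] this[OF fin(4) sets_N(2)]
      this[OF fin(5) sets_pos_part] this[OF fin(6) sets_neg_part] lincomb(5,6)
    show ?case unfolding signed_integral_def by (simp only:) algebra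
  next
    case (lim U u c)
    have c: "(\<lambda>i. \<integral>x. U i x \<partial>M) \<longlonglongrightarrow> (\<integral>x. u x \<partial>M)"
      if "finite_measure M" "sets M = sets borel" for M :: "'a measure"
    proof (rule integral_dominated_convergence[where w = "\<lambda>_. c"])
      show "u \<in> borel_measurable M" "U i \<in> borel_measurable M" for i
        using lim(1,3) measurable_cong_sets[OF that(2) refl] by blast+
      show "integrable M (\<lambda>_. c)" using that(1) finite_measure.integrable_const by blast
    qed (use lim in auto)
    have "(\<lambda>i. signed_integral \<nu> (U i)) \<longlonglongrightarrow> signed_integral \<nu> u"
      unfolding signed_integral_def by (intro tendsto_diff c fin sets_pos_part sets_neg_part)
    moreover have "(\<lambda>i. signed_integral \<nu> (U i)) \<longlonglongrightarrow>
       (\<integral>x. u x \<partial>\<kappa>1) - (\<integral>x. u x \<partial>\<kappa>2) - ((\<integral>x. u x \<partial>N1) - (\<integral>x. u x \<partial>N2))"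
      unfolding lim(5) by (intro tendsto_diff c fin sets_\<kappa>1 sets_\<kappa>2 sets_N)
    ultimately show ?case by (rule LIMSEQ_unique)
  qed
  have formula: "signed_integral \<nu> h = (\<integral>x. h x \<partial>\<kappa>1) - (\<integral>x. h x \<partial>\<kappa>2) - (\<integral>x. f x * h x \<partial>m)"
    if "h \<in> borel_measurable borel" "\<And>x. \<bar>h x\<bar> \<le> c" for h c
    using \<nu>_int[OF that] N_int[OF that] by simp
  have "\<L> u = signed_integral \<nu> u'"
    if u: "u \<in> F\<^sub>e" and u': "u' \<in> borel_measurable borel" "qc_version m a D u u'" "signed_integrable \<nu> u'" for u u'
  proof (rule \<L>_clip[OF u])
    have q: "qc u'" "AE x in m. u' x = u x" using u'(2) by (auto simp: qc_version_def)
    note [measurable] = u'(1) F_measurable[OF u]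
    obtain un where un: "approximating m a D u un" using F_E[OF u] by blast
    obtain M where M: "\<And>n. a.nb (un n) \<le> M"
      using a.Cauchy_bounded[OF approximating_D[OF un] approximating_Cauchy[OF un]] by blast
    have eq: "\<L> (\<lambda>x. clip (real (Suc n)) (u x)) = signed_integral \<nu> (\<lambda>x. clip (real (Suc n)) (u' x))" for n
    proof -
      obtain v where v: "approximating m a D (\<lambda>x. clip (real (Suc n)) (u x)) v"
        using clip_approximating[OF u un M, of "real (Suc n)"] by auto
      have F: "(\<lambda>x. clip (real (Suc n)) (u x)) \<in> F\<^sub>e" by (rule F_I[OF _ v]) measurable
      have ae: "AE x in m. clip (real (Suc n)) (u' x) = clip (real (Suc n)) (u x)"
        using q(2) by eventually_elim simp
      have bd: "\<bar>clip (real (Suc n)) y\<bar> \<le> real (Suc n)" for y by (rule clip_bounded) simp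
      have "(\<integral>x. clip (real (Suc n)) (u' x) \<partial>\<kappa>1) - (\<integral>x. clip (real (Suc n)) (u' x) \<partial>\<kappa>2) =
         (\<integral>x. f x * clip (real (Suc n)) (u x) \<partial>m) + \<L> (\<lambda>x. clip (real (Suc n)) (u x))"
        by (rule \<L>_bounded(3)[OF F AE_I2[OF bd] _ qc_clip[OF q(1)] ae]) measurable
      moreover have "(\<integral>x. f x * clip (real (Suc n)) (u' x) \<partial>m) = (\<integral>x. f x * clip (real (Suc n)) (u x) \<partial>m)"
        by (rule integral_cong_AE) (measurable, use ae in eventually_elim, simp)
      moreover have "signed_integral \<nu> (\<lambda>x. clip (real (Suc n)) (u' x)) =
         (\<integral>x. clip (real (Suc n)) (u' x) \<partial>\<kappa>1) - (\<integral>x. clip (real (Suc n)) (u' x) \<partial>\<kappa>2) - (\<integral>x. f x * clip (real (Suc n)) (u' x) \<partial>m)"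
        by (rule formula[OF _ bd]) measurable
      ultimately show ?thesis by simp
    qed
    have c: "(\<lambda>n. \<integral>x. clip (real (Suc n)) (u' x) \<partial>M) \<longlonglongrightarrow> (\<integral>x. u' x \<partial>M)"
      if "integrable M u'" "sets M = sets borel" for M :: "'a measure"
    proof (rule integral_dominated_convergence[where w = "\<lambda>x. \<bar>u' x\<bar>"])
      have mM: "borel_measurable M = borel_measurable (borel :: 'a measure)" by (rule measurable_cong_sets[OF that(2) refl])
      show "u' \<in> borel_measurable M" "(\<lambda>x. clip (real (Suc n)) (u' x)) \<in> borel_measurable M" for n
        unfolding mM by measurable
      show "AE x in M. (\<lambda>n. clip (real (Suc n)) (u' x)) \<longlonglongrightarrow> u' x"
        by (intro AE_I2 clip_tendsto)
      have "\<bar>clip (real (Suc n)) y\<bar> \<le> \<bar>y\<bar>" for n y by (auto simp: min_def max_def)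
      then show "AE x in M. norm (clip (real (Suc n)) (u' x)) \<le> \<bar>u' x\<bar>" for n by simp
    qed (use that in simp)
    have int: "integrable (pos_part \<nu>) u'" "integrable (neg_part \<nu>) u'"
      using total_var_integrable u'(3) by (auto simp: signed_integrable_def)
    show "(\<lambda>n. \<L> (\<lambda>x. clip (real (Suc n)) (u x))) \<longlonglongrightarrow> signed_integral \<nu> u'"
      unfolding eq unfolding signed_integral_def
      by (intro tendsto_diff c int sets_pos_part sets_neg_part)
  qed
  then have "\<nu> \<in> dual_bounded_measures m a D"
    unfolding dual_bounded_measures_def using \<nu>_bounded \<L>_dual by blast
  then show ?thesis using formula by blast
qed

context quasi_regular_form
begin

section \<open>The two implications for a symmetric form\<close>

lemma zero_in_F: "(\<lambda>x. 0) \<in> F\<^sub>e"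
proof (rule F_I)
  show "approximating m a D (\<lambda>x. 0) (\<lambda>n x. 0)"
    using a.zero_in by (simp add: approximating_iff a.form_Cauchy_iff a.nb_zero)
qed simp

lemma exc_indicator:
  assumes "exc B"
  shows "qc_version m a D (\<lambda>x. 0) (indicator B)"
proof -
  obtain F where F: "is_nest F" "B \<subseteq> (\<Inter>k. - F k)" using assms unfolding exceptional_def by blast
  have "continuous_on (F k) (indicator B :: 'a \<Rightarrow> real)" for k
    by (rule continuous_on_eq[OF continuous_on_const[of _ 0]]) (use F(2) in \<open>auto simp: indicator_def\<close>)
  then have "qc (indicator B)" using F(1) unfolding quasi_continuous_def by blast
  moreover have "AE x in m. indicator B x = (0::real)" using exc_AE[OF assms] by eventually_elim simp
  ultimately show ?thesis by (simp add: qc_version_def)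
qed

text \<open>Borel subsets of an exceptional set are exceptional, so both upper variations vanish on
  it.\<close>

lemma no_charge_parts:
  assumes \<mu>: "\<mu> \<in> bounded_measures" and zero: "\<And>B. B \<in> sets borel \<Longrightarrow> exc B \<Longrightarrow> \<mu> B = 0"
  shows "no_charge (pos_part \<mu>)" "no_charge (neg_part \<mu>)" "no_charge (total_var \<mu>)"
proof -
  have sm: "signed_measure \<mu>" using \<mu> by (simp add: bounded_measures_def)
  have "emeasure (pos_part \<mu>) B = 0 \<and> emeasure (neg_part \<mu>) B = 0" if B: "B \<in> sets borel" "exc B" for B
  proof -
    have "\<mu> B' = 0" if "B' \<in> sets borel" "B' \<subseteq> B" for B'
      using zero[OF that(1) exc_subset[OF B(2) that(2)]] .
    then have "upper_var \<mu> B = 0" "upper_var (\<lambda>A. - \<mu> A) B = 0"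
      unfolding upper_var_def by (auto intro!: antisym SUP_least)
    then show ?thesis using emeasure_pos_part[OF sm B(1)] emeasure_neg_part[OF sm B(1)] by simp
  qed
  then show "no_charge (pos_part \<mu>)" "no_charge (neg_part \<mu>)" "no_charge (total_var \<mu>)"
    using finite_pos_part[OF \<mu>] by (auto simp: no_charge_def emeasure_total_var)
qed

text \<open>A quasi-continuous version of a bounded class is bounded only quasi-everywhere; this
  allows its replacement by a bounded function under the integral.\<close>

lemma signed_integral_cong_qe:
  assumes \<mu>: "\<mu> \<in> bounded_measures" and zero: "\<And>B. B \<in> sets borel \<Longrightarrow> exc B \<Longrightarrow> \<mu> B = 0"
    and u: "u \<in> borel_measurable borel" and v: "v \<in> borel_measurable borel" "\<And>x. \<bar>v x\<bar> \<le> c"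
    and eq: "exc {x. u x \<noteq> v x}"
  shows "signed_integrable \<mu> u" "signed_integral \<mu> u = signed_integral \<mu> v"
proof -
  note nc = no_charge_parts[OF \<mu> zero]
  have m: "u \<in> borel_measurable M" "v \<in> borel_measurable M" if "sets M = sets borel" for M :: "'a measure"
    using u v(1) measurable_cong_sets[OF that refl] by blast+
  have ae: "AE x in M. v x = u x" if "no_charge M" for M
    using no_charge_AE[OF that eq] by eventually_elim simp
  have "integrable (total_var \<mu>) v"
    using bounded_signed_integrable[OF \<mu> v] by (simp add: signed_integrable_def)
  then show "signed_integrable \<mu> u"
    unfolding signed_integrable_def
    by (rule integrable_cong_AE_imp[OF _ m(1)[OF sets_total_var] ae[OF nc(3)]])
  have "integral\<^sup>L M u = integral\<^sup>L M v" if "no_charge M" for M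
  proof (rule integral_cong_AE)
    have "sets M = sets borel" using that by (simp add: no_charge_def)
    then show "u \<in> borel_measurable M" "v \<in> borel_measurable M" by (rule m)+
    show "AE x in M. u x = v x" using ae[OF that] by eventually_elim simp
  qed
  then show "signed_integral \<mu> u = signed_integral \<mu> v"
    using nc(1,2) by (simp add: signed_integral_def)
qed

lemma smooth_if_decomposition:
  assumes \<mu>: "\<mu> \<in> bounded_measures" and nest: "is_nest F" "\<And>k. compact (F k)"
    and \<nu>: "\<nu> \<in> dual_bounded_measures m a D" and dec: "decomposition m a D \<mu> f \<nu>"
  shows "\<mu> \<in> bounded_smooth_measures m a D"
proof -
  have sm: "signed_measure \<mu>" using \<mu> by (simp add: bounded_measures_def)
  have zero: "\<mu> B = 0" if B: "B \<in> sets borel" "exc B" for B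
  proof -
    have Bm: "(indicator B :: 'a \<Rightarrow> real) \<in> borel_measurable borel" using B(1) by simp
    have "\<exists>c. AE x in m. \<bar>0::real\<bar> \<le> c" by (intro exI[of _ 0]) simp
    then have 1: "signed_integrable \<nu> (indicator B)"
      "signed_integral \<mu> (indicator B) = (\<integral>x. f x * 0 \<partial>m) + signed_integral \<nu> (indicator B)"
      using dec[unfolded decomposition_def, rule_format, OF zero_in_F _ Bm exc_indicator[OF B(2)]] by simp_all
    obtain L where L: "L \<in> extended_dual m a D"
      "\<And>u u'. u \<in> F\<^sub>e \<Longrightarrow> u' \<in> borel_measurable borel \<Longrightarrow> qc_version m a D u u' \<Longrightarrow> signed_integrable \<nu> u' \<Longrightarrow>
         L u = signed_integral \<nu> u'"
      using \<nu> unfolding dual_bounded_measures_def by blast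
    \<comment> \<open>Homogeneity with factor 0 forces \<open>L\<close> to vanish at the zero
      function, one of whose quasi-continuous versions is \<open>indicator B\<close>.\<close>
    have "\<forall>c. \<forall>u\<in>F\<^sub>e. L (\<lambda>x. c * u x) = c * L u" using L(1) by (simp add: extended_dual_def)
    from this[rule_format, OF zero_in_F, of 0] have "signed_integral \<nu> (indicator B) = 0"
      using L(2)[OF zero_in_F Bm exc_indicator[OF B(2)] 1(1)] by simp
    then have "signed_integral \<mu> (indicator B) = 0" using 1(2) by simp
    moreover have "integral\<^sup>L (pos_part \<mu>) (indicator B) = measure (pos_part \<mu>) B"
      "integral\<^sup>L (neg_part \<mu>) (indicator B) = measure (neg_part \<mu>) B"
      using B(1) sets_eq_imp_space_eq[OF sets_pos_part, of \<mu>] sets_eq_imp_space_eq[OF sets_neg_part, of \<mu>] by simp_all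
    ultimately show ?thesis using jordan_decomposition[OF \<mu> B(1)] by (simp add: signed_integral_def)
  qed
  have "no_charge (total_var \<mu>)" using no_charge_parts(3)[OF \<mu> zero] .
  then have "emeasure (total_var \<mu>) B = 0" if "B \<in> sets borel" "exc B" for B
    using that by (simp add: no_charge_def)
  moreover have "emeasure (total_var \<mu>) (F k) < \<infinity>" for k
    using finite_measure.emeasure_finite[OF finite_pos_part(3)[OF \<mu>], of "F k"] by (simp add: less_top)
  ultimately have "smooth m a D (total_var \<mu>)" using nest unfolding smooth_def by auto
  then show ?thesis using \<mu> by (simp add: bounded_smooth_measures_def)
qed

lemma decomposition_if_smooth:
  assumes "\<mu> \<in> bounded_smooth_measures m a D"
  shows "\<exists>f \<nu>. integrable m f \<and> \<nu> \<in> dual_bounded_measures m a D \<and> decomposition m a D \<mu> f \<nu>"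
proof -
  have \<mu>: "\<mu> \<in> bounded_measures" and sm: "smooth m a D (total_var \<mu>)"
    using assms by (auto simp: bounded_smooth_measures_def)
  have zero: "\<mu> B = 0" if "B \<in> sets borel" "exc B" for B
    using sm that emeasure_total_var[OF that(1), of \<mu>] jordan_decomposition[OF \<mu> that(1)]
    unfolding smooth_def by (simp add: measure_def)
  note nc = no_charge_parts[OF \<mu> zero]
  obtain f1 W1 where 1: "integrable m f1" "\<And>n. W1 n \<in> D" "form_Cauchy a W1"
    "\<And>v. v \<in> D \<Longrightarrow> qc v \<Longrightarrow> \<exists>c. \<forall>x. \<bar>v x\<bar> \<le> c \<Longrightarrow>
       (\<lambda>n. a (W1 n) v) \<longlonglongrightarrow> (\<integral>x. v x \<partial>pos_part \<mu>) - (\<integral>x. f1 x * v x \<partial>m)"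
    using decomposition_positive[OF nc(1)] by blast
  obtain f2 W2 where 2: "integrable m f2" "\<And>n. W2 n \<in> D" "form_Cauchy a W2"
    "\<And>v. v \<in> D \<Longrightarrow> qc v \<Longrightarrow> \<exists>c. \<forall>x. \<bar>v x\<bar> \<le> c \<Longrightarrow>
       (\<lambda>n. a (W2 n) v) \<longlonglongrightarrow> (\<integral>x. v x \<partial>neg_part \<mu>) - (\<integral>x. f2 x * v x \<partial>m)"
    using decomposition_positive[OF nc(2)] by blast
  define f where "f x = f1 x - f2 x" for x
  define W where "W n x = 1 * W1 n x + (-1) * W2 n x" for n x
  interpret decomposed_measure m a D g "pos_part \<mu>" "neg_part \<mu>" f W
  proof
    show "form_Cauchy a W" unfolding W_def using 1 2 by (intro a.Cauchy_lincomb)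
    show "W n \<in> D" for n unfolding W_def using 1 2 by (intro a.lincomb_in)
    show "integrable m f" unfolding f_def using 1 2 by simp
    fix v assume v: "v \<in> D" "qc v" "\<exists>c. \<forall>x. \<bar>v x\<bar> \<le> c"
    then obtain c where c: "\<And>x. \<bar>v x\<bar> \<le> c" by blast
    have [measurable]: "v \<in> borel_measurable borel" using v(1) by measurable
    have int: "integrable m (\<lambda>x. k x * v x)" if "integrable m k" for k
      by (rule integrable_mult_bounded[OF that _ c]) measurable
    have W: "(\<lambda>n. a (W n) v) = (\<lambda>n. a (W1 n) v - a (W2 n) v)"
      using a.b_diff[OF 1(2) 2(2) v(1)] by (simp add: W_def[abs_def])
    have lim: "(\<lambda>n. a (W1 n) v - a (W2 n) v) \<longlonglongrightarrow>
      ((\<integral>x. v x \<partial>pos_part \<mu>) - (\<integral>x. f1 x * v x \<partial>m)) - ((\<integral>x. v x \<partial>neg_part \<mu>) - (\<integral>x. f2 x * v x \<partial>m))"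
      by (intro tendsto_diff 1(4) 2(4) v)
    have "(\<integral>x. f x * v x \<partial>m) = (\<integral>x. f1 x * v x \<partial>m) - (\<integral>x. f2 x * v x \<partial>m)"
      using int[OF 1(1)] int[OF 2(1)] by (simp add: f_def left_diff_distrib)
    then have "((\<integral>x. v x \<partial>pos_part \<mu>) - (\<integral>x. f1 x * v x \<partial>m)) - ((\<integral>x. v x \<partial>neg_part \<mu>) - (\<integral>x. f2 x * v x \<partial>m)) =
      (\<integral>x. v x \<partial>pos_part \<mu>) - (\<integral>x. v x \<partial>neg_part \<mu>) - (\<integral>x. f x * v x \<partial>m)"
      by simp
    with lim show "(\<lambda>n. a (W n) v) \<longlonglongrightarrow>
      (\<integral>x. v x \<partial>pos_part \<mu>) - (\<integral>x. v x \<partial>neg_part \<mu>) - (\<integral>x. f x * v x \<partial>m)"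
      unfolding W by (simp only:)
  qed (use nc in auto)
  obtain \<nu> where \<nu>: "\<nu> \<in> dual_bounded_measures m a D"
    "\<And>h c. h \<in> borel_measurable borel \<Longrightarrow> (\<And>x. \<bar>h x\<bar> \<le> c) \<Longrightarrow>
     signed_integral \<nu> h = (\<integral>x. h x \<partial>pos_part \<mu>) - (\<integral>x. h x \<partial>neg_part \<mu>) - (\<integral>x. f x * h x \<partial>m)"
    using dual_measure by blast
  have \<nu>b: "\<nu> \<in> bounded_measures" using \<nu>(1) by (simp add: dual_bounded_measures_def)
  \<comment> \<open>\<open>\<nu>\<close> is known through its integrals of bounded Borel functions;
    indicators show that it charges no exceptional set, so versions may be changed there for
    \<open>\<nu>\<close> as well as for \<open>\<mu>\<close>.\<close>
  have \<nu>_zero: "\<nu> B = 0" if B: "B \<in> sets borel" "exc B" for B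
  proof -
    have ind: "integral\<^sup>L M (indicator B) = measure M B" if "sets M = sets borel" for M :: "'a measure"
      using sets_eq_imp_space_eq[OF that] B(1) by (simp add: that)
    have "(\<integral>x. f x * indicator B x \<partial>m) = 0"
      by (rule integral_eq_zero_AE) (use exc_AE[OF B(2)] in eventually_elim, simp)
    then have "signed_integral \<nu> (indicator B) = measure (pos_part \<mu>) B - measure (neg_part \<mu>) B"
      using \<nu>(2)[of "indicator B" 1] B(1) ind[OF sets_pos_part, of \<mu>] ind[OF sets_neg_part, of \<mu>] by simp
    also have "\<dots> = 0" using jordan_decomposition[OF \<mu> B(1)] zero[OF B] by simp
    finally show ?thesis
      unfolding signed_integral_def ind[OF sets_pos_part] ind[OF sets_neg_part]
      using jordan_decomposition[OF \<nu>b B(1)] by simp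
  qed
  have "decomposition m a D \<mu> f \<nu>"
    unfolding decomposition_def
  proof (intro ballI impI, elim exE)
    fix u u' c
    assume u: "u \<in> F\<^sub>e" and c: "AE x in m. \<bar>u x\<bar> \<le> c"
      and u': "u' \<in> borel_measurable borel" "qc_version m a D u u'"
    note [measurable] = u'(1) F_measurable[OF u]
    have q: "qc u'" "AE x in m. u' x = u x" using u'(2) by (auto simp: qc_version_def)
    \<comment> \<open>The clip is bounded everywhere and, by quasi-continuity, differs from
      \<open>u'\<close> only on an exceptional set; \<open>max\<close> keeps the level
      nonnegative.\<close>
    define h where "h x = clip (max c 0) (u' x)" for x
    have hm [measurable]: "h \<in> borel_measurable borel" unfolding h_def by measurable
    have hb: "\<bar>h x\<bar> \<le> max c 0" for x unfolding h_def by (rule clip_bounded) simp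
    have hu: "AE x in m. h x = u x" using q(2) c by eventually_elim (auto simp: h_def min_def max_def)
    have hu': "AE x in m. u' x = h x" using q(2) hu by eventually_elim simp
    have "exc {x. u' x \<noteq> h x}"
      by (rule qc_unique[OF q(1) _ hu']) (unfold h_def, rule qc_clip[OF q(1)])
    note \<mu>_eq = signed_integral_cong_qe[OF \<mu> zero u'(1) hm hb this]
      and \<nu>_eq = signed_integral_cong_qe[OF \<nu>b \<nu>_zero u'(1) hm hb this]
    have "(\<integral>x. f x * h x \<partial>m) = (\<integral>x. f x * u x \<partial>m)"
      by (rule integral_cong_AE) (measurable, use hu in eventually_elim, simp)
    then have "signed_integral \<nu> h = signed_integral \<mu> h - (\<integral>x. f x * u x \<partial>m)"
      using \<nu>(2)[OF hm hb] by (simp add: signed_integral_def)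
    then show "signed_integrable \<mu> u' \<and> signed_integrable \<nu> u' \<and>
        signed_integral \<mu> u' = (\<integral>x. f x * u x \<partial>m) + signed_integral \<nu> u'"
      using \<mu>_eq \<nu>_eq by simp
  qed
  then show ?thesis using f_integrable \<nu>(1) by blast
qed

end

section \<open>Invariance of all notions under passing to the symmetric part\<close>

lemma sym_part_diag [simp]: "sym_part \<E> u u = \<E> u u"
  by (simp add: sym_part_def)

lemma sym_part_sym_part [simp]: "sym_part (sym_part \<E>) = sym_part \<E>"
  by (simp add: sym_part_def fun_eq_iff add.commute)

lemma form_dense_sym_part: "form_dense m (sym_part \<E>) D = form_dense m \<E> D"
  by (simp add: form_dense_def fun_eq_iff form_alpha_def)

lemma nest_sym_part: "nest m (sym_part \<E>) D = nest m \<E> D"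
  by (simp add: nest_def fun_eq_iff form_dense_sym_part)

lemma exceptional_sym_part: "exceptional m (sym_part \<E>) D = exceptional m \<E> D"
  by (simp add: exceptional_def fun_eq_iff nest_sym_part)

lemma qc_version_sym_part: "qc_version m (sym_part \<E>) D = qc_version m \<E> D"
  by (simp add: qc_version_def quasi_continuous_def fun_eq_iff nest_sym_part)

lemma extended_domain_sym_part: "extended_domain m (sym_part \<E>) D = extended_domain m \<E> D"
  by (simp add: extended_domain_def approximating_def)

lemma extended_dual_sym_part: "extended_dual m (sym_part \<E>) D = extended_dual m \<E> D"
  by (simp add: extended_dual_def extended_domain_sym_part extended_energy_def approximating_def)

lemma bounded_smooth_measures_sym_part:
  "bounded_smooth_measures m (sym_part \<E>) D = bounded_smooth_measures m \<E> D"
  by (simp add: bounded_smooth_measures_def smooth_def nest_sym_part exceptional_sym_part)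

lemma dual_bounded_measures_sym_part:
  "dual_bounded_measures m (sym_part \<E>) D = dual_bounded_measures m \<E> D"
  by (simp add: dual_bounded_measures_def extended_dual_sym_part extended_domain_sym_part qc_version_sym_part)

lemma decomposition_sym_part: "decomposition m (sym_part \<E>) D = decomposition m \<E> D"
  by (simp add: decomposition_def fun_eq_iff extended_domain_sym_part qc_version_sym_part)

lemma quasi_regular_form_sym_part:
  fixes m :: "'a::metric_space measure"
  assumes "lusin_space (euclidean :: 'a topology)"
    and m: "sets m = sets borel"
    and dir: "dirichlet_form m \<E> D" and qr: "quasi_regular m \<E> D"
    and g: "integrable m g" "bounded (range g)" "AE x in m. 0 < g x"
      "\<And>u. u \<in> D \<Longrightarrow> (\<integral>x. \<bar>u x\<bar> * g x \<partial>m) \<le> sqrt (\<E> u u)"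
  shows "quasi_regular_form m (sym_part \<E>) D g"
proof -
  have bil: "bilinear_form_on m \<E> D" using dir by (simp add: dirichlet_form_def)
  have nn: "0 \<le> sym_part \<E> u u" if "u \<in> D" for u
    using dir that unfolding dirichlet_form_def by blast
  have bil': "bilinear_form_on m (sym_part \<E>) D"
  proof -
    have *: "\<E> u v = \<E> u' v \<and> \<E> v u = \<E> v u'" if "u \<in> D" "u' \<in> D" "v \<in> D" "AE x in m. u x = u' x" for u u' v
      using bil that unfolding bilinear_form_on_def by blast
    have **: "\<E> (\<lambda>x. u x + u' x) v = \<E> u v + \<E> u' v \<and> \<E> v (\<lambda>x. u x + u' x) = \<E> v u + \<E> v u'"
      if "u \<in> D" "u' \<in> D" "v \<in> D" for u u' v
      using bil that unfolding bilinear_form_on_def by blast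
    have ***: "\<E> (\<lambda>x. c * u x) v = c * \<E> u v \<and> \<E> v (\<lambda>x. c * u x) = c * \<E> v u" if "u \<in> D" "v \<in> D" for c u v
      using bil that unfolding bilinear_form_on_def by blast
    have "\<forall>u\<in>D. \<forall>u'\<in>D. \<forall>v\<in>D. (AE x in m. u x = u' x) \<longrightarrow>
        sym_part \<E> u v = sym_part \<E> u' v \<and> sym_part \<E> v u = sym_part \<E> v u'"
      unfolding sym_part_def using * by metis
    moreover have "\<forall>u\<in>D. \<forall>u'\<in>D. \<forall>v\<in>D. sym_part \<E> (\<lambda>x. u x + u' x) v = sym_part \<E> u v + sym_part \<E> u' v \<and>
        sym_part \<E> v (\<lambda>x. u x + u' x) = sym_part \<E> v u + sym_part \<E> v u'"
      by (simp add: sym_part_def ** add_divide_distrib)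
    moreover have "\<forall>c. \<forall>u\<in>D. \<forall>v\<in>D. sym_part \<E> (\<lambda>x. c * u x) v = c * sym_part \<E> u v \<and>
        sym_part \<E> v (\<lambda>x. c * u x) = c * sym_part \<E> v u"
      by (simp add: sym_part_def *** distrib_left)
    ultimately show ?thesis using bil unfolding bilinear_form_on_def by (elim conjE, intro conjI)
  qed
  have sym: "sym_part \<E> u v = sym_part \<E> v u" for u v by (simp add: sym_part_def)
  interpret psd_form D "sym_part \<E>"
  proof
    show "(\<lambda>x. 0) \<in> D" using bil unfolding bilinear_form_on_def by blast
    show "(\<lambda>x. u x + v x) \<in> D" if "u \<in> D" "v \<in> D" for u v
      using bil that unfolding bilinear_form_on_def by blast
    show "(\<lambda>x. c * u x) \<in> D" if "u \<in> D" for c u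
      using bil that unfolding bilinear_form_on_def by blast
    show "sym_part \<E> (\<lambda>x. u x + u' x) v = sym_part \<E> u v + sym_part \<E> u' v"
      if "u \<in> D" "u' \<in> D" "v \<in> D" for u u' v
      using bil' that unfolding bilinear_form_on_def by blast
    show "sym_part \<E> (\<lambda>x. c * u x) v = c * sym_part \<E> u v" if "u \<in> D" "v \<in> D" for c u v
      using bil' that unfolding bilinear_form_on_def by blast
  qed (use sym nn in auto)
  show ?thesis
  proof
    show "closed_form m (sym_part \<E>) D" "dense_in_L2 m D" using dir by (simp_all add: dirichlet_form_def)
    fix u assume u: "u \<in> D"
    define v where "v = unit_contraction u"
    have v: "v \<in> D" "0 \<le> \<E> (\<lambda>x. u x + v x) (\<lambda>x. u x - v x)" "0 \<le> \<E> (\<lambda>x. u x - v x) (\<lambda>x. u x + v x)"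
      using dir u unfolding dirichlet_form_def v_def by blast+
    show "unit_contraction u \<in> D" using v(1) by (simp add: v_def)
    \<comment> \<open>Averaging the two contraction inequalities symmetrizes the product, and the
      mixed terms cancel, leaving the difference of the two energies.\<close>
    have "0 \<le> sym_part \<E> (\<lambda>x. u x + v x) (\<lambda>x. u x - v x)" using v by (simp add: sym_part_def)
    also have "\<dots> = sym_part \<E> u u - sym_part \<E> v v"
      using u v(1) by (simp only: b_diff_right[OF u v(1) add_in[OF u v(1)]] b_add[OF u v(1) u]
          b_add[OF u v(1) v(1)] sym[of v u] add_diff_cancel_left add_diff_cancel_right)
    finally show "sym_part \<E> (unit_contraction u) (unit_contraction u) \<le> sym_part \<E> u u"
      unfolding v_def by linarith
  next
    show "(\<integral>x. \<bar>u x\<bar> * g x \<partial>m) \<le> nb u" if "u \<in> D" for u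
      using g(4)[OF that] by (simp add: nb_def)
    show "\<exists>A. form_dense m (sym_part \<E>) D A \<and> (\<forall>u\<in>A. \<exists>u'. qc_version m (sym_part \<E>) D u u')"
      using qr unfolding quasi_regular_def qc_version_sym_part by blast
    show "\<exists>\<V>\<subseteq>\<U>. countable \<V> \<and> \<Union>\<V> = \<Union>\<U>" if "\<And>U. U \<in> \<U> \<Longrightarrow> open U" for \<U> :: "'a set set"
      using lusin_lindelof[OF assms(1) that] .
  qed (rule m bil' nn g(1-3) sym | assumption)+
qed

theorem theorem3p2:
  fixes m :: "'a::metric_space measure"
    and \<E> :: "('a \<Rightarrow> real) \<Rightarrow> ('a \<Rightarrow> real) \<Rightarrow> real"
    and D :: "('a \<Rightarrow> real) set"
    and \<mu> :: "'a set \<Rightarrow> real"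
  assumes "lusin_space (euclidean :: 'a topology)"
    and "sets m = sets borel" and "sigma_finite_measure m" and "full_support m"
    and "dirichlet_form m \<E> D" and "quasi_regular m \<E> D" and "transient m \<E> D"
    and "\<mu> \<in> bounded_measures"
  shows "\<mu> \<in> bounded_smooth_measures m \<E> D \<longleftrightarrow>
    (\<exists>f \<nu>. integrable m f \<and> \<nu> \<in> dual_bounded_measures m \<E> D \<and> decomposition m \<E> D \<mu> f \<nu>)"
proof -
  obtain g where g: "integrable m g" "bounded (range g)" "AE x in m. 0 < g x"
      "\<And>u. u \<in> D \<Longrightarrow> (\<integral>x. \<bar>u x\<bar> * g x \<partial>m) \<le> sqrt (\<E> u u)"
    using assms(7) unfolding transient_def by blast
  interpret quasi_regular_form m "sym_part \<E>" D g
    by (rule quasi_regular_form_sym_part[OF assms(1,2,5,6) g])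
  obtain F where F: "nest m \<E> D F" "\<And>k. compact (F k)"
    using assms(6) unfolding quasi_regular_def by blast
  note eqs = bounded_smooth_measures_sym_part dual_bounded_measures_sym_part decomposition_sym_part nest_sym_part
  show ?thesis
    using decomposition_if_smooth[of \<mu>, unfolded eqs] smooth_if_decomposition[OF assms(8), unfolded eqs, OF F]
    by blast
qed

end
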